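(* Fix $p_1,p_2\in(-1,1)$. For all $\epsilon\in(0,1]$, $\ell\in\mathbb Z^+$, $\theta_0\in[0,1)$ and closed convex sets $K_1,K_2\subseteq[0,1]^\ell$, there exist $n_0\in\mathbb Z^+$, $d\in\mathbb Z^+$ and $\tau\in(0,1)$ such that the following holds. For all $n\ge n_0$ there exist mappings $$T_1:\{f:\{+1,-1\}^n\to K_1\}\to\{F:\mathbb R^n\to K_1\},\qquad T_2:\{g:\{+1,-1\}^n\to K_2\}\to\{G:\mathbb R^n\to K_2\}$$ such that for all $\theta\in[-\theta_0,\theta_0]$ (for which $N_{p_1,p_2,\theta}$ is a valid distribution), if $f,g$ satisfy $$\max_{i\in[n]}\min\Big(\max_{j\in[\ell]}\mathrm{Inf}_i^{\le d}(f_j),\ \max_{j\in[\ell]}\mathrm{Inf}_i^{\le d}(g_j)\Big)\le\tau,$$ then for $F=T_1(f)$ and $G=T_2(g)$, $$\Big|\mathbb E_{(x,y)\sim N^{\otimes n}}\langle f(x),g(y)\rangle-\mathbb E_{(X,Y)\sim\mathcal G^{\otimes n}}\langle F(X),G(Y)\rangle\Big|\le\epsilon,$$ where $N=N_{p_1,p_2,\theta}$ and $\mathcal G$ is the bivariate Gaussian distribution matching the first and second moments of $N$.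
   Context: For $p_1,p_2,\theta\in[-1,1]$ (such that all the following are in $[0,1]$), $N_{p_1,p_2,\theta}$ is the distribution on $\{+1,-1\}^2$ giving $(+1,+1)$ probability $\frac{1+\theta}4+\frac{p_1+p_2}4$, $(+1,-1)$ probability $\frac{1-\theta}4+\frac{p_1-p_2}4$, $(-1,+1)$ probability $\frac{1-\theta}4-\frac{p_1-p_2}4$, $(-1,-1)$ probability $\frac{1+\theta}4-\frac{p_1+p_2}4$; so $\mathbb E[x]=p_1$, $\mathbb E[y]=p_2$, $\mathbb E[xy]=\theta$. $\mathcal G$ is the Gaussian distribution of $(X,Y)\in\mathbb R^2$ with $\mathbb E[X]=p_1$, $\mathbb E[Y]=p_2$, $\mathbb E[X^2]=\mathbb E[Y^2]=1$, $\mathbb E[XY]=\theta$. $f_j,g_j$ are coordinate functions of $f,g$; $\langle\cdot,\cdot\rangle$ is the inner product on $\mathbb R^\ell$. Low-degree influence: for a distribution $\mu$ on $\{+1,-1\}$ with mean $p\in(-1,1)$, let $\chi(z)=(z-p)/\sqrt{1-p^2}$; every $h:\{+1,-1\}^n\to\mathbb R$ has a unique expansion $h=\sum_{S\subseteq[n]}\hat h(S)\prod_{i\in S}\chi(z_i)$ and $\mathrm{Inf}^{\le d}_i(h)=\sum_{S\ni i,|S|\le d}\hat h(S)^2$. Influences of $f_j$ are taken with respect to the product of the $x$-marginal of $N$ (mean $p_1$), those of $g_j$ with respect to the product of the $y$-marginal (mean $p_2$). *)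

theory Defs
  imports "HOL-Probability.Probability"
begin

section \<open>Correlated biased bits\<close>

definition pair_mass :: "real \<Rightarrow> real \<Rightarrow> real \<Rightarrow> real \<times> real \<Rightarrow> real" where
  "pair_mass p1 p2 \<theta> z =
     (if z = (1, 1) then (1 + \<theta>) / 4 + (p1 + p2) / 4
      else if z = (1, -1) then (1 - \<theta>) / 4 + (p1 - p2) / 4
      else if z = (-1, 1) then (1 - \<theta>) / 4 - (p1 - p2) / 4
      else if z = (-1, -1) then (1 + \<theta>) / 4 - (p1 + p2) / 4
      else 0)"

definition valid_pair :: "real \<Rightarrow> real \<Rightarrow> real \<Rightarrow> bool" where
  "valid_pair p1 p2 \<theta> \<longleftrightarrow> (\<forall>z. pair_mass p1 p2 \<theta> z \<in> {0..1})"

text \<open>Meaningful only under \<^const>\<open>valid_pair\<close>; see \<open>pmf_biased_pair\<close> below.\<close>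

definition biased_pair :: "real \<Rightarrow> real \<Rightarrow> real \<Rightarrow> (real \<times> real) pmf" where
  "biased_pair p1 p2 \<theta> = embed_pmf (pair_mass p1 p2 \<theta>)"

lemma pair_mass_outside: "z \<notin> {-1, 1} \<times> {-1, 1} \<Longrightarrow> pair_mass p1 p2 \<theta> z = 0"
  by (auto simp: pair_mass_def)

lemma pmf_biased_pair:
  assumes "valid_pair p1 p2 \<theta>"
  shows "pmf (biased_pair p1 p2 \<theta>) z = pair_mass p1 p2 \<theta> z"
  unfolding biased_pair_def
proof (rule pmf_embed_pmf)
  show nn: "0 \<le> pair_mass p1 p2 \<theta> z" for z
    using assms by (cases z) (simp add: valid_pair_def)
  let ?A = "{-1, 1} \<times> {-1, 1} :: (real \<times> real) set"
  have "(\<integral>\<^sup>+z. ennreal (pair_mass p1 p2 \<theta> z) \<partial>count_space UNIV)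
      = (\<Sum>z\<in>?A. ennreal (pair_mass p1 p2 \<theta> z))"
    by (rule nn_integral_count_space') (auto simp: pair_mass_outside)
  also have "\<dots> = ennreal (\<Sum>z\<in>?A. pair_mass p1 p2 \<theta> z)"
    using nn by (rule sum_ennreal)
  also have "(\<Sum>z\<in>?A. pair_mass p1 p2 \<theta> z) = 1"
    by (simp add: pair_mass_def sum.cartesian_product[symmetric] field_simps)
  finally show "(\<integral>\<^sup>+z. ennreal (pair_mass p1 p2 \<theta> z) \<partial>count_space UNIV) = 1"
    by simp
qed

lemma set_biased_pair:
  assumes "valid_pair p1 p2 \<theta>"
  shows "set_pmf (biased_pair p1 p2 \<theta>) \<subseteq> {-1, 1} \<times> {-1, 1}"
  using pmf_biased_pair[OF assms] pair_mass_outside by (fastforce simp: set_pmf_iff)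

lemma biased_pair_moments:
  assumes "valid_pair p1 p2 \<theta>"
  shows "measure_pmf.expectation (biased_pair p1 p2 \<theta>) fst = p1"
    and "measure_pmf.expectation (biased_pair p1 p2 \<theta>) snd = p2"
    and "measure_pmf.expectation (biased_pair p1 p2 \<theta>) (\<lambda>(x, y). x * y) = \<theta>"
proof -
  have *: "measure_pmf.expectation (biased_pair p1 p2 \<theta>) h
      = (\<Sum>z\<in>{-1, 1} \<times> {-1, 1}. h z * pair_mass p1 p2 \<theta> z)" for h :: "real \<times> real \<Rightarrow> real"
    using set_biased_pair[OF assms]
    by (subst integral_measure_pmf_real[where A = "{-1, 1} \<times> {-1, 1}"])
       (auto simp: pmf_biased_pair[OF assms])
  show "measure_pmf.expectation (biased_pair p1 p2 \<theta>) fst = p1"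
       "measure_pmf.expectation (biased_pair p1 p2 \<theta>) snd = p2"
       "measure_pmf.expectation (biased_pair p1 p2 \<theta>) (\<lambda>(x, y). x * y) = \<theta>"
    unfolding * by (simp_all add: pair_mass_def sum.cartesian_product[symmetric] field_simps)
qed


section \<open>The bivariate Gaussian with matching moments\<close>

text \<open>
  Law of the affine image of two independent standard Gaussians \<open>u\<close>, \<open>v\<close> whose mean vector is
  \<open>(m1, m2)\<close> and whose covariance matrix has diagonal \<open>(v1, v2)\<close> and off-diagonal entry \<open>c\<close>
  (Cholesky factorisation). Intended for \<open>v1 > 0\<close> and \<open>c\<^sup>2 \<le> v1 * v2\<close>.
\<close>

definition std_gaussian :: "real measure" where
  "std_gaussian = density lborel std_normal_density"

definition bivariate_gaussian ::
  "real \<Rightarrow> real \<Rightarrow> real \<Rightarrow> real \<Rightarrow> real \<Rightarrow> (real \<times> real) measure" where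
  "bivariate_gaussian m1 m2 v1 v2 c =
     distr (std_gaussian \<Otimes>\<^sub>M std_gaussian) borel
       (\<lambda>(u, v). (m1 + sqrt v1 * u, m2 + c / sqrt v1 * u + sqrt (v2 - c\<^sup>2 / v1) * v))"

definition matching_gaussian :: "real \<Rightarrow> real \<Rightarrow> real \<Rightarrow> (real \<times> real) measure" where
  "matching_gaussian p1 p2 \<theta> =
     bivariate_gaussian p1 p2 (1 - p1\<^sup>2) (1 - p2\<^sup>2) (\<theta> - p1 * p2)"

lemma prob_space_std_gaussian: "prob_space std_gaussian"
  unfolding std_gaussian_def by (rule prob_space_normal_density) simp

lemma sets_std_gaussian [measurable_cong, simp]: "sets std_gaussian = sets borel"
  by (simp add: std_gaussian_def)

lemma std_gaussian_moments:
  shows "integrable std_gaussian (\<lambda>u. u ^ k)"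
    and "integral\<^sup>L std_gaussian (\<lambda>u. u) = 0"
    and "integral\<^sup>L std_gaussian (\<lambda>u. u\<^sup>2) = 1"
proof -
  show "integrable std_gaussian (\<lambda>u. u ^ k)"
    unfolding std_gaussian_def
    by (subst integrable_real_density) (auto intro: integrable_std_normal_moment)
  show "integral\<^sup>L std_gaussian (\<lambda>u. u) = 0"
    unfolding std_gaussian_def
    using integral_std_normal_moment_odd[of 0] by (subst integral_real_density) auto
  show "integral\<^sup>L std_gaussian (\<lambda>u. u\<^sup>2) = 1"
    unfolding std_gaussian_def
    using integral_std_normal_moment_even[of 1] by (subst integral_real_density) auto
qed

lemma sets_bivariate_gaussian [measurable_cong, simp]:
  "sets (bivariate_gaussian m1 m2 v1 v2 c) = sets borel"
  by (simp add: bivariate_gaussian_def)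

lemma bivariate_gaussian_map_measurable:
  "(\<lambda>(u, v). (m1 + a * u, m2 + b * u + d * v)) \<in> borel_measurable (std_gaussian \<Otimes>\<^sub>M std_gaussian)"
  for m1 m2 a b d :: real
  unfolding borel_prod[symmetric] by measurable

lemma prob_space_bivariate_gaussian: "prob_space (bivariate_gaussian m1 m2 v1 v2 c)"
proof -
  interpret S: prob_space std_gaussian by (rule prob_space_std_gaussian)
  interpret P: pair_prob_space std_gaussian std_gaussian ..
  show ?thesis
    unfolding bivariate_gaussian_def
    by (rule P.prob_space_distr) (rule bivariate_gaussian_map_measurable)
qed

lemma std_gaussian_pair_integral:
  fixes a0 a1 a2 a11 a12 a22 :: real
  shows "has_bochner_integral (std_gaussian \<Otimes>\<^sub>M std_gaussian)
    (\<lambda>z. a0 + a1 * fst z + a2 * snd z + a11 * (fst z)\<^sup>2 + a12 * (fst z * snd z) + a22 * (snd z)\<^sup>2)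
    (a0 + a11 + a22)"
proof -
  interpret S: prob_space std_gaussian by (rule prob_space_std_gaussian)
  interpret P: pair_prob_space std_gaussian std_gaussian ..
  have mon: "has_bochner_integral (std_gaussian \<Otimes>\<^sub>M std_gaussian) (\<lambda>z. f (fst z) * g (snd z))
     (integral\<^sup>L std_gaussian f * integral\<^sup>L std_gaussian g)"
    if f: "integrable std_gaussian f" and g: "integrable std_gaussian g" for f g :: "real \<Rightarrow> real"
  proof -
    have [measurable]: "f \<in> borel_measurable borel" "g \<in> borel_measurable borel"
      using borel_measurable_integrable[OF f] borel_measurable_integrable[OF g] by simp_all
    have i: "integrable (std_gaussian \<Otimes>\<^sub>M std_gaussian) (\<lambda>z. f (fst z) * g (snd z))"
    proof (rule P.Fubini_integrable)
      show "integrable std_gaussian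
          (\<lambda>x. LINT y|std_gaussian. norm (f (fst (x, y)) * g (snd (x, y))))"
        using f by (simp add: abs_mult)
    qed (use g in auto)
    show ?thesis
      using P.integral_fst'[OF i] i by (simp add: has_bochner_integral_iff)
  qed
  have I: "integrable std_gaussian (\<lambda>u. 1::real)" "integrable std_gaussian (\<lambda>u. u)"
    "integrable std_gaussian (\<lambda>u. u\<^sup>2)"
    using std_gaussian_moments(1)[of 0] std_gaussian_moments(1)[of 1]
      std_gaussian_moments(1)[of 2] by simp_all
  have "has_bochner_integral (std_gaussian \<Otimes>\<^sub>M std_gaussian)
    (\<lambda>z. a0 * (1 * 1) + a1 * (fst z * 1) + a2 * (1 * snd z) + a11 * ((fst z)\<^sup>2 * 1)
         + a12 * (fst z * snd z) + a22 * (1 * (snd z)\<^sup>2))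
    (a0 * (1 * 1) + a1 * (0 * 1) + a2 * (1 * 0) + a11 * (1 * 1) + a12 * (0 * 0) + a22 * (1 * 1))"
    using mon[OF I(1) I(1)] mon[OF I(2) I(1)] mon[OF I(1) I(2)] mon[OF I(3) I(1)]
      mon[OF I(2) I(2)] mon[OF I(1) I(3)]
    by (intro has_bochner_integral_add has_bochner_integral_mult_right)
       (simp_all add: std_gaussian_moments S.prob_space)
  then show ?thesis by simp
qed

lemma bivariate_gaussian_moments:
  assumes "v1 > 0" and "c\<^sup>2 \<le> v1 * v2"
  shows "has_bochner_integral (bivariate_gaussian m1 m2 v1 v2 c) fst m1"
    and "has_bochner_integral (bivariate_gaussian m1 m2 v1 v2 c) snd m2"
    and "has_bochner_integral (bivariate_gaussian m1 m2 v1 v2 c) (\<lambda>z. (fst z)\<^sup>2) (v1 + m1\<^sup>2)"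
    and "has_bochner_integral (bivariate_gaussian m1 m2 v1 v2 c) (\<lambda>z. (snd z)\<^sup>2) (v2 + m2\<^sup>2)"
    and "has_bochner_integral (bivariate_gaussian m1 m2 v1 v2 c) (\<lambda>z. fst z * snd z) (c + m1 * m2)"
proof -
  define a b d where "a = sqrt v1" and "b = c / sqrt v1" and "d = sqrt (v2 - c\<^sup>2 / v1)"
  have a: "a * a = v1" "a * b = c" using assms by (auto simp: a_def b_def)
  have "c\<^sup>2 / v1 \<le> v2" using assms by (simp add: field_simps)
  then have d: "d * d = v2 - c\<^sup>2 / v1" by (simp add: d_def)
  have b: "b * b = c\<^sup>2 / v1" using assms by (simp add: b_def power2_eq_square)
  have red: "has_bochner_integral (bivariate_gaussian m1 m2 v1 v2 c) h I"
    if "h \<in> borel_measurable borel"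
      and "has_bochner_integral (std_gaussian \<Otimes>\<^sub>M std_gaussian)
             (\<lambda>z. h (m1 + a * fst z, m2 + b * fst z + d * snd z)) I"
    for h :: "real \<times> real \<Rightarrow> real" and I
    using that bivariate_gaussian_map_measurable[of m1 a m2 b d]
    unfolding bivariate_gaussian_def unfolding b_def[symmetric] d_def[symmetric] unfolding a_def[symmetric]
    by (simp add: has_bochner_integral_iff integrable_distr_eq integral_distr case_prod_beta)
  have meas: "fst \<in> borel_measurable (borel :: (real \<times> real) measure)"
    "snd \<in> borel_measurable (borel :: (real \<times> real) measure)"
    by (simp_all add: borel_prod[symmetric])
  note meas' = borel_measurable_power[OF meas(1)] borel_measurable_power[OF meas(2)]
    borel_measurable_times[OF meas]
  show "has_bochner_integral (bivariate_gaussian m1 m2 v1 v2 c) fst m1"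
    using std_gaussian_pair_integral[of m1 a 0 0 0 0] by (intro red meas) simp
  show "has_bochner_integral (bivariate_gaussian m1 m2 v1 v2 c) snd m2"
    using std_gaussian_pair_integral[of m2 b d 0 0 0] by (intro red meas) simp
  show "has_bochner_integral (bivariate_gaussian m1 m2 v1 v2 c) (\<lambda>z. (fst z)\<^sup>2) (v1 + m1\<^sup>2)"
    using std_gaussian_pair_integral[of "m1\<^sup>2" "2 * m1 * a" 0 "a * a" 0 0]
    by (intro red meas') (simp add: a(1)[symmetric] power2_eq_square algebra_simps)
  have v2: "v2 = b * b + d * d" using b d by simp
  show "has_bochner_integral (bivariate_gaussian m1 m2 v1 v2 c) (\<lambda>z. (snd z)\<^sup>2) (v2 + m2\<^sup>2)"
    using std_gaussian_pair_integral[of "m2\<^sup>2" "2 * m2 * b" "2 * m2 * d" "b * b" "2 * b * d" "d * d"]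
    by (intro red meas') (simp add: v2 power2_eq_square algebra_simps)
  show "has_bochner_integral (bivariate_gaussian m1 m2 v1 v2 c) (\<lambda>z. fst z * snd z) (c + m1 * m2)"
    using std_gaussian_pair_integral[of "m1 * m2" "m1 * b + m2 * a" "m1 * d" "a * b" "a * d" 0]
    by (intro red meas') (simp add: a(2)[symmetric] power2_eq_square algebra_simps)
qed

lemma matching_gaussian_moments:
  assumes "p1 \<in> {-1<..<1}" and "p2 \<in> {-1<..<1}" and valid: "valid_pair p1 p2 \<theta>"
  shows "has_bochner_integral (matching_gaussian p1 p2 \<theta>) fst p1"
    and "has_bochner_integral (matching_gaussian p1 p2 \<theta>) snd p2"
    and "has_bochner_integral (matching_gaussian p1 p2 \<theta>) (\<lambda>z. (fst z)\<^sup>2) 1"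
    and "has_bochner_integral (matching_gaussian p1 p2 \<theta>) (\<lambda>z. (snd z)\<^sup>2) 1"
    and "has_bochner_integral (matching_gaussian p1 p2 \<theta>) (\<lambda>z. fst z * snd z) \<theta>"
proof -
  define A where "A = (1 + \<theta>) / 4 + (p1 + p2) / 4"
  define B where "B = (1 - \<theta>) / 4 + (p1 - p2) / 4"
  define C where "C = (1 - \<theta>) / 4 - (p1 - p2) / 4"
  define D where "D = (1 + \<theta>) / 4 - (p1 + p2) / 4"
  have nn: "A \<ge> 0" "B \<ge> 0" "C \<ge> 0" "D \<ge> 0"
    using valid[unfolded valid_pair_def, rule_format, of "(1, 1)"]
      valid[unfolded valid_pair_def, rule_format, of "(1, -1)"]
      valid[unfolded valid_pair_def, rule_format, of "(-1, 1)"]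
      valid[unfolded valid_pair_def, rule_format, of "(-1, -1)"]
    by (simp_all add: pair_mass_def A_def B_def C_def D_def)
  have c: "\<theta> - p1 * p2 = 4 * (A * D - B * C)"
    and v1: "1 - p1\<^sup>2 = 4 * ((A + B) * (C + D))" and v2: "1 - p2\<^sup>2 = 4 * ((A + C) * (B + D))"
    unfolding A_def B_def C_def D_def by (simp_all add: field_simps power2_eq_square)
  have AD: "A * D \<ge> 0" "B * C \<ge> 0" "A * C \<ge> 0" "B * D \<ge> 0" "A * B \<ge> 0" "C * D \<ge> 0"
    using nn by simp_all
  have "(A * D - B * C)\<^sup>2 \<le> (A * D + B * C)\<^sup>2"
    using AD mult_nonneg_nonneg[OF AD(1,2)] by (simp add: power2_eq_square algebra_simps)
  also have "\<dots> \<le> ((A + B) * (C + D)) * ((A + C) * (B + D))"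
    unfolding power2_eq_square using AD by (intro mult_mono) (simp_all add: algebra_simps)
  finally have "(\<theta> - p1 * p2)\<^sup>2 \<le> (1 - p1\<^sup>2) * (1 - p2\<^sup>2)"
    unfolding c v1 v2 power_mult_distrib by simp
  moreover have "1 - p1\<^sup>2 > 0" using assms(1) by (simp add: abs_square_less_1 abs_less_iff)
  ultimately show "has_bochner_integral (matching_gaussian p1 p2 \<theta>) fst p1"
    "has_bochner_integral (matching_gaussian p1 p2 \<theta>) snd p2"
    "has_bochner_integral (matching_gaussian p1 p2 \<theta>) (\<lambda>z. (fst z)\<^sup>2) 1"
    "has_bochner_integral (matching_gaussian p1 p2 \<theta>) (\<lambda>z. (snd z)\<^sup>2) 1"
    "has_bochner_integral (matching_gaussian p1 p2 \<theta>) (\<lambda>z. fst z * snd z) \<theta>"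
    using bivariate_gaussian_moments[of "1 - p1\<^sup>2" "\<theta> - p1 * p2" "1 - p2\<^sup>2" p1 p2]
    unfolding matching_gaussian_def by simp_all
qed


section \<open>Fourier expansion and low-degree influence\<close>

definition cube :: "nat \<Rightarrow> (nat \<Rightarrow> real) set" where
  "cube n = {..<n} \<rightarrow>\<^sub>E {-1, 1}"

definition chi :: "real \<Rightarrow> real \<Rightarrow> real" where
  "chi p z = (z - p) / sqrt (1 - p\<^sup>2)"

text \<open>
  The coefficient function is pinned down to be \<open>undefined\<close> outside \<open>Pow {..<n}\<close>, so that the
  description is unique; see \<open>ex1_fourier\<close> below.
\<close>

definition fourier :: "real \<Rightarrow> nat \<Rightarrow> ((nat \<Rightarrow> real) \<Rightarrow> real) \<Rightarrow> nat set \<Rightarrow> real" where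
  "fourier p n h = (THE c. c \<in> Pow {..<n} \<rightarrow>\<^sub>E UNIV \<and>
     (\<forall>z\<in>cube n. h z = (\<Sum>S\<in>Pow {..<n}. c S * (\<Prod>i\<in>S. chi p (z i)))))"

definition low_deg_influence ::
  "real \<Rightarrow> nat \<Rightarrow> nat \<Rightarrow> nat \<Rightarrow> ((nat \<Rightarrow> real) \<Rightarrow> real) \<Rightarrow> real" where
  "low_deg_influence p n d i h =
     (\<Sum>S | S \<subseteq> {..<n} \<and> i \<in> S \<and> card S \<le> d. (fourier p n h S)\<^sup>2)"

lemma finite_cube [simp]: "finite (cube n)"
  unfolding cube_def by (rule finite_PiE) auto

lemma chi_orthogonal:
  assumes "p \<in> {-1<..<1}"
  shows "(\<Sum>z\<in>{-1, 1}. (1 + z * p) / 2 * chi p z) = 0"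
    and "(\<Sum>z\<in>{-1, 1}. (1 + z * p) / 2 * (chi p z)\<^sup>2) = 1"
    and "(\<Sum>z\<in>{-1, 1}. (1 + z * p) / 2) = 1"
proof -
  have pos: "1 - p\<^sup>2 > 0" using assms by (simp add: abs_square_less_1 abs_less_iff)
  then have sq: "(sqrt (1 - p\<^sup>2))\<^sup>2 = 1 - p\<^sup>2" by simp
  show "(\<Sum>z\<in>{-1, 1}. (1 + z * p) / 2 * chi p z) = 0"
    using pos by (simp add: chi_def field_simps power2_eq_square)
  have "(\<Sum>z\<in>{-1, 1}. (1 + z * p) / 2 * (chi p z)\<^sup>2)
      = ((1 - p) * (-1 - p)\<^sup>2 + (1 + p) * (1 - p)\<^sup>2) / (2 * (1 - p\<^sup>2))"
    unfolding chi_def power_divide sq using pos by (simp add: divide_simps)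
  also have "(1 - p) * (-1 - p)\<^sup>2 + (1 + p) * (1 - p)\<^sup>2 = 2 * (1 - p\<^sup>2)"
    by (simp add: algebra_simps power2_eq_square)
  finally show "(\<Sum>z\<in>{-1, 1}. (1 + z * p) / 2 * (chi p z)\<^sup>2) = 1" using pos by simp
  show "(\<Sum>z\<in>{-1, 1}. (1 + z * p) / 2) = 1" by (simp add: field_simps)
qed

lemma chi_complete:
  assumes "p \<in> {-1<..<1}" and "z \<in> {-1, 1}" and "w \<in> {-1, 1}"
  shows "(1 + w * p) / 2 * (1 + chi p z * chi p w) = (if z = w then 1 else 0)"
proof -
  have pos: "1 - p\<^sup>2 > 0" using assms(1) by (simp add: abs_square_less_1 abs_less_iff)
  then have *: "chi p z * chi p w = (z - p) * (w - p) / (1 - p\<^sup>2)" by (simp add: chi_def)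
  show ?thesis
    unfolding * using assms(2,3) pos by (auto simp: field_simps power2_eq_square)
qed

lemma ex1_fourier:
  assumes p: "p \<in> {-1<..<1}"
  shows "\<exists>!c. c \<in> Pow {..<n} \<rightarrow>\<^sub>E UNIV \<and>
     (\<forall>z\<in>cube n. h z = (\<Sum>S\<in>Pow {..<n}. c S * (\<Prod>i\<in>S. chi p (z i))))"
proof -
  define \<mu> where "\<mu> z = (\<Prod>i<n. (1 + z i * p) / 2)" for z :: "nat \<Rightarrow> real"
  define X where "X S z = (\<Prod>i\<in>S. chi p (z i))" for S and z :: "nat \<Rightarrow> real"
  have X: "X S z = (\<Prod>i<n. if i \<in> S then chi p (z i) else 1)" if "S \<subseteq> {..<n}" for S z
    using that unfolding X_def
    by (simp add: prod.If_cases Int_absorb1 flip: Collect_mem_eq)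
  have orth: "(\<Sum>z\<in>cube n. \<mu> z * X S z * X T z) = (if S = T then 1 else 0)"
    if S: "S \<subseteq> {..<n}" and T: "T \<subseteq> {..<n}" for S T
  proof -
    let ?g = "\<lambda>i z. (1 + z * p) / 2 * (if i \<in> S then chi p z else 1) * (if i \<in> T then chi p z else 1)"
    have g: "(\<Sum>z\<in>{-1, 1}. ?g i z) = (if i \<in> S \<longleftrightarrow> i \<in> T then 1 else 0)" for i
      using chi_orthogonal[OF p]
      by (cases "i \<in> S"; cases "i \<in> T")
         (simp_all only: power2_eq_square mult.assoc if_True if_False mult_1_right simp_thms)
    have "(\<Sum>z\<in>cube n. \<mu> z * X S z * X T z) = (\<Sum>z\<in>cube n. \<Prod>i<n. ?g i (z i))"
      by (simp only: X[OF S] X[OF T] \<mu>_def prod.distrib)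
    also have "\<dots> = (\<Prod>i<n. \<Sum>z\<in>{-1, 1}. ?g i z)"
      unfolding cube_def by (rule prod_sum_PiE[symmetric]) auto
    also have "\<dots> = (\<Prod>i<n. if i \<in> S \<longleftrightarrow> i \<in> T then 1 else 0)"
      unfolding g ..
    also have "\<dots> = (if S = T then 1 else 0)"
    proof (cases "S = T")
      case False
      then obtain i where "i < n" "(i \<in> S) \<noteq> (i \<in> T)" using S T by blast
      then show ?thesis using False by (auto intro!: prod_zero)
    qed simp
    finally show ?thesis .
  qed
  have comp: "(\<Sum>S\<in>Pow {..<n}. \<mu> w * X S w * X S z) = (if w = z then 1 else 0)"
    if z: "z \<in> cube n" and w: "w \<in> cube n" for z w
  proof -
    have "(\<Sum>S\<in>Pow {..<n}. \<mu> w * X S w * X S z)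
        = \<mu> w * (\<Sum>S\<in>Pow {..<n}. (\<Prod>i\<in>S. chi p (z i) * chi p (w i)) * (\<Prod>i\<in>{..<n} - S. 1))"
      by (simp add: X_def prod.distrib sum_distrib_left mult_ac)
    also have "\<dots> = \<mu> w * (\<Prod>i<n. chi p (z i) * chi p (w i) + 1)"
      by (subst prod_add) auto
    also have "\<dots> = (\<Prod>i<n. (1 + w i * p) / 2 * (1 + chi p (z i) * chi p (w i)))"
      unfolding \<mu>_def by (simp only: prod.distrib add.commute)
    also have "\<dots> = (\<Prod>i<n. if z i = w i then 1 else 0)"
      using z w by (intro prod.cong refl chi_complete[OF p]) (auto simp: cube_def PiE_iff)
    also have "\<dots> = (if w = z then 1 else 0)"
    proof (cases "w = z")
      case False
      then obtain i where "i < n" "z i \<noteq> w i"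
        using PiE_ext[OF z[unfolded cube_def] w[unfolded cube_def]] by fastforce
      then show ?thesis using False by (auto intro!: prod_zero)
    qed simp
    finally show ?thesis .
  qed
  define c where "c = (\<lambda>S\<in>Pow {..<n}. \<Sum>w\<in>cube n. \<mu> w * X S w * h w)"
  show ?thesis
  proof (rule ex1I[of _ c], intro conjI ballI)
    show "c \<in> Pow {..<n} \<rightarrow>\<^sub>E UNIV" by (auto simp: c_def)
  next
    fix z assume z: "z \<in> cube n"
    have "(\<Sum>S\<in>Pow {..<n}. c S * X S z)
        = (\<Sum>S\<in>Pow {..<n}. \<Sum>w\<in>cube n. h w * (\<mu> w * X S w * X S z))"
      by (simp add: c_def sum_distrib_left sum_distrib_right mult_ac)
    also have "\<dots> = (\<Sum>w\<in>cube n. h w * (\<Sum>S\<in>Pow {..<n}. \<mu> w * X S w * X S z))"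
      by (subst sum.swap) (simp add: sum_distrib_left)
    also have "\<dots> = (\<Sum>w\<in>cube n. h w * (if w = z then 1 else 0))"
      using z by (intro sum.cong refl) (simp add: comp)
    also have "\<dots> = h z" using z by (simp add: if_distrib cong: if_cong)
    finally show "h z = (\<Sum>S\<in>Pow {..<n}. c S * (\<Prod>i\<in>S. chi p (z i)))"
      unfolding X_def by simp
  next
    fix b assume b: "b \<in> Pow {..<n} \<rightarrow>\<^sub>E UNIV \<and>
      (\<forall>z\<in>cube n. h z = (\<Sum>S\<in>Pow {..<n}. b S * (\<Prod>i\<in>S. chi p (z i))))"
    show "b = c"
    proof (rule PiE_ext)
      show "b \<in> Pow {..<n} \<rightarrow>\<^sub>E UNIV" using b by blast
      show "c \<in> Pow {..<n} \<rightarrow>\<^sub>E UNIV" by (auto simp: c_def)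
    next
      fix T assume T: "T \<in> Pow {..<n}"
      have "c T = (\<Sum>w\<in>cube n. \<mu> w * X T w * (\<Sum>S\<in>Pow {..<n}. b S * X S w))"
        using T b by (simp add: c_def X_def)
      also have "\<dots> = (\<Sum>S\<in>Pow {..<n}. b S * (\<Sum>w\<in>cube n. \<mu> w * X S w * X T w))"
        by (simp add: sum_distrib_left mult_ac sum.swap[of _ "cube n"])
      also have "\<dots> = (\<Sum>S\<in>Pow {..<n}. b S * (if S = T then 1 else 0))"
        using T by (intro sum.cong refl) (simp add: orth)
      also have "\<dots> = b T" using T by (simp add: if_distrib cong: if_cong)
      finally show "b T = c T" by simp
    qed
  qed
qed


section \<open>Functions on Gaussian space and correlations\<close>

text \<open>
  A function into \<open>K\<close> on Gaussian space \<open>\<real>\<^sup>n\<close> is understood to be Borel measurable, without which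
  its expectation is not defined.
\<close>

definition gaussian_functions ::
  "nat \<Rightarrow> (real ^ 'l) set \<Rightarrow> ((nat \<Rightarrow> real) \<Rightarrow> real ^ 'l) set" where
  "gaussian_functions n K = (Pi\<^sub>M {..<n} (\<lambda>_. borel)) \<rightarrow>\<^sub>M (restrict_space borel K)"

text \<open>
  The \<open>n\<close> coordinate pairs are drawn independently, and are then split into the two vectors of
  first and of second components; \<open>restrict\<close> makes these elements of the extensional function
  spaces that represent \<open>{+1,-1}\<^sup>n\<close> and \<open>\<real>\<^sup>n\<close>.
\<close>

definition discrete_correlation ::
  "nat \<Rightarrow> (real \<times> real) pmf \<Rightarrow> ((nat \<Rightarrow> real) \<Rightarrow> 'a) \<Rightarrow> ((nat \<Rightarrow> real) \<Rightarrow> 'a::real_inner) \<Rightarrow> real" where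
  "discrete_correlation n N f g =
     measure_pmf.expectation (Pi_pmf {..<n} undefined (\<lambda>_. N))
       (\<lambda>z. inner (f (\<lambda>i\<in>{..<n}. fst (z i))) (g (\<lambda>i\<in>{..<n}. snd (z i))))"

definition gaussian_correlation ::
  "nat \<Rightarrow> (real \<times> real) measure \<Rightarrow> ((nat \<Rightarrow> real) \<Rightarrow> 'a) \<Rightarrow> ((nat \<Rightarrow> real) \<Rightarrow> 'a::real_inner) \<Rightarrow> real" where
  "gaussian_correlation n G F H =
     (LINT z|Pi\<^sub>M {..<n} (\<lambda>_. G).
        inner (F (\<lambda>i\<in>{..<n}. fst (z i))) (H (\<lambda>i\<in>{..<n}. snd (z i))))"

end

theory Submission
  imports Defs
begin

text \<open>
  The extension \<open>T f\<close> drops from the Fourier expansion of \<open>f\<close> all sets of size above \<open>d\<close> and all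
  sets meeting the finite set \<open>B\<close> of coordinates on which \<open>f\<close> is influential, damps the coefficient
  of \<open>S\<close> by \<open>\<eta> ^ card S\<close>, evaluates the resulting polynomial at Gaussians, and projects to \<open>K\<close>.

  Before the projection, both correlations are \<open>\<Sum>S. \<rho> ^ card S * \<langle>f S, g S\<rangle>\<close> in terms of the
  coefficients, and \<open>\<bar>\<rho>\<bar> \<le> \<rho>0 < 1\<close> uniformly in \<open>\<theta>\<close>, so damping and truncation cost little. Dropping the
  sets that meet \<open>B\<close> also costs little: where \<open>f\<close> is influential \<open>g\<close> is not, and \<open>B\<close> has bounded size.
  This is why \<open>T f\<close> need not know \<open>g\<close>.

  The projection moves the polynomial only slightly in \<open>L\<^sup>2\<close>. On the cube the polynomial is close to
  an average of values of \<open>f\<close>, hence to \<open>K\<close>. Distance to \<open>K\<close> is controlled by finitely many half-spaces,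
  for each of which the excess, measured by a piecewise cubic test function, is transferred from bits to
  Gaussians by Lindeberg replacement; the error is bounded by hypercontractivity, all influences
  outside \<open>B\<close> being small.
\<close>

text \<open>Truncation alone need not stay near \<open>K\<close>, and averaging alone does not bound
  the degree. Damping reconciles the two: re-randomising at rate \<eta> keeps values in
  \<open>K\<close>, and above degree d it leaves a tail of L2 norm at most \<eta>^d R. Its price is
  bounded uniformly over all degrees because of \<rho>0 < 1, so \<eta> can be fixed before d without
  circularity.

  Two influence thresholds are essential. Membership in B is decided by \<tau>', set by what
  Lindeberg replacement tolerates; at most d R^2 / \<tau>' coordinates exceed it. The hypothesis is
  used at a far smaller \<tau>, so that the influences of the other function, summed over all of B,
  are still negligible. The order of choice is \<eta>, net of directions, d, \<tau>', \<tau>, and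
  none of it involves n.

  Everything takes place on product spaces of pairs, with f and g read off through
  \<open>fst\<close> and \<open>snd\<close>; \<theta> survives only in the correlation of the
  standardised components.\<close>

section \<open>A test function with Lipschitz second derivative\<close>

text \<open>
  The second derivative is \<open>6 * min 1 (max s 0)\<close>: Lipschitz, as Lindeberg replacement needs, and bounded,
  so that no moments beyond the second enter on the side of the cube.
\<close>

definition smooth_ramp :: "real \<Rightarrow> real" where
  "smooth_ramp s = (max s 0)^3 - (max (s - 1) 0)^3"

text \<open>The second derivative of the cube of the positive part is Lipschitz with constant 6, so
  the second-order remainder at distance t is at most 6/6 times the cube of |t|.\<close>

lemma cube_pos_part_taylor:
  fixes a t :: real
  shows "\<bar>(max (a + t) 0)^3 - (max a 0)^3 - 3 * (max a 0)^2 * t - 3 * max a 0 * t^2\<bar> \<le> \<bar>t\<bar>^3"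
proof (cases "a \<ge> 0")
  case True
  show ?thesis
  proof (cases "a + t \<ge> 0")
    case t: True
    have "(a + t)^3 - a^3 - 3 * a^2 * t - 3 * a * t^2 = t^3"
      by (simp add: algebra_simps power2_eq_square power3_eq_cube)
    then show ?thesis using True t by (simp add: max_def power_abs)
  next
    case False
    \<comment> \<open>When the step crosses the kink the remainder is u^3 + t^3, and 0 < u <= -t
      keeps it between t^3 and 0.\<close>
    define u where "u = - (a + t)"
    have u: "u > 0" "u \<le> - t" using False True by (auto simp: u_def)
    have "-(a^3) - 3 * a^2 * t - 3 * a * t^2 = u^3 - (-t)^3"
      by (simp add: u_def algebra_simps power2_eq_square power3_eq_cube)
    moreover have "u^3 \<le> (-t)^3" using u by (intro power_mono) auto
    moreover have "u^3 \<ge> 0" using u by simp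
    moreover have "\<bar>t\<bar>^3 = (-t)^3" using u by simp
    ultimately show ?thesis using True False by (simp add: max_def)
  qed
next
  case False
  then show ?thesis by (auto simp: max_def intro!: power_mono)
qed

text \<open>Only the independence of \<open>b\<close> and \<open>c\<close> from \<open>t\<close>
  matters: two laws with equal first and second moments give the quadratic part the same
  expectation, whatever the coefficients.\<close>

lemma smooth_ramp_taylor:
  "\<exists>b c. \<forall>t. \<bar>smooth_ramp (a + t) - smooth_ramp a - b * t - c * t^2\<bar> \<le> 2 * \<bar>t\<bar>^3"
proof (intro exI allI)
  fix t
  have eq: "a + t - 1 = (a - 1) + t" by simp
  show "\<bar>smooth_ramp (a + t) - smooth_ramp a - (3 * (max a 0)^2 - 3 * (max (a-1) 0)^2) * t
      - (3 * max a 0 - 3 * max (a-1) 0) * t^2\<bar> \<le> 2 * \<bar>t\<bar>^3"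
    using cube_pos_part_taylor[of a t] cube_pos_part_taylor[of "a - 1" t]
    unfolding smooth_ramp_def eq left_diff_distrib by linarith
qed

text \<open>These bounds let the ramp stand in for the squared positive part in both directions. In
  the third, arguments below \<open>k\<close> are paid for by \<open>k^2\<close>; between
  \<open>k\<close> and 1 the cubic growth costs only a factor \<open>1 / k\<close>, and above 1 the
  ramp already dominates the square.\<close>

lemma smooth_ramp_bounds:
  shows "0 \<le> smooth_ramp s" and "smooth_ramp s \<le> 3 * (max s 0)^2"
  and "0 < k \<Longrightarrow> k \<le> 1 \<Longrightarrow> (max s 0)^2 \<le> k^2 + smooth_ramp s / k"
proof -
  have big: "smooth_ramp s = 3 * s^2 - 3 * s + 1" if "s \<ge> 1"
    using that by (simp add: smooth_ramp_def max_def algebra_simps power2_eq_square power3_eq_cube)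
  have small: "smooth_ramp s = s^3" if "0 \<le> s" "s \<le> 1"
    using that by (simp add: smooth_ramp_def max_def)
  have neg: "smooth_ramp s = 0" if "s \<le> 0"
    using that by (simp add: smooth_ramp_def max_def)
  have large: "s^2 \<le> 3 * s^2 - 3 * s + 1" if "s \<ge> 1"
  proof -
    have "(2 * s - 1) * (s - 1) \<ge> 0" using that by (intro mult_nonneg_nonneg) auto
    then show ?thesis by (simp add: algebra_simps power2_eq_square)
  qed
  consider "s \<le> 0" | "0 \<le> s" "s \<le> 1" | "s \<ge> 1" by linarith
  note cs = this
  show "0 \<le> smooth_ramp s"
    using cs
  proof cases
    case 3
    then show ?thesis using large big zero_le_power2[of s] by linarith
  qed (auto simp: neg small)
  show "smooth_ramp s \<le> 3 * (max s 0)^2"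
    using cs
  proof cases
    case 2
    have "s^2 * s \<le> s^2 * 1" using 2 by (intro mult_left_mono) auto
    moreover have "s^3 = s^2 * s" by (simp add: power2_eq_square power3_eq_cube)
    ultimately have "s^3 \<le> 3 * s^2" using zero_le_power2[of s] by linarith
    then show ?thesis using 2 by (simp add: small)
  qed (auto simp: neg big max_def)
  assume k: "0 < k" "k \<le> 1"
  show "(max s 0)^2 \<le> k^2 + smooth_ramp s / k"
    using cs
  proof cases
    case 2
    show ?thesis
    proof (cases "s \<le> k")
      case True
      then have "s^2 \<le> k^2" using 2 by (intro power_mono) auto
      moreover have "s^3 / k \<ge> 0" using 2 k by auto
      ultimately show ?thesis using 2 by (simp add: small)
    next
      case False
      have "s^2 * k \<le> s^2 * s" using False by (intro mult_left_mono) auto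
      then have "s^2 \<le> s^3 / k" using k by (simp add: field_simps power2_eq_square power3_eq_cube)
      then show ?thesis using 2 by (simp add: small add_increasing)
    qed
  next
    case 3
    have "s^2 * k \<le> s^2 * 1" using k by (intro mult_left_mono) auto
    then have "s^2 * k \<le> 3 * s^2 - 3 * s + 1" using large[OF 3] by linarith
    then have "s^2 \<le> smooth_ramp s / k" using k 3 by (simp add: big field_simps)
    then show ?thesis using 3 by (simp add: add_increasing max_def)
  qed (use k in \<open>auto simp: neg\<close>)
qed

lemma smooth_ramp_measurable [measurable]: "smooth_ramp \<in> borel_measurable borel"
  unfolding smooth_ramp_def by measurable

section \<open>Functions with finite fourth moment\<close>

text \<open>Fourth moments are what the hypercontractive estimate controls. On a probability space
  they also make products, squares, cubes and ramps integrable, so one predicate closed under linear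
  combinations settles integrability for all polynomials.\<close>

definition L4 :: "'a measure \<Rightarrow> ('a \<Rightarrow> real) \<Rightarrow> bool" where
  "L4 M f \<longleftrightarrow> f \<in> borel_measurable M \<and> integrable M (\<lambda>x. f x ^ 4)"

lemma L4_measurable: "L4 M f \<Longrightarrow> f \<in> borel_measurable M"
  by (simp add: L4_def)

lemma power4_add_le: "(a + b) ^ 4 \<le> 8 * (a ^ 4 + b ^ 4)" for a b :: real
proof -
  have "(a + b)^2 \<le> 2 * (a^2 + b^2)"
    using zero_le_power2[of "a - b"] by (simp add: power2_eq_square algebra_simps)
  then have "((a + b)^2)^2 \<le> (2 * (a^2 + b^2))^2" by (intro power_mono) auto
  also have "\<dots> = 4 * (a^2 + b^2)^2" unfolding power_mult_distrib by simp
  also have "(a^2 + b^2)^2 \<le> 2 * ((a^2)^2 + (b^2)^2)"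
    using zero_le_power2[of "a^2 - b^2"] by (simp add: power2_eq_square algebra_simps)
  finally show ?thesis by simp
qed

lemma L4_add: "L4 M f \<Longrightarrow> L4 M g \<Longrightarrow> L4 M (\<lambda>x. f x + g x)"
  unfolding L4_def
proof (intro conjI; (elim conjE)?)
  assume *: "f \<in> borel_measurable M" "g \<in> borel_measurable M"
    "integrable M (\<lambda>x. f x ^ 4)" "integrable M (\<lambda>x. g x ^ 4)"
  show "(\<lambda>x. f x + g x) \<in> borel_measurable M" using * by simp
  show "integrable M (\<lambda>x. (f x + g x) ^ 4)"
  proof (rule Bochner_Integration.integrable_bound)
    show "integrable M (\<lambda>x. 8 * (f x ^ 4 + g x ^ 4))" using * by simp
    show "AE x in M. norm ((f x + g x) ^ 4) \<le> norm (8 * (f x ^ 4 + g x ^ 4))"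
      using power4_add_le by (intro AE_I2) (simp add: order_trans[OF _ abs_ge_self])
  qed (use * in simp)
qed

lemma L4_cmult: "L4 M f \<Longrightarrow> L4 M (\<lambda>x. c * f x)"
  unfolding L4_def by (auto simp: power_mult_distrib)

lemma L4_sum: "(\<And>i. i \<in> I \<Longrightarrow> L4 M (f i)) \<Longrightarrow> L4 M (\<lambda>x. \<Sum>i\<in>I. f i x)"
proof (induction I rule: infinite_finite_induct)
  case (insert i I)
  then show ?case by (auto intro: L4_add)
qed (auto simp: L4_def)

lemma L4_bounded:
  assumes "prob_space M" "f \<in> borel_measurable M" "\<And>x. \<bar>f x\<bar> \<le> C"
  shows "L4 M f"
proof -
  interpret prob_space M by fact
  have "integrable M (\<lambda>x. f x ^ 4)"
  proof (rule integrable_const_bound[of _ "C^4"])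
    show "AE x in M. norm (f x ^ 4) \<le> C ^ 4"
      using assms(3) by (intro AE_I2) (simp only: real_norm_def power_abs, intro power_mono, auto)
  qed (use assms(2) in measurable)
  then show ?thesis using assms by (simp add: L4_def)
qed

lemma L4_const: "prob_space M \<Longrightarrow> L4 M (\<lambda>_. c)"
  by (rule L4_bounded[of _ _ "\<bar>c\<bar>"]) auto

lemma L4_integrable_sq_prod:
  assumes "L4 M f" "L4 M g" shows "integrable M (\<lambda>x. (f x)^2 * (g x)^2)"
proof (rule Bochner_Integration.integrable_bound[of M "\<lambda>x. f x ^ 4 + g x ^ 4"])
  have "(a^2) * (b^2) \<le> a^4 + b^4" for a b :: real
  proof -
    have "0 \<le> (a^2 - b^2)^2 + (a^4 + b^4)" by simp
    then show ?thesis by (simp add: power2_eq_square algebra_simps power4_eq_xxxx)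
  qed
  then show "AE x in M. norm ((f x)^2 * (g x)^2) \<le> norm (f x ^ 4 + g x ^ 4)"
    by (auto simp: abs_mult)
qed (use assms in \<open>auto simp: L4_def\<close>)

lemma L4_integrable_prod:
  assumes "prob_space M" "L4 M f" "L4 M g" shows "integrable M (\<lambda>x. f x * g x)"
proof (rule Bochner_Integration.integrable_bound[of M "\<lambda>x. 1 + (f x)^2 * (g x)^2"])
  interpret prob_space M by fact
  show "integrable M (\<lambda>x. 1 + (f x)^2 * (g x)^2)"
    using L4_integrable_sq_prod[OF assms(2,3)] by simp
  have "\<bar>c\<bar> \<le> 1 + c^2" for c :: real
    using zero_le_power2[of "\<bar>c\<bar> - 1"] by (simp add: power2_eq_square algebra_simps abs_mult_self_eq)
  then show "AE x in M. norm (f x * g x) \<le> norm (1 + (f x)^2 * (g x)^2)"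
    by (simp flip: power_mult_distrib)
qed (use assms in \<open>auto simp: L4_def\<close>)

lemma L4_integrable_sq: "prob_space M \<Longrightarrow> L4 M f \<Longrightarrow> integrable M (\<lambda>x. (f x)^2)"
  using L4_integrable_prod[of M f f] by (simp add: power2_eq_square)

lemma L4_integrable: "prob_space M \<Longrightarrow> L4 M f \<Longrightarrow> integrable M f"
  using L4_integrable_prod[of M f "\<lambda>_. 1"] L4_const by fastforce

text \<open>The weight stays free: in the Lindeberg step it becomes the small parameter that trades
  second against fourth moments, in place of an optimised Cauchy-Schwarz bound.\<close>

lemma cube_le_AMGM: "t > 0 \<Longrightarrow> \<bar>b\<bar>^3 \<le> (t * b^2 + b^4 / t) / 2" for b t :: real
proof -
  assume t: "t > 0"
  have "0 \<le> b^2 * (t - \<bar>b\<bar>)^2" by simp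
  also have "\<dots> = t^2 * b^2 + b^4 - 2 * t * \<bar>b\<bar>^3"
    by (cases "b \<ge> 0") (simp_all add: power2_eq_square algebra_simps power3_eq_cube power4_eq_xxxx)
  finally show ?thesis using t by (simp add: field_simps power2_eq_square)
qed

lemma L4_integrable_cube:
  assumes "prob_space M" "L4 M f" shows "integrable M (\<lambda>x. \<bar>f x\<bar>^3)"
proof (rule Bochner_Integration.integrable_bound[of M "\<lambda>x. (1 * (f x)^2 + f x ^ 4 / 1) / 2"])
  show "integrable M (\<lambda>x. (1 * (f x)^2 + f x ^ 4 / 1) / 2)"
    using L4_integrable_sq[OF assms] assms(2) by (simp add: L4_def)
  show "AE x in M. norm (\<bar>f x\<bar>^3) \<le> norm ((1 * (f x)^2 + f x ^ 4 / 1) / 2)"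
    using cube_le_AMGM[of 1] by (intro AE_I2) (simp add: order_trans[OF _ abs_ge_self])
qed (use assms in \<open>auto simp: L4_def\<close>)

lemma L4_integral_sq_prod_le:
  assumes f: "L4 M f" and g: "L4 M g"
    and "integral\<^sup>L M (\<lambda>x. f x ^ 4) \<le> a^2" and "integral\<^sup>L M (\<lambda>x. g x ^ 4) \<le> b^2"
    and "a \<ge> 0" "b \<ge> 0"
  shows "integral\<^sup>L M (\<lambda>x. (f x)^2 * (g x)^2) \<le> a * b"
proof -
  define X where "X = integral\<^sup>L M (\<lambda>x. (f x)^2 * (g x)^2)"
  have *: "X \<le> (t * a^2 + b^2 / t) / 2" if "t > 0" for t
  proof -
    have "X \<le> integral\<^sup>L M (\<lambda>x. (t * f x ^ 4 + g x ^ 4 / t) / 2)"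
      unfolding X_def
    proof (intro integral_mono L4_integrable_sq_prod f g)
      show "integrable M (\<lambda>x. (t * f x ^ 4 + g x ^ 4 / t) / 2)" using f g by (simp add: L4_def)
      fix x
      have "0 \<le> (t * (f x)^2 - (g x)^2)^2" by simp
      then show "(f x)^2 * (g x)^2 \<le> (t * f x ^ 4 + g x ^ 4 / t) / 2"
        using that by (simp add: field_simps power2_eq_square power4_eq_xxxx)
    qed
    also have "\<dots> = (t * integral\<^sup>L M (\<lambda>x. f x ^ 4) + integral\<^sup>L M (\<lambda>x. g x ^ 4) / t) / 2"
      using f g by (simp add: L4_def)
    also have "\<dots> \<le> (t * a^2 + b^2 / t) / 2"
      using assms that by (intro divide_right_mono add_mono mult_left_mono) auto
    finally show ?thesis .
  qed
  \<comment> \<open>The best weight is b / a, which degenerates when a or b vanishes; both are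
    shifted by e > 0, and e tends to 0 afterwards.\<close>
  have "X \<le> (a + e) * (b + e)" if e: "e > 0" for e
  proof -
    have p: "a + e > 0" "b + e > 0" using assms e by auto
    have "X \<le> ((b + e) / (a + e) * a^2 + b^2 / ((b + e) / (a + e))) / 2" using p by (intro *) auto
    also have "\<dots> \<le> ((b + e) / (a + e) * (a + e)^2 + (b + e)^2 / ((b + e) / (a + e))) / 2"
      using p assms e by (intro divide_right_mono add_mono mult_left_mono power_mono) auto
    also have "\<dots> = (a + e) * (b + e)"
    proof -
      have "(v / u * u^2 + v^2 / (v / u)) / 2 = u * v" if "u > 0" "v > 0" for u v :: real
        using that by (simp add: field_simps power2_eq_square)
      from this[OF p] show ?thesis .
    qed
    finally show ?thesis .
  qed
  then have "eventually (\<lambda>e. X \<le> (a + e) * (b + e)) (at_right 0)"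
    by (auto simp: eventually_at_filter)
  moreover have "((\<lambda>e. (a + e) * (b + e)) \<longlongrightarrow> (a + 0) * (b + 0)) (at_right 0)"
    by (intro tendsto_intros)
  ultimately show ?thesis
    unfolding X_def using tendsto_lowerbound by fastforce
qed

section \<open>Multilinear polynomials in independent variables\<close>

definition monomial :: "('a \<Rightarrow> real) \<Rightarrow> nat set \<Rightarrow> (nat \<Rightarrow> 'a) \<Rightarrow> real" where
  "monomial \<xi> S z = (\<Prod>i\<in>S. \<xi> (z i))"

definition multilinear :: "('a \<Rightarrow> real) \<Rightarrow> nat set \<Rightarrow> (nat set \<Rightarrow> real) \<Rightarrow> (nat \<Rightarrow> 'a) \<Rightarrow> real" where
  "multilinear \<xi> I c z = (\<Sum>S\<in>Pow I. c S * monomial \<xi> S z)"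

lemma monomial_upd: "i \<notin> S \<Longrightarrow> monomial \<xi> S (z(i := y)) = monomial \<xi> S z"
  unfolding monomial_def by (intro prod.cong) auto

lemma sum_Pow_insert:
  assumes "finite I" "i \<notin> I"
  shows "(\<Sum>S\<in>Pow (insert i I). g S) = (\<Sum>S\<in>Pow I. g S) + (\<Sum>S\<in>Pow I. g (insert i S))"
proof -
  have "inj_on (insert i) (Pow I)" using assms(2) by (intro inj_onI) (metis PowD insert_ident subsetD)
  then show ?thesis
    unfolding Pow_insert using assms by (subst sum.union_disjoint) (auto simp: sum.reindex)
qed

text \<open>A multilinear polynomial is affine in each variable. Freezing the others and integrating
  out \<open>y\<close> is the mechanism behind both the fourth-moment induction and the replacement
  of one coordinate.\<close>

lemma multilinear_upd:
  assumes "finite I" "i \<notin> I"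
  shows "multilinear \<xi> (insert i I) c (z(i := y))
    = multilinear \<xi> I c z + \<xi> y * multilinear \<xi> I (\<lambda>S. c (insert i S)) z"
proof -
  have "multilinear \<xi> (insert i I) c (z(i := y))
    = (\<Sum>S\<in>Pow I. c S * monomial \<xi> S (z(i := y)))
      + (\<Sum>S\<in>Pow I. c (insert i S) * monomial \<xi> (insert i S) (z(i := y)))"
    unfolding multilinear_def by (rule sum_Pow_insert[OF assms])
  also have "(\<Sum>S\<in>Pow I. c S * monomial \<xi> S (z(i := y))) = multilinear \<xi> I c z"
    unfolding multilinear_def using assms(2)
    by (intro sum.cong refl arg_cong2[where f = "(*)"] monomial_upd) auto
  also have "(\<Sum>S\<in>Pow I. c (insert i S) * monomial \<xi> (insert i S) (z(i := y)))
      = \<xi> y * multilinear \<xi> I (\<lambda>S. c (insert i S)) z"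
    unfolding multilinear_def sum_distrib_left
  proof (intro sum.cong refl)
    fix S assume S: "S \<in> Pow I"
    then have "i \<notin> S" "finite S" using assms by (auto intro: finite_subset)
    then have "monomial \<xi> (insert i S) (z(i := y)) = \<xi> y * monomial \<xi> S z"
      by (simp add: monomial_def) (intro disjI2 prod.cong, auto)
    then show "c (insert i S) * monomial \<xi> (insert i S) (z(i := y))
        = \<xi> y * (c (insert i S) * monomial \<xi> S z)" by simp
  qed
  finally show ?thesis .
qed

text \<open>\<open>\<xi>\<close> is kept apart from the measure so that signs and Gaussians can
  share it: replacing one law by the other then changes \<open>M\<close> and leaves every polynomial
  untouched.\<close>

locale standardized = prob_space M for M :: "'a measure" +
  fixes \<xi> :: "'a \<Rightarrow> real" and K :: real
  assumes \<xi>_L4: "L4 M \<xi>"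
    and mean_\<xi>: "integral\<^sup>L M \<xi> = 0" and var_\<xi>: "integral\<^sup>L M (\<lambda>x. (\<xi> x)^2) = 1"
    and fourth_\<xi>: "integral\<^sup>L M (\<lambda>x. \<xi> x ^ 4) \<le> K" and K_ge_1: "K \<ge> 1"
begin

lemma \<xi>_measurable [measurable]: "\<xi> \<in> borel_measurable M"
  using \<xi>_L4 by (rule L4_measurable)

lemma \<xi>_integrable: "integrable M \<xi>" "integrable M (\<lambda>x. (\<xi> x)^2)" "integrable M (\<lambda>x. \<xi> x ^ 4)"
  "integrable M (\<lambda>x. \<bar>\<xi> x\<bar>^3)"
  using L4_integrable[OF _ \<xi>_L4] L4_integrable_sq[OF _ \<xi>_L4] L4_integrable_cube[OF _ \<xi>_L4]
    prob_space_axioms \<xi>_L4 by (simp_all add: L4_def)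

lemma third_\<xi>: "integral\<^sup>L M (\<lambda>x. \<bar>\<xi> x\<bar>^3) \<le> K"
proof -
  have "integral\<^sup>L M (\<lambda>x. \<bar>\<xi> x\<bar>^3) \<le> integral\<^sup>L M (\<lambda>x. ((\<xi> x)^2 + \<xi> x ^ 4) / 2)"
    using \<xi>_integrable cube_le_AMGM[of 1] by (intro integral_mono) auto
  also have "\<dots> = (1 + integral\<^sup>L M (\<lambda>x. \<xi> x ^ 4)) / 2"
    using \<xi>_integrable var_\<xi> by simp
  also have "\<dots> \<le> K" using fourth_\<xi> K_ge_1 by simp
  finally show ?thesis .
qed

text \<open>The linear term vanishes in the mean, and the cubic one is absorbed by 4 a u^3 <= 2 a^2
  u^2 + 2 u^4. This turns the binomial coefficients 6 and 1 into 8 and 3 and avoids the third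
  moment, which is nonzero for biased bits.\<close>

lemma fourth_moment_affine:
  "integral\<^sup>L M (\<lambda>x. (a + \<xi> x * b) ^ 4) \<le> a^4 + 8 * (a^2 * b^2) + 3 * K * b^4"
proof -
  have "integral\<^sup>L M (\<lambda>x. (a + \<xi> x * b) ^ 4)
    \<le> integral\<^sup>L M (\<lambda>x. a^4 + 4 * a^3 * b * \<xi> x + 8 * (a^2 * b^2) * (\<xi> x)^2 + 3 * b^4 * \<xi> x ^ 4)"
  proof (intro integral_mono)
    have "L4 M (\<lambda>x. a + b * \<xi> x)"
      by (intro L4_add L4_const L4_cmult \<xi>_L4 prob_space_axioms)
    then show "integrable M (\<lambda>x. (a + \<xi> x * b) ^ 4)" by (simp add: L4_def mult.commute)
    show "integrable M (\<lambda>x. a^4 + 4 * a^3 * b * \<xi> x + 8 * (a^2 * b^2) * (\<xi> x)^2 + 3 * b^4 * \<xi> x ^ 4)"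
      using \<xi>_integrable by auto
    fix x
    have "(a + u) ^ 4 \<le> a^4 + 4 * a^3 * u + 8 * (a^2 * u^2) + 3 * u^4" for u
    proof -
      have "a^4 + 4 * a^3 * u + 8 * (a^2 * u^2) + 3 * u^4 - (a + u)^4 = 2 * (a * u - u^2)^2"
        by algebra
      then show ?thesis using zero_le_power2[of "a * u - u^2"] by linarith
    qed
    from this[of "\<xi> x * b"]
    show "(a + \<xi> x * b) ^ 4
      \<le> a^4 + 4 * a^3 * b * \<xi> x + 8 * (a^2 * b^2) * (\<xi> x)^2 + 3 * b^4 * \<xi> x ^ 4"
      by (simp only: power_mult_distrib mult.assoc mult.left_commute mult.commute)
  qed
  also have "\<dots> = a^4 + 8 * (a^2 * b^2) + 3 * b^4 * integral\<^sup>L M (\<lambda>x. \<xi> x ^ 4)"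
    using \<xi>_integrable mean_\<xi> var_\<xi> prob_space by simp
  also have "\<dots> \<le> a^4 + 8 * (a^2 * b^2) + 3 * b^4 * K"
    using fourth_\<xi> by (intro add_mono mult_left_mono) auto
  finally show ?thesis by (simp add: mult_ac)
qed

end

text \<open>The law may vary with the index so that hybrids, Gaussian in some coordinates and
  discrete in the others, are instances too.\<close>

locale standardized_product =
  fixes M :: "nat \<Rightarrow> 'a measure" and \<xi> :: "'a \<Rightarrow> real" and K :: real
  assumes std: "standardized (M i) \<xi> K"
begin

lemma prob: "prob_space (M i)"
  by (rule standardized.axioms(1)[OF std])

sublocale product_sigma_finite M
  by (intro product_sigma_finite.intro prob_space_imp_sigma_finite prob)

lemma prob_PiM: "prob_space (Pi\<^sub>M I M)"
  by (intro prob_space_PiM prob)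

lemma monomial_measurable: "S \<subseteq> I \<Longrightarrow> monomial \<xi> S \<in> borel_measurable (Pi\<^sub>M I M)"
  unfolding monomial_def
  using standardized.\<xi>_measurable[OF std] by (intro borel_measurable_prod) (auto intro!: measurable_compose[OF measurable_component_singleton])

lemma monomial_L4:
  assumes "finite I" "S \<subseteq> I"
  shows "L4 (Pi\<^sub>M I M) (monomial \<xi> S)"
  unfolding L4_def
proof
  show "monomial \<xi> S \<in> borel_measurable (Pi\<^sub>M I M)" using assms by (intro monomial_measurable)
  have "integrable (Pi\<^sub>M I M) (\<lambda>z. \<Prod>i\<in>I. (if i \<in> S then \<xi> (z i) ^ 4 else 1))"
  proof (rule product_integrable_prod[OF assms(1)])
    fix i
    interpret standardized "M i" \<xi> K by (rule std)
    show "integrable (M i) (\<lambda>y. if i \<in> S then \<xi> y ^ 4 else 1)"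
      using \<xi>_integrable by (cases "i \<in> S") auto
  qed
  moreover have "(\<Prod>i\<in>I. (if i \<in> S then \<xi> (z i) ^ 4 else 1)) = monomial \<xi> S z ^ 4" for z
    unfolding monomial_def prod_power_distrib
    using assms by (simp add: prod.If_cases Int_absorb1 flip: Collect_mem_eq)
  ultimately show "integrable (Pi\<^sub>M I M) (\<lambda>z. monomial \<xi> S z ^ 4)" by simp
qed

lemma multilinear_L4: "finite I \<Longrightarrow> L4 (Pi\<^sub>M I M) (multilinear \<xi> I c)"
  unfolding multilinear_def by (intro L4_sum L4_cmult monomial_L4) auto

text \<open>
  Weighting the coefficient of degree \<open>k\<close> by \<open>(4 K)\<^sup>k\<close> makes the bound pass through the
  induction without any bookkeeping of degrees.
\<close>

lemma fourth_moment_multilinear: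
  assumes "finite I"
  shows "(LINT z|Pi\<^sub>M I M. multilinear \<xi> I c z ^ 4) \<le> (\<Sum>S\<in>Pow I. (4 * K) ^ card S * (c S)^2)^2"
  using assms
proof (induction I arbitrary: c rule: finite_induct)
  case empty
  interpret prob_space "Pi\<^sub>M {} M" by (rule prob_PiM)
  show ?case by (simp add: multilinear_def monomial_def prob_space)
next
  case (insert i I)
  define A where "A = multilinear \<xi> I c"
  define B where "B = multilinear \<xi> I (\<lambda>S. c (insert i S))"
  define a where "a = (\<Sum>S\<in>Pow I. (4 * K) ^ card S * (c S)^2)"
  define b where "b = (\<Sum>S\<in>Pow I. (4 * K) ^ card S * (c (insert i S))^2)"
  interpret standardized "M i" \<xi> K by (rule std)
  have ab: "a \<ge> 0" "b \<ge> 0" unfolding a_def b_def using K_ge_1 by (auto intro!: sum_nonneg)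
  have A: "L4 (Pi\<^sub>M I M) A" and B: "L4 (Pi\<^sub>M I M) B"
    unfolding A_def B_def using insert by (auto intro: multilinear_L4)
  have A4: "(LINT z|Pi\<^sub>M I M. A z ^ 4) \<le> a^2" and B4: "(LINT z|Pi\<^sub>M I M. B z ^ 4) \<le> b^2"
    unfolding A_def B_def a_def b_def by (rule insert.IH)+
  have int: "integrable (Pi\<^sub>M (insert i I) M) (\<lambda>z. multilinear \<xi> (insert i I) c z ^ 4)"
    using multilinear_L4[of "insert i I" c] insert by (simp add: L4_def)
  have "(LINT z|Pi\<^sub>M (insert i I) M. multilinear \<xi> (insert i I) c z ^ 4)
      = (LINT z|Pi\<^sub>M I M. LINT y|M i. (A z + \<xi> y * B z) ^ 4)"
    unfolding product_integral_insert[OF insert(1,2) int]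
    using insert by (simp add: multilinear_upd A_def B_def)
  also have "\<dots> \<le> (LINT z|Pi\<^sub>M I M. A z^4 + 8 * ((A z)^2 * (B z)^2) + 3 * K * B z^4)"
  proof (rule integral_mono')
    show "integrable (Pi\<^sub>M I M) (\<lambda>z. A z^4 + 8 * ((A z)^2 * (B z)^2) + 3 * K * B z^4)"
      using A B L4_integrable_sq_prod[OF A B] by (auto simp: L4_def)
  qed (use K_ge_1 in \<open>auto intro!: fourth_moment_affine\<close>)
  also have "\<dots> = (LINT z|Pi\<^sub>M I M. A z^4) + 8 * (LINT z|Pi\<^sub>M I M. (A z)^2 * (B z)^2)
      + 3 * K * (LINT z|Pi\<^sub>M I M. B z^4)"
    using A B L4_integrable_sq_prod[OF A B] by (simp add: L4_def)
  also have "\<dots> \<le> a^2 + 8 * (a * b) + 3 * K * b^2"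
    using K_ge_1 A4 B4 ab
    by (intro add_mono mult_left_mono L4_integral_sq_prod_le[OF A B]) auto
  \<comment> \<open>The cross term decides the weight: 8 a b has to fit into 2 a (4 K b), and K >= 1
    then leaves room for 3 K b^2 inside (4 K b)^2.\<close>
  also have "\<dots> \<le> (a + 4 * K * b)^2"
  proof -
    have "8 * (a * b) \<le> 8 * K * (a * b)" using K_ge_1 ab by (intro mult_right_mono) auto
    moreover have "3 * K * b^2 \<le> 16 * K^2 * b^2"
      using K_ge_1 by (intro mult_right_mono) (auto simp: power2_eq_square)
    ultimately show ?thesis by (simp add: power2_eq_square algebra_simps)
  qed
  also have "a + 4 * K * b = (\<Sum>S\<in>Pow (insert i I). (4 * K) ^ card S * (c S)^2)"
  proof -
    have "(\<Sum>S\<in>Pow I. (4 * K) ^ card (insert i S) * (c (insert i S))^2) = 4 * K * b"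
      unfolding b_def sum_distrib_left
    proof (intro sum.cong refl)
      fix S assume "S \<in> Pow I"
      then have "card (insert i S) = Suc (card S)"
        using insert by (intro card_insert_disjoint) (auto intro: finite_subset)
      then show "(4 * K) ^ card (insert i S) * (c (insert i S))^2
          = 4 * K * ((4 * K) ^ card S * (c (insert i S))^2)" by simp
    qed
    then show ?thesis unfolding sum_Pow_insert[OF insert(1,2)] a_def by simp
  qed
  finally show ?case .
qed

end

lemma integral_monomial_monomial:
  assumes 1: "standardized_product M \<xi> K" and 2: "standardized_product M \<zeta> K'"
    and \<rho>: "\<And>i. integral\<^sup>L (M i) (\<lambda>y. \<xi> y * \<zeta> y) = \<rho>"
    and I: "finite I" and S: "S \<subseteq> I" and T: "T \<subseteq> I"
  shows "integral\<^sup>L (Pi\<^sub>M I M) (\<lambda>z. monomial \<xi> S z * monomial \<zeta> T z) = (if S = T then \<rho> ^ card S else 0)"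
proof -
  interpret A: standardized_product M \<xi> K by fact
  interpret B: standardized_product M \<zeta> K' by fact
  let ?g = "\<lambda>i y. (if i \<in> S then \<xi> y else 1) * (if i \<in> T then \<zeta> y else 1)"
  have fin: "finite S" "finite T" using I S T finite_subset by auto
  have int: "integrable (M i) (?g i)" for i
  proof -
    interpret A': standardized "M i" \<xi> K by (rule A.std)
    interpret B': standardized "M i" \<zeta> K' by (rule B.std)
    show ?thesis
      by (intro L4_integrable_prod A'.prob_space_axioms; cases "i \<in> S"; cases "i \<in> T")
        (simp_all add: A'.\<xi>_L4 B'.\<xi>_L4 L4_const A'.prob_space_axioms)
  qed
  have val: "integral\<^sup>L (M i) (?g i) = (if i \<in> S \<longleftrightarrow> i \<in> T then (if i \<in> S then \<rho> else 1) else 0)" for i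
  proof -
    interpret A': standardized "M i" \<xi> K by (rule A.std)
    interpret B': standardized "M i" \<zeta> K' by (rule B.std)
    show ?thesis using A'.mean_\<xi> B'.mean_\<xi> \<rho> A'.prob_space by auto
  qed
  have "monomial \<xi> S z * monomial \<zeta> T z = (\<Prod>i\<in>I. ?g i (z i))" for z
    unfolding prod.distrib monomial_def using S T I
    by (simp add: prod.If_cases Int_absorb1 flip: Collect_mem_eq)
  then have "integral\<^sup>L (Pi\<^sub>M I M) (\<lambda>z. monomial \<xi> S z * monomial \<zeta> T z)
      = (\<Prod>i\<in>I. if i \<in> S \<longleftrightarrow> i \<in> T then (if i \<in> S then \<rho> else 1) else 0)"
    using A.product_integral_prod[OF I int] val by simp
  also have "\<dots> = (if S = T then \<rho> ^ card S else 0)"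
  proof (cases "S = T")
    case True
    then have "(\<Prod>i\<in>I. if i \<in> S \<longleftrightarrow> i \<in> T then (if i \<in> S then \<rho> else 1) else 0) = (\<Prod>i\<in>I. if i \<in> S then \<rho> else 1)"
      by simp
    also have "\<dots> = \<rho> ^ card S" using S I by (simp add: prod.If_cases Int_absorb1 flip: Collect_mem_eq)
    finally show ?thesis using True by simp
  next
    case False
    then obtain i where "i \<in> I" "(i \<in> S) \<noteq> (i \<in> T)" using S T by blast
    then show ?thesis using False I by (auto intro!: prod_zero)
  qed
  finally show ?thesis .
qed

lemma integral_multilinear_multilinear:
  assumes 1: "standardized_product M \<xi> K" and 2: "standardized_product M \<zeta> K'"
    and \<rho>: "\<And>i. integral\<^sup>L (M i) (\<lambda>y. \<xi> y * \<zeta> y) = \<rho>"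
    and I: "finite I"
  shows "integral\<^sup>L (Pi\<^sub>M I M) (\<lambda>z. multilinear \<xi> I a z * multilinear \<zeta> I b z)
    = (\<Sum>S\<in>Pow I. \<rho> ^ card S * a S * b S)"
proof -
  interpret A: standardized_product M \<xi> K by fact
  interpret B: standardized_product M \<zeta> K' by fact
  have int: "integrable (Pi\<^sub>M I M) (\<lambda>z. monomial \<xi> S z * monomial \<zeta> T z)" if "S \<subseteq> I" "T \<subseteq> I" for S T
    using I that by (intro L4_integrable_prod A.prob_PiM A.monomial_L4 B.monomial_L4)
  have "integral\<^sup>L (Pi\<^sub>M I M) (\<lambda>z. multilinear \<xi> I a z * multilinear \<zeta> I b z)
     = integral\<^sup>L (Pi\<^sub>M I M) (\<lambda>z. \<Sum>S\<in>Pow I. \<Sum>T\<in>Pow I. (a S * b T) * (monomial \<xi> S z * monomial \<zeta> T z))"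
    unfolding multilinear_def sum_product by (simp add: mult_ac)
  also have "\<dots> = (\<Sum>S\<in>Pow I. \<Sum>T\<in>Pow I. (a S * b T) * (if S = T then \<rho> ^ card S else 0))"
    using int
    by (subst Bochner_Integration.integral_sum,
        auto intro!: sum.cong simp: integral_monomial_monomial[OF 1 2 \<rho> I])
  also have "\<dots> = (\<Sum>S\<in>Pow I. \<rho> ^ card S * a S * b S)"
    using I by (simp add: if_distrib mult_ac cong: if_cong)
  finally show ?thesis .
qed

context standardized_product
begin

lemma second_moment_multilinear:
  assumes "finite I"
  shows "(LINT z|Pi\<^sub>M I M. (multilinear \<xi> I c z)^2) = (\<Sum>S\<in>Pow I. (c S)^2)"
proof -
  have "integral\<^sup>L (M i) (\<lambda>y. \<xi> y * \<xi> y) = 1" for i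
    using standardized.var_\<xi>[OF std, of i] by (simp add: power2_eq_square)
  from integral_multilinear_multilinear[OF standardized_product_axioms standardized_product_axioms this assms]
  show ?thesis by (simp add: power2_eq_square)
qed

end

section \<open>Lindeberg replacement\<close>

lemma integrable_smooth_ramp:
  assumes "prob_space M" "L4 M f" shows "integrable M (\<lambda>x. smooth_ramp (f x))"
proof (rule Bochner_Integration.integrable_bound)
  show "integrable M (\<lambda>x. 3 * (f x)^2)" using L4_integrable_sq[OF assms] by simp
  show "(\<lambda>x. smooth_ramp (f x)) \<in> borel_measurable M"
    using L4_measurable[OF assms(2)] by measurable
  have "\<bar>smooth_ramp s\<bar> \<le> 3 * s^2" for s
  proof -
    have "(max s 0)^2 \<le> s^2" by (simp add: max_def)
    then show ?thesis using smooth_ramp_bounds(1,2)[of s] by linarith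
  qed
  then show "AE x in M. norm (smooth_ramp (f x)) \<le> norm (3 * (f x)^2)" by simp
qed

text \<open>Both integrals are compared with \<open>smooth_ramp a + q * b^2\<close>, the mean of the
  common quadratic Taylor polynomial at \<open>a\<close>; the third absolute moment bounds each
  remainder by \<open>2 * K * \<bar>b\<bar>^3\<close>.\<close>

lemma smooth_ramp_replacement:
  assumes M: "standardized M \<xi> K" and N: "standardized N \<xi> K"
  shows "\<bar>(LINT y|M. smooth_ramp (a + \<xi> y * b)) - (LINT y|N. smooth_ramp (a + \<xi> y * b))\<bar> \<le> 4 * K * \<bar>b\<bar>^3"
proof -
  obtain p q where pq: "\<And>t. \<bar>smooth_ramp (a + t) - smooth_ramp a - p * t - q * t^2\<bar> \<le> 2 * \<bar>t\<bar>^3"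
    using smooth_ramp_taylor by blast
  have *: "\<bar>(LINT y|M. smooth_ramp (a + \<xi> y * b)) - (smooth_ramp a + q * b^2)\<bar> \<le> 2 * K * \<bar>b\<bar>^3"
    if "standardized M \<xi> K" for M :: "'a measure"
  proof -
    interpret standardized M \<xi> K by fact
    have "L4 M (\<lambda>y. a + b * \<xi> y)" by (intro L4_add L4_const L4_cmult \<xi>_L4 prob_space_axioms)
    then have int: "integrable M (\<lambda>y. smooth_ramp (a + \<xi> y * b))"
      by (simp add: integrable_smooth_ramp prob_space_axioms mult.commute)
    have eq: "(LINT y|M. smooth_ramp (a + \<xi> y * b)) - (smooth_ramp a + q * b^2)
      = (LINT y|M. smooth_ramp (a + \<xi> y * b) - smooth_ramp a - p * b * \<xi> y - q * b^2 * (\<xi> y)^2)"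
      using int \<xi>_integrable mean_\<xi> var_\<xi> prob_space by simp
    have "\<bar>(LINT y|M. smooth_ramp (a + \<xi> y * b)) - (smooth_ramp a + q * b^2)\<bar>
        \<le> (LINT y|M. 2 * \<bar>b\<bar>^3 * \<bar>\<xi> y\<bar>^3)"
      unfolding eq
    proof (rule order_trans[OF integral_abs_bound], rule integral_mono)
      show "integrable M (\<lambda>y. \<bar>smooth_ramp (a + \<xi> y * b) - smooth_ramp a - p * b * \<xi> y - q * b^2 * (\<xi> y)^2\<bar>)"
        using int \<xi>_integrable by simp
      show "integrable M (\<lambda>y. 2 * \<bar>b\<bar>^3 * \<bar>\<xi> y\<bar>^3)" using \<xi>_integrable by simp
      show "\<bar>smooth_ramp (a + \<xi> y * b) - smooth_ramp a - p * b * \<xi> y - q * b^2 * (\<xi> y)^2\<bar>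
        \<le> 2 * \<bar>b\<bar>^3 * \<bar>\<xi> y\<bar>^3" for y
        using pq[of "\<xi> y * b"] by (simp add: abs_mult power_mult_distrib mult_ac)
    qed
    also have "\<dots> \<le> 2 * \<bar>b\<bar>^3 * K"
      using third_\<xi> by (simp add: mult_left_mono)
    finally show ?thesis by (simp add: mult_ac)
  qed
  show ?thesis using *[OF M] *[OF N] by linarith
qed

definition influence :: "nat set \<Rightarrow> (nat set \<Rightarrow> real) \<Rightarrow> nat \<Rightarrow> real" where
  "influence I c i = (\<Sum>S | S \<subseteq> I \<and> i \<in> S. (c S)^2)"

lemma influence_nonneg: "influence I c i \<ge> 0"
  unfolding influence_def by (rule sum_nonneg) auto

lemma influence_insert:
  assumes "finite I" "i \<notin> I"
  shows "influence (insert i I) c i = (\<Sum>S\<in>Pow I. (c (insert i S))^2)"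
proof -
  have "{S. S \<subseteq> insert i I \<and> i \<in> S} = insert i ` Pow I"
  proof (intro set_eqI iffI)
    fix S assume "S \<in> {S. S \<subseteq> insert i I \<and> i \<in> S}"
    then have "S = insert i (S - {i})" "S - {i} \<in> Pow I" by auto
    then show "S \<in> insert i ` Pow I" by blast
  qed auto
  moreover have "inj_on (insert i) (Pow I)"
    using assms(2) by (intro inj_onI) (metis PowD insert_ident subsetD)
  ultimately show ?thesis by (simp add: influence_def sum.reindex)
qed

text \<open>Each \<open>S\<close> is counted once per element, hence at most \<open>d\<close> times
  unless its coefficient vanishes. This keeps the total Lindeberg error, and the number of
  influential coordinates, independent of the number of variables.\<close>

lemma sum_influence_le:
  assumes "finite I" and deg: "\<And>S. S \<subseteq> I \<Longrightarrow> card S > d \<Longrightarrow> c S = 0"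
  shows "(\<Sum>i\<in>I. influence I c i) \<le> d * (\<Sum>S\<in>Pow I. (c S)^2)"
proof -
  have "(\<Sum>i\<in>I. influence I c i) = (\<Sum>i\<in>I. \<Sum>S\<in>Pow I. if i \<in> S then (c S)^2 else 0)"
    unfolding influence_def using assms(1)
    by (intro sum.cong[OF refl]) (simp add: sum.If_cases Int_def)
  also have "\<dots> = (\<Sum>S\<in>Pow I. \<Sum>i\<in>I. if i \<in> S then (c S)^2 else 0)" by (rule sum.swap)
  also have "\<dots> = (\<Sum>S\<in>Pow I. card S * (c S)^2)"
    using assms(1) by (intro sum.cong refl) (auto simp: sum.If_cases Int_absorb1)
  also have "\<dots> \<le> (\<Sum>S\<in>Pow I. d * (c S)^2)"
  proof (rule sum_mono)
    fix S assume "S \<in> Pow I"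
    then show "card S * (c S)^2 \<le> d * (c S)^2"
      using deg[of S] by (cases "card S > d") (auto intro!: mult_right_mono)
  qed
  finally show ?thesis by (simp add: sum_distrib_left)
qed

text \<open>With the polynomial written as A + \<xi> y B, the replacement costs a third absolute
  moment of B. Weighted AM-GM and the fourth-moment bound reduce it to the second moment of B, which
  is exactly the influence. The result is linear in the influence with the small factor
  \<open>t\<close>, so it can be summed over all coordinates.\<close>

lemma lindeberg_step:
  assumes M: "standardized_product M \<xi> K" and N: "standardized_product N \<xi> K"
    and I: "finite I" "i \<notin> I" and eq: "\<And>j. j \<in> I \<Longrightarrow> M j = N j"
    and deg: "\<And>S. S \<subseteq> insert i I \<Longrightarrow> card S > d \<Longrightarrow> c S = 0"
    and t: "t > 0" and inf: "influence (insert i I) c i \<le> (t / (4 * K) ^ d)^2"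
  shows "\<bar>(LINT z|Pi\<^sub>M (insert i I) M. smooth_ramp (multilinear \<xi> (insert i I) c z))
      - (LINT z|Pi\<^sub>M (insert i I) N. smooth_ramp (multilinear \<xi> (insert i I) c z))\<bar>
    \<le> 4 * K * t * influence (insert i I) c i"
proof -
  interpret M: standardized_product M \<xi> K by fact
  interpret N: standardized_product N \<xi> K by fact
  interpret Mi: standardized "M i" \<xi> K by (rule M.std)
  interpret PI: prob_space "Pi\<^sub>M I M" by (rule M.prob_PiM)
  have eqI: "Pi\<^sub>M I N = Pi\<^sub>M I M" using eq by (intro PiM_cong) auto
  have K: "K \<ge> 1" by (rule Mi.K_ge_1)
  define A where "A = multilinear \<xi> I c"
  define B where "B = multilinear \<xi> I (\<lambda>S. c (insert i S))"
  define b where "b = influence (insert i I) c i"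
  have b: "b = (\<Sum>S\<in>Pow I. (c (insert i S))^2)" "b \<ge> 0"
    unfolding b_def by (rule influence_insert[OF I], rule influence_nonneg)
  have A: "L4 (Pi\<^sub>M I M) A" and B: "L4 (Pi\<^sub>M I M) B"
    unfolding A_def B_def using I by (auto intro: M.multilinear_L4)
  define \<Phi> where "\<Phi> L z = (LINT y|L. smooth_ramp (A z + \<xi> y * B z))" for L z
  have int: "integrable (Pi\<^sub>M (insert i I) L) (\<lambda>z. smooth_ramp (multilinear \<xi> (insert i I) c z))"
    if "standardized_product L \<xi> K" for L
    using that I by (intro integrable_smooth_ramp standardized_product.prob_PiM standardized_product.multilinear_L4) auto
  have fold: "(LINT z|Pi\<^sub>M (insert i I) L. smooth_ramp (multilinear \<xi> (insert i I) c z))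
      = (LINT z|Pi\<^sub>M I M. \<Phi> (L i) z)" "integrable (Pi\<^sub>M I M) (\<Phi> (L i))"
    if L: "standardized_product L \<xi> K" and eqL: "Pi\<^sub>M I L = Pi\<^sub>M I M" for L
  proof -
    interpret L: standardized_product L \<xi> K by fact
    have e: "smooth_ramp (multilinear \<xi> (insert i I) c (z(i := y))) = smooth_ramp (A z + \<xi> y * B z)" for z y
      using I by (simp add: multilinear_upd A_def B_def)
    show "(LINT z|Pi\<^sub>M (insert i I) L. smooth_ramp (multilinear \<xi> (insert i I) c z))
      = (LINT z|Pi\<^sub>M I M. \<Phi> (L i) z)"
      unfolding L.product_integral_insert[OF I int[OF L]] eqL e \<Phi>_def ..
    interpret Li: standardized "L i" \<xi> K by (rule L.std)
    show "integrable (Pi\<^sub>M I M) (\<Phi> (L i))"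
    proof (rule Bochner_Integration.integrable_bound)
      show "integrable (Pi\<^sub>M I M) (\<lambda>z. 6 * (A z)^2 + 6 * (B z)^2)"
        using L4_integrable_sq[OF PI.prob_space_axioms A] L4_integrable_sq[OF PI.prob_space_axioms B] by simp
      have [measurable]: "A \<in> borel_measurable (Pi\<^sub>M I M)" "B \<in> borel_measurable (Pi\<^sub>M I M)"
        using A B by (auto intro: L4_measurable)
      show "\<Phi> (L i) \<in> borel_measurable (Pi\<^sub>M I M)"
        unfolding \<Phi>_def by measurable
      have "\<bar>\<Phi> (L i) z\<bar> \<le> 6 * (A z)^2 + 6 * (B z)^2" for z
      proof -
        have *: "0 \<le> smooth_ramp s" "smooth_ramp s \<le> 3 * s^2" for s
        proof -
          have "(max s 0)^2 \<le> s^2" by (simp add: max_def)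
          then show "0 \<le> smooth_ramp s" "smooth_ramp s \<le> 3 * s^2"
            using smooth_ramp_bounds(1,2)[of s] by linarith+
        qed
        have "\<Phi> (L i) z \<ge> 0" unfolding \<Phi>_def by (intro integral_nonneg_AE) (auto simp: *)
        moreover have "\<Phi> (L i) z \<le> (LINT y|L i. 6 * (A z)^2 + 6 * (B z)^2 * (\<xi> y)^2)"
          unfolding \<Phi>_def
        proof (rule integral_mono')
          show "integrable (L i) (\<lambda>y. 6 * (A z)^2 + 6 * (B z)^2 * (\<xi> y)^2)"
            using Li.\<xi>_integrable by simp
          fix y
          have "0 \<le> 3 * (A z - \<xi> y * B z)^2" by simp
          then have "3 * (A z + \<xi> y * B z)^2 \<le> 6 * (A z)^2 + 6 * (B z)^2 * (\<xi> y)^2"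
            by (simp add: power2_eq_square algebra_simps)
          then show "smooth_ramp (A z + \<xi> y * B z) \<le> 6 * (A z)^2 + 6 * (B z)^2 * (\<xi> y)^2"
            using *(2) order_trans by blast
        qed simp
        ultimately show ?thesis using Li.\<xi>_integrable Li.var_\<xi> Li.prob_space by simp
      qed
      then show "AE z in Pi\<^sub>M I M. norm (\<Phi> (L i) z) \<le> norm (6 * (A z)^2 + 6 * (B z)^2)"
        by (intro AE_I2) simp
    qed
  qed
  have "\<bar>(LINT z|Pi\<^sub>M (insert i I) M. smooth_ramp (multilinear \<xi> (insert i I) c z))
      - (LINT z|Pi\<^sub>M (insert i I) N. smooth_ramp (multilinear \<xi> (insert i I) c z))\<bar>
    = \<bar>LINT z|Pi\<^sub>M I M. \<Phi> (M i) z - \<Phi> (N i) z\<bar>"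
    using fold[OF M] fold[OF N] eqI by simp
  also have "\<dots> \<le> (LINT z|Pi\<^sub>M I M. 2 * K * (t * (B z)^2 + B z ^ 4 / t))"
  proof (rule order_trans[OF integral_abs_bound], rule integral_mono)
    show "integrable (Pi\<^sub>M I M) (\<lambda>z. \<bar>\<Phi> (M i) z - \<Phi> (N i) z\<bar>)"
      using fold(2)[OF M] fold(2)[OF N] eqI by simp
    show "integrable (Pi\<^sub>M I M) (\<lambda>z. 2 * K * (t * (B z)^2 + B z ^ 4 / t))"
      using B L4_integrable_sq[OF PI.prob_space_axioms B] by (simp add: L4_def)
    fix z
    have "\<bar>\<Phi> (M i) z - \<Phi> (N i) z\<bar> \<le> 4 * K * \<bar>B z\<bar>^3"
      unfolding \<Phi>_def by (rule smooth_ramp_replacement[OF M.std N.std])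
    also have "\<dots> \<le> 4 * K * ((t * (B z)^2 + B z ^ 4 / t) / 2)"
      using K by (intro mult_left_mono cube_le_AMGM t) auto
    finally show "\<bar>\<Phi> (M i) z - \<Phi> (N i) z\<bar> \<le> 2 * K * (t * (B z)^2 + B z ^ 4 / t)" by simp
  qed
  also have "\<dots> = 2 * K * (t * (LINT z|Pi\<^sub>M I M. (B z)^2) + (LINT z|Pi\<^sub>M I M. B z ^ 4) / t)"
    using B L4_integrable_sq[OF PI.prob_space_axioms B] by (simp add: L4_def)
  also have "\<dots> \<le> 2 * K * (t * b + t * b)"
  proof -
    have B2: "(LINT z|Pi\<^sub>M I M. (B z)^2) = b"
      unfolding B_def b(1) by (rule M.second_moment_multilinear[OF I(1)])
    have "(LINT z|Pi\<^sub>M I M. B z ^ 4) \<le> (\<Sum>S\<in>Pow I. (4 * K) ^ card S * (c (insert i S))^2)^2"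
      unfolding B_def by (rule M.fourth_moment_multilinear[OF I(1)])
    also have "\<dots> \<le> ((4 * K) ^ d * b)^2"
      unfolding b(1) sum_distrib_left
    proof (intro power_mono sum_mono sum_nonneg)
      fix S assume S: "S \<in> Pow I"
      then have "card (insert i S) = Suc (card S)"
        using I by (intro card_insert_disjoint) (auto intro: finite_subset)
      moreover have "insert i S \<subseteq> insert i I" using S by auto
      ultimately have "c (insert i S) = 0" if "card S > d" using deg[of "insert i S"] that by simp
      moreover have "(4 * K) ^ card S \<le> (4 * K) ^ d" if "card S \<le> d"
        using K that by (intro power_increasing) auto
      ultimately show "(4 * K) ^ card S * (c (insert i S))^2 \<le> (4 * K) ^ d * (c (insert i S))^2"
        by (cases "card S > d") (auto intro: mult_right_mono)
      show "0 \<le> (4 * K) ^ card S * (c (insert i S))^2" using K by simp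
    qed
    also have "\<dots> = ((4 * K) ^ d)^2 * b * b" by (simp add: power2_eq_square)
    \<comment> \<open>Only one of the two factors \<open>b\<close> is traded for its smallness; the
      other survives as the influence in the conclusion.\<close>
    also have "\<dots> \<le> ((4 * K) ^ d)^2 * (t / (4 * K) ^ d)^2 * b"
      using inf b(2) by (intro mult_right_mono mult_left_mono) (auto simp: b_def)
    also have "\<dots> = t^2 * b" using K by (simp add: power_divide)
    finally have "(LINT z|Pi\<^sub>M I M. B z ^ 4) / t \<le> t * b"
      using t by (simp add: field_simps power2_eq_square)
    then show ?thesis using B2 K t by (intro mult_left_mono add_mono) auto
  qed
  finally show ?thesis by (simp add: b_def)
qed

lemma lindeberg_replacement:
  assumes M: "standardized_product M \<xi> K" and N: "standardized_product N \<xi> K"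
    and deg: "\<And>S. S \<subseteq> {..<n} \<Longrightarrow> card S > d \<Longrightarrow> c S = 0"
    and t: "t > 0" and inf: "\<And>i. i < n \<Longrightarrow> influence {..<n} c i \<le> (t / (4 * K) ^ d)^2"
  shows "\<bar>(LINT z|Pi\<^sub>M {..<n} M. smooth_ramp (multilinear \<xi> {..<n} c z))
      - (LINT z|Pi\<^sub>M {..<n} N. smooth_ramp (multilinear \<xi> {..<n} c z))\<bar>
    \<le> 4 * K * t * d * (\<Sum>S\<in>Pow {..<n}. (c S)^2)"
proof -
  \<comment> \<open>The hybrid \<open>H k\<close> already has the new law in the first
    \<open>k\<close> coordinates, so \<open>H k\<close> and \<open>H (Suc k)\<close> can differ at
    the index \<open>k\<close> only.\<close>
  define H where "H k i = (if i < k then N i else M i)" for k i :: nat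
  have H: "standardized_product (H k) \<xi> K" for k
    using M N by (auto simp: standardized_product_def H_def)
  define E where "E k = (LINT z|Pi\<^sub>M {..<n} (H k). smooth_ramp (multilinear \<xi> {..<n} c z))" for k
  have step: "\<bar>E k - E (Suc k)\<bar> \<le> 4 * K * t * influence {..<n} c k" if "k < n" for k
  proof -
    have ins: "insert k ({..<n} - {k}) = {..<n}" using that by auto
    show ?thesis
      using lindeberg_step[OF H H, of "{..<n} - {k}" k k "Suc k" d c t, unfolded ins] deg t inf[OF that]
      unfolding E_def by (force simp: H_def)
  qed
  have K: "K \<ge> 1" using M by (auto simp: standardized_product_def standardized_def standardized_axioms_def)
  have "\<bar>E 0 - E n\<bar> = \<bar>\<Sum>k<n. E k - E (Suc k)\<bar>" by (simp add: sum_lessThan_telescope')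
  also have "\<dots> \<le> (\<Sum>k<n. 4 * K * t * influence {..<n} c k)"
    using step by (intro order_trans[OF sum_abs] sum_mono) auto
  also have "\<dots> = 4 * K * t * (\<Sum>k<n. influence {..<n} c k)" by (simp add: sum_distrib_left)
  also have "\<dots> \<le> 4 * K * t * (d * (\<Sum>S\<in>Pow {..<n}. (c S)^2))"
    using K t deg by (intro mult_left_mono sum_influence_le) auto
  finally have "\<bar>E 0 - E n\<bar> \<le> 4 * K * t * d * (\<Sum>S\<in>Pow {..<n}. (c S)^2)" by (simp add: mult.assoc)
  moreover have "Pi\<^sub>M {..<n} (H 0) = Pi\<^sub>M {..<n} M" "Pi\<^sub>M {..<n} (H n) = Pi\<^sub>M {..<n} N"
    by (auto simp: H_def intro!: PiM_cong)
  ultimately show ?thesis by (simp add: E_def)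
qed

section \<open>Distance to a convex body\<close>

text \<open>For the unit outer normal e at the projection w, the excess of v over the support
  function is exactly the distance D. Passing from e to a nearby u shifts values on K by at most
  \<delta> R each and the value on v - w by at most \<delta> D <= D / 2; moving D / 2 to the left
  produces the factor 2.\<close>

lemma closest_point_dist_le_support:
  fixes K :: "'a::euclidean_space set"
  assumes K: "closed K" "convex K" "K \<noteq> {}" and R: "\<And>k. k \<in> K \<Longrightarrow> norm k \<le> R"
    and v: "v \<notin> K" and u: "dist ((v - closest_point K v) /\<^sub>R norm (v - closest_point K v)) u \<le> \<delta>"
    and \<delta>: "\<delta> \<le> 1/2"
  shows "dist v (closest_point K v) \<le> 2 * (inner u v - (SUP k\<in>K. inner u k)) + 4 * (\<delta> * R)"
proof -
  define w where "w = closest_point K v"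
  define D where "D = norm (v - w)"
  define e where "e = (v - w) /\<^sub>R D"
  have w: "w \<in> K" unfolding w_def using K by (intro closest_point_in_set)
  have D: "D > 0" using v w by (auto simp: D_def)
  have eu: "norm (e - u) \<le> \<delta>" using u by (simp add: e_def D_def w_def dist_norm)
  have \<delta>0: "\<delta> \<ge> 0" using eu norm_ge_zero order_trans by blast
  have R0: "R \<ge> 0" using R[OF w] norm_ge_zero order_trans by blast
  have ev: "inner e (v - w) = D"
    using D by (simp add: e_def D_def dot_square_norm power2_eq_square)
  have ek: "inner e k \<le> inner e w" if "k \<in> K" for k
  proof -
    have "inner (v - w) (k - w) \<le> 0"
      unfolding w_def by (rule closest_point_dot[OF K(2,1) that])
    then have "inner e (k - w) \<le> 0" using D by (simp add: e_def mult_le_0_iff)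
    then show ?thesis by (simp add: inner_diff_right)
  qed
  have uk: "\<bar>inner u k - inner e k\<bar> \<le> \<delta> * norm k" for k
  proof -
    have "\<bar>inner (e - u) k\<bar> \<le> norm (e - u) * norm k" by (rule Cauchy_Schwarz_ineq2)
    also have "\<dots> \<le> \<delta> * norm k" using eu by (intro mult_right_mono) auto
    finally show ?thesis by (simp add: inner_diff_left abs_minus_commute)
  qed
  define h where "h = (SUP k\<in>K. inner u k)"
  have "h \<le> inner u w + 2 * (\<delta> * R)"
    unfolding h_def
  proof (rule cSUP_least[OF K(3)])
    fix k assume k: "k \<in> K"
    have "\<delta> * norm k \<le> \<delta> * R" "\<delta> * norm w \<le> \<delta> * R" using R k w \<delta>0 by (auto intro: mult_left_mono)
    then show "inner u k \<le> inner u w + 2 * (\<delta> * R)"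
      using uk[of k] uk[of w] ek[OF k] by linarith
  qed
  moreover have "inner u v - inner u w \<ge> D / 2"
  proof -
    have "\<delta> * norm (v - w) \<le> 1/2 * norm (v - w)" using \<delta> by (intro mult_right_mono) auto
    then have "\<bar>inner u (v - w) - D\<bar> \<le> D / 2" using uk[of "v - w"] ev by (simp add: D_def)
    then show ?thesis unfolding inner_diff_right by linarith
  qed
  ultimately have "D \<le> 2 * (inner u v - h) + 4 * (\<delta> * R)" by (simp add: field_simps)
  then show ?thesis by (simp add: D_def w_def h_def dist_norm)
qed

lemma sphere_net:
  fixes \<delta> :: real assumes "\<delta> > 0"
  obtains U :: "'a::euclidean_space set"
  where "finite U" "\<And>u. u \<in> U \<Longrightarrow> norm u = 1" "\<And>e. norm e = 1 \<Longrightarrow> \<exists>u\<in>U. dist e u \<le> \<delta>"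
proof -
  have "compact (sphere 0 1 :: 'a set)" by simp
  moreover have "sphere 0 1 \<subseteq> (\<Union>u\<in>sphere 0 (1::real) :: 'a set. ball u \<delta>)" using assms by auto
  ultimately obtain U :: "'a set"
    where U: "U \<subseteq> sphere 0 1" "finite U" "sphere 0 1 \<subseteq> (\<Union>u\<in>U. ball u \<delta>)"
    by (metis compactE_image open_ball)
  show ?thesis
  proof (rule that[OF U(2)])
    show "norm u = 1" if "u \<in> U" for u using U(1) that by auto
    show "\<exists>u\<in>U. dist e u \<le> \<delta>" if "norm e = 1" for e
    proof -
      have "e \<in> sphere 0 1" using that by simp
      then obtain u where "u \<in> U" "e \<in> ball u \<delta>" using U(3) by blast
      then show ?thesis by (auto simp: dist_commute intro!: bexI[of _ u])
    qed
  qed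
qed

text \<open>The relevant direction of the net depends on \<open>v\<close>; summing over all of
  \<open>U\<close> removes this dependence, so that each direction can be integrated separately. The
  constants come from (2 s + r)^2 <= 8 s^2 + 2 r^2 with r = 4 \<delta> R.\<close>

lemma closest_point_dist_sq_le_net:
  fixes K :: "'a::euclidean_space set"
  assumes K: "closed K" "convex K" "K \<noteq> {}" and R: "\<And>k. k \<in> K \<Longrightarrow> norm k \<le> R"
    and U: "finite U" "\<And>e. norm e = 1 \<Longrightarrow> \<exists>u\<in>U. dist e u \<le> \<delta>" and \<delta>: "\<delta> \<le> 1/2"
  shows "(dist v (closest_point K v))^2
    \<le> 32 * (\<delta> * R)^2 + 8 * (\<Sum>u\<in>U. (max (inner u v - (SUP k\<in>K. inner u k)) 0)^2)"
proof (cases "v \<in> K")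
  case True
  then show ?thesis by (simp add: closest_point_self sum_nonneg)
next
  case False
  define e where "e = (v - closest_point K v) /\<^sub>R norm (v - closest_point K v)"
  have "closest_point K v \<noteq> v" using closest_point_in_set[OF K(1,3), of v] False by metis
  then have "norm e = 1" by (simp add: e_def)
  then obtain u where u: "u \<in> U" "dist e u \<le> \<delta>" using U(2) by blast
  define s where "s = max (inner u v - (SUP k\<in>K. inner u k)) 0"
  have "dist v (closest_point K v) \<le> 2 * (inner u v - (SUP k\<in>K. inner u k)) + 4 * (\<delta> * R)"
    using closest_point_dist_le_support[OF K R False, of u \<delta>] u(2) \<delta> by (simp add: e_def)
  also have "\<dots> \<le> 2 * s + 4 * (\<delta> * R)" unfolding s_def by (intro add_right_mono mult_left_mono) auto
  finally have "dist v (closest_point K v) \<le> 2 * s + 4 * (\<delta> * R)" .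
  then have "(dist v (closest_point K v))^2 \<le> (2 * s + 4 * (\<delta> * R))^2"
    by (intro power_mono) (auto simp: mult.assoc)
  also have "\<dots> \<le> 8 * s^2 + 32 * (\<delta> * R)^2"
    using zero_le_power2[of "2 * s - 4 * (\<delta> * R)"] by (simp add: power2_eq_square algebra_simps)
  also have "s^2 \<le> (\<Sum>u\<in>U. (max (inner u v - (SUP k\<in>K. inner u k)) 0)^2)"
    unfolding s_def using u U(1) by (intro member_le_sum) auto
  finally show ?thesis by simp
qed

lemma norm_le_card_unit_box:
  fixes x :: "real ^ 'l" assumes "\<And>j. x $ j \<in> {0..1}" shows "norm x \<le> CARD('l)"
proof -
  have "norm x \<le> (\<Sum>j\<in>UNIV. \<bar>x $ j\<bar>)" by (rule norm_le_l1_cart)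
  also have "\<dots> \<le> (\<Sum>j\<in>(UNIV :: 'l set). 1)"
    using assms by (intro sum_mono) (auto simp: abs_le_iff intro: order_trans[of _ 0])
  finally show ?thesis by simp
qed

section \<open>Vector-valued Fourier expansions\<close>

definition vec_multilinear ::
  "('a \<Rightarrow> real) \<Rightarrow> nat set \<Rightarrow> (nat set \<Rightarrow> 'b::real_inner) \<Rightarrow> (nat \<Rightarrow> 'a) \<Rightarrow> 'b" where
  "vec_multilinear \<xi> I a z = (\<Sum>S\<in>Pow I. monomial \<xi> S z *\<^sub>R a S)"

lemma inner_vec_multilinear:
  "inner u (vec_multilinear \<xi> I a z) = multilinear \<xi> I (\<lambda>S. inner u (a S)) z"
  by (simp add: vec_multilinear_def multilinear_def inner_sum_right mult.commute)

lemma vec_multilinear_nth: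
  "vec_multilinear \<xi> I a z $ j = multilinear \<xi> I (\<lambda>S. a S $ j) z"
  by (simp add: vec_multilinear_def multilinear_def mult.commute)

definition vec_fourier :: "real \<Rightarrow> nat \<Rightarrow> ((nat \<Rightarrow> real) \<Rightarrow> real ^ 'l) \<Rightarrow> nat set \<Rightarrow> real ^ 'l" where
  "vec_fourier p n f S = (\<chi> j. fourier p n (\<lambda>x. f x $ j) S)"

lemma vec_fourier_expansion:
  assumes p: "p \<in> {-1<..<1}" and z: "z \<in> cube n"
  shows "f z = vec_multilinear (chi p) {..<n} (vec_fourier p n f) z"
proof -
  have "f z $ j = vec_multilinear (chi p) {..<n} (vec_fourier p n f) z $ j" for j
    using theI'[OF ex1_fourier[OF p, of n "\<lambda>x. f x $ j"], folded fourier_def] z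
    by (simp add: vec_multilinear_nth multilinear_def vec_fourier_def monomial_def)
  then show ?thesis by (simp add: vec_eq_iff)
qed

lemma monomial_restrict:
  "S \<subseteq> I \<Longrightarrow> monomial g S (\<lambda>i\<in>I. s (z i)) = monomial (\<lambda>y. g (s y)) S z"
  unfolding monomial_def by (intro prod.cong) auto

text \<open>Turns a polynomial in the first or second components into one on the space of pairs,
  where a single product measure governs both functions.\<close>

lemma vec_multilinear_restrict:
  "vec_multilinear g I a (\<lambda>i\<in>I. s (z i)) = vec_multilinear (\<lambda>y. g (s y)) I a z"
  unfolding vec_multilinear_def by (intro sum.cong) (auto simp: monomial_restrict)

text \<open>
  Partial re-randomisation: the coordinate \<open>i\<close> is kept with probability \<open>\<eta> i\<close> and resampled
  otherwise. It multiplies the coefficient of \<open>S\<close> by the product of the \<open>\<eta> i\<close> over \<open>S\<close>, so that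
  \<open>\<eta> i = 0\<close> averages out the coordinate \<open>i\<close>.
\<close>

lemma rerandomisation_in_convex:
  fixes f :: "(nat \<Rightarrow> real) \<Rightarrow> real ^ 'l"
  assumes p: "p \<in> {-1<..<1}" and f: "\<And>x. x \<in> cube n \<Longrightarrow> f x \<in> K" and K: "convex K"
    and \<eta>: "\<And>i. \<eta> i \<in> {0..1}" and z: "z \<in> cube n"
  shows "vec_multilinear (chi p) {..<n} (\<lambda>S. (\<Prod>i\<in>S. \<eta> i) *\<^sub>R vec_fourier p n f S) z \<in> K"
proof -
  \<comment> \<open>\<open>k w\<close> is the probability that re-randomisation turns
    \<open>z\<close> into \<open>w\<close>: by completeness of \<open>chi p\<close>, each factor is
    \<open>\<eta> i\<close> times the indicator of z i = w i, plus 1 - \<eta> i times the mass of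
    \<open>w i\<close>.\<close>
  define k where "k w = (\<Prod>i<n. (1 + w i * p) / 2 * (1 + \<eta> i * chi p (z i) * chi p (w i)))" for w
  have k_nonneg: "k w \<ge> 0" if w: "w \<in> cube n" for w
    unfolding k_def
  proof (rule prod_nonneg)
    fix i assume "i \<in> {..<n}"
    then have zw: "z i \<in> {-1, 1}" "w i \<in> {-1, 1}" using z w by (auto simp: cube_def)
    have "(1 + w i * p) / 2 * (1 + \<eta> i * chi p (z i) * chi p (w i))
      = \<eta> i * ((1 + w i * p) / 2 * (1 + chi p (z i) * chi p (w i))) + (1 - \<eta> i) * ((1 + w i * p) / 2)"
    proof -
      have "q * (1 + e * x * y) = e * (q * (1 + x * y)) + (1 - e) * q" for q e x y :: real
        by (simp add: algebra_simps)
      then show ?thesis by blast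
    qed
    also have "\<dots> = \<eta> i * (if z i = w i then 1 else 0) + (1 - \<eta> i) * ((1 + w i * p) / 2)"
      unfolding chi_complete[OF p zw] ..
    also have "\<dots> \<ge> 0" using \<eta>[of i] p zw by (intro add_nonneg_nonneg mult_nonneg_nonneg) auto
    finally show "(1 + w i * p) / 2 * (1 + \<eta> i * chi p (z i) * chi p (w i)) \<ge> 0" .
  qed
  have k_mono: "(\<Sum>w\<in>cube n. k w * monomial (chi p) S w) = (\<Prod>i\<in>S. \<eta> i) * monomial (chi p) S z"
    if S: "S \<subseteq> {..<n}" for S
  proof -
    let ?g = "\<lambda>i w. (1 + w * p) / 2 * (1 + \<eta> i * chi p (z i) * chi p w) * (if i \<in> S then chi p w else 1)"
    have g: "(\<Sum>w\<in>{-1, 1}. ?g i w) = (if i \<in> S then \<eta> i * chi p (z i) else 1)" for i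
    proof -
      have gen: "q * (1 + c * x) * x = q * x + c * (q * x^2)" "q * (1 + c * x) = q + c * (q * x)"
        for q c x :: real by (simp_all add: algebra_simps power2_eq_square)
      have "(\<Sum>w\<in>{-1, 1}. (1 + w * p) / 2 * (1 + c * chi p w) * chi p w) =
         (\<Sum>w\<in>{-1, 1}. (1 + w * p) / 2 * chi p w) + c * (\<Sum>w\<in>{-1, 1}. (1 + w * p) / 2 * (chi p w)^2)"
        "(\<Sum>w\<in>{-1, 1}. (1 + w * p) / 2 * (1 + c * chi p w)) =
         (\<Sum>w\<in>{-1, 1}. (1 + w * p) / 2) + c * (\<Sum>w\<in>{-1, 1}. (1 + w * p) / 2 * chi p w)" for c
        unfolding sum_distrib_left sum.distrib[symmetric]
        by (intro sum.cong refl gen)+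
      note this[of "\<eta> i * chi p (z i)", unfolded chi_orthogonal[OF p]]
      then show ?thesis by (cases "i \<in> S") simp_all
    qed
    have "monomial (chi p) S w = (\<Prod>i<n. if i \<in> S then chi p (w i) else 1)" for w
      unfolding monomial_def using S by (simp add: prod.If_cases Int_absorb1 flip: Collect_mem_eq)
    then have "(\<Sum>w\<in>cube n. k w * monomial (chi p) S w) = (\<Sum>w\<in>cube n. \<Prod>i<n. ?g i (w i))"
      by (simp only: k_def prod.distrib)
    also have "\<dots> = (\<Prod>i<n. \<Sum>w\<in>{-1, 1}. ?g i w)"
      unfolding cube_def by (rule prod_sum_PiE[symmetric]) auto
    also have "\<dots> = (\<Prod>i\<in>S. \<eta> i * chi p (z i))"
      unfolding g using S by (simp add: prod.If_cases Int_absorb1 flip: Collect_mem_eq)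
    finally show ?thesis by (simp add: monomial_def prod.distrib)
  qed
  have sum1: "(\<Sum>w\<in>cube n. k w) = 1"
    using k_mono[of "{}"] by (simp add: monomial_def)
  have "(\<Sum>w\<in>cube n. k w *\<^sub>R f w)
    = (\<Sum>w\<in>cube n. \<Sum>S\<in>Pow {..<n}. (k w * monomial (chi p) S w) *\<^sub>R vec_fourier p n f S)"
    by (intro sum.cong refl, subst vec_fourier_expansion[OF p])
       (auto simp: vec_multilinear_def scaleR_sum_right)
  also have "\<dots> = (\<Sum>S\<in>Pow {..<n}. (\<Sum>w\<in>cube n. k w * monomial (chi p) S w) *\<^sub>R vec_fourier p n f S)"
    by (subst sum.swap) (simp add: scaleR_sum_left)
  also have "\<dots> = vec_multilinear (chi p) {..<n} (\<lambda>S. (\<Prod>i\<in>S. \<eta> i) *\<^sub>R vec_fourier p n f S) z"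
    unfolding vec_multilinear_def by (intro sum.cong refl) (simp add: k_mono mult.commute)
  finally show ?thesis
    using convex_sum[OF finite_cube K sum1, of f] k_nonneg f by simp
qed

section \<open>The two laws of a coordinate pair\<close>

lemma one_minus_square_pos: "p \<in> {-1<..<1} \<Longrightarrow> 0 < 1 - p^2" for p :: real
  by (simp add: abs_square_less_1 abs_less_iff)

lemma chi_affine: "chi p z = 1 / sqrt (1 - p^2) * z + - (p / sqrt (1 - p^2))"
  by (simp add: chi_def diff_divide_distrib)

lemma chi_measurable [measurable]: "chi p \<in> borel_measurable borel"
  unfolding chi_def by measurable

text \<open>Signs and matching Gaussians enter through mean \<open>p\<close> and second moment 1,
  hence variance 1 - p^2; in this sense \<open>chi p\<close> standardises both at once.\<close>

lemma standardized_chi: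
  assumes "prob_space M" and p: "p \<in> {-1<..<1}" and s: "L4 M s"
    and mean: "integral\<^sup>L M s = p" and sq: "integral\<^sup>L M (\<lambda>y. (s y)^2) = 1"
    and fourth: "integral\<^sup>L M (\<lambda>y. chi p (s y) ^ 4) \<le> K" and K: "K \<ge> 1"
  shows "standardized M (\<lambda>y. chi p (s y)) K"
proof -
  interpret prob_space M by fact
  note pos = one_minus_square_pos[OF p]
  have int: "integrable M s" "integrable M (\<lambda>y. (s y)^2)"
    using L4_integrable L4_integrable_sq s prob_space_axioms by auto
  show ?thesis
  proof
    show "L4 M (\<lambda>y. chi p (s y))"
      unfolding chi_affine by (intro L4_add L4_cmult L4_const s prob_space_axioms)
    show "expectation (\<lambda>y. chi p (s y)) = 0"
      unfolding chi_affine using int mean prob_space by simp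
    have "(chi p x)^2 = (x^2 - 2 * p * x + p^2) / (1 - p^2)" for x
      using pos by (simp add: chi_def power_divide power2_diff)
    then have "expectation (\<lambda>y. (chi p (s y))^2) = (1 - 2 * p * p + p^2) / (1 - p^2)"
      using int mean sq prob_space by simp
    also have "\<dots> = 1" using pos by (simp add: power2_eq_square)
    finally show "expectation (\<lambda>y. (chi p (s y))^2) = 1" .
  qed (use fourth K in auto)
qed

lemma integral_chi_chi:
  assumes "prob_space M" and p: "p1 \<in> {-1<..<1}" "p2 \<in> {-1<..<1}" and s: "L4 M s" "L4 M t"
    and mean: "integral\<^sup>L M s = p1" "integral\<^sup>L M t = p2" and prod: "integral\<^sup>L M (\<lambda>y. s y * t y) = \<theta>"
  shows "integral\<^sup>L M (\<lambda>y. chi p1 (s y) * chi p2 (t y))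
    = (\<theta> - p1 * p2) / (sqrt (1 - p1^2) * sqrt (1 - p2^2))"
proof -
  interpret prob_space M by fact
  have int: "integrable M s" "integrable M t" "integrable M (\<lambda>y. s y * t y)"
    using L4_integrable L4_integrable_prod s prob_space_axioms by auto
  have "chi p1 x * chi p2 y = (x * y - p2 * x - p1 * y + p1 * p2) / (sqrt (1 - p1^2) * sqrt (1 - p2^2))" for x y
    by (simp add: chi_def algebra_simps)
  then show ?thesis using int mean prod prob_space by simp
qed

text \<open>
  The first summand bounds \<open>chi p\<close> squared on signs; \<open>48\<close> is a crude bound for the fourth moment of
  a standard Gaussian, written as a combination of two independent ones.
\<close>

definition moment_bound :: "real \<Rightarrow> real" where
  "moment_bound p = 4 / (1 - p^2) + 48"

lemma moment_bound_ge_1: "p \<in> {-1<..<1} \<Longrightarrow> moment_bound p \<ge> 1"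
  using one_minus_square_pos[of p] by (simp add: moment_bound_def)

definition pair_correlation :: "real \<Rightarrow> real \<Rightarrow> real \<Rightarrow> real" where
  "pair_correlation p1 p2 \<theta> = (\<theta> - p1 * p2) / (sqrt (1 - p1^2) * sqrt (1 - p2^2))"

lemma standardized_sign:
  assumes "prob_space M" and p: "p \<in> {-1<..<1}" and s: "s \<in> borel_measurable M"
    and sign: "AE y in M. s y \<in> {-1, 1}" and mean: "integral\<^sup>L M s = p"
  shows "L4 M s" and "standardized M (\<lambda>y. chi p (s y)) (moment_bound p)"
proof -
  interpret prob_space M by fact
  note pos = one_minus_square_pos[OF p]
  show L4: "L4 M s"
    unfolding L4_def
  proof
    show "integrable M (\<lambda>x. s x ^ 4)"
      by (rule integrable_const_bound[of _ 1]) (use s sign in auto)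
  qed fact
  have "(AE y in M. (s y)^2 = 1)" using sign by eventually_elim auto
  then have sq: "expectation (\<lambda>y. (s y)^2) = 1"
    using integral_cong_AE[of "\<lambda>y. (s y)^2" M "\<lambda>_. 1"] s prob_space by simp
  show "standardized M (\<lambda>y. chi p (s y)) (moment_bound p)"
  proof (rule standardized_chi[OF prob_space_axioms p L4 mean sq _ moment_bound_ge_1[OF p]])
    have chi_sq: "(chi p x)^2 \<le> 4 / (1 - p^2)" if "x \<in> {-1, 1}" for x
    proof -
      have "(x - p)^2 \<le> 2^2" using that p by (intro power2_le_iff_abs_le[THEN iffD2]) auto
      then show ?thesis using pos by (simp add: chi_def power_divide divide_right_mono)
    qed
    define a where "a = 1 / (1 - p^2)"
    have int: "integrable M s" using L4_integrable[OF prob_space_axioms L4] .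
    \<comment> \<open>On signs the square of \<open>chi p\<close> is affine in \<open>s y\<close>,
      so bounding one of two such factors by 4 / (1 - p^2) leaves an expectation that the mean
      determines.\<close>
    have "AE y in M. chi p (s y) ^ 4 \<le> 4 / (1 - p^2) * ((1 + p^2 - 2 * p * s y) / (1 - p^2))"
      using sign
    proof eventually_elim
      case (elim y)
      have "(chi p (s y))^2 * (chi p (s y))^2 \<le> 4 / (1 - p^2) * (chi p (s y))^2"
        using chi_sq[OF elim] by (intro mult_right_mono) auto
      also have "(chi p (s y))^2 = (1 + p^2 - 2 * p * s y) / (1 - p^2)"
        using pos elim by (auto simp: chi_def power_divide power2_eq_square algebra_simps)
      finally show ?case
        using \<open>(chi p (s y))^2 = _\<close> by (simp add: power4_eq_xxxx power2_eq_square mult.assoc)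
    qed
    then have "expectation (\<lambda>y. chi p (s y) ^ 4)
        \<le> expectation (\<lambda>y. 4 / (1 - p^2) * ((1 + p^2 - 2 * p * s y) / (1 - p^2)))"
    proof (intro integral_mono_AE)
      have "L4 M (\<lambda>y. chi p (s y))"
        unfolding chi_affine by (intro L4_add L4_cmult L4_const L4 prob_space_axioms)
      then show "integrable M (\<lambda>y. chi p (s y) ^ 4)" by (simp add: L4_def)
      show "integrable M (\<lambda>y. 4 / (1 - p^2) * ((1 + p^2 - 2 * p * s y) / (1 - p^2)))"
        using int by simp
    qed auto
    also have "\<dots> = 4 / (1 - p^2) * ((1 + p^2 - 2 * p * p) / (1 - p^2))"
      using int mean prob_space by simp
    also have "\<dots> = 4 / (1 - p^2)" using pos by (simp add: power2_eq_square)
    finally show "expectation (\<lambda>y. chi p (s y) ^ 4) \<le> moment_bound p"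
      by (simp add: moment_bound_def)
  qed
qed

lemma standardized_biased_pair:
  assumes p: "p1 \<in> {-1<..<1}" "p2 \<in> {-1<..<1}" and v: "valid_pair p1 p2 \<theta>"
  defines "N \<equiv> measure_pmf (biased_pair p1 p2 \<theta>)"
  shows "standardized N (\<lambda>z. chi p1 (fst z)) (moment_bound p1)"
    and "standardized N (\<lambda>z. chi p2 (snd z)) (moment_bound p2)"
    and "AE z in N. fst z \<in> {-1, 1}" and "AE z in N. snd z \<in> {-1, 1}"
    and "integral\<^sup>L N (\<lambda>z. chi p1 (fst z) * chi p2 (snd z)) = pair_correlation p1 p2 \<theta>"
proof -
  have N: "prob_space N" unfolding N_def by (rule measure_pmf.prob_space_axioms)
  show AE: "AE z in N. fst z \<in> {-1, 1}" "AE z in N. snd z \<in> {-1, 1}"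
    using set_biased_pair[OF v] unfolding N_def AE_measure_pmf_iff by fastforce+
  note m = biased_pair_moments[OF v, folded N_def]
  have ms: "fst \<in> borel_measurable N" "snd \<in> borel_measurable N" by (simp_all add: N_def)
  note 1 = standardized_sign[OF N p(1) ms(1) AE(1) m(1)]
  note 2 = standardized_sign[OF N p(2) ms(2) AE(2) m(2)]
  show "standardized N (\<lambda>z. chi p1 (fst z)) (moment_bound p1)"
    "standardized N (\<lambda>z. chi p2 (snd z)) (moment_bound p2)"
    by (rule 1(2), rule 2(2))
  show "integral\<^sup>L N (\<lambda>z. chi p1 (fst z) * chi p2 (snd z)) = pair_correlation p1 p2 \<theta>"
    using integral_chi_chi[OF N p 1(1) 2(1) m(1,2) m(3)[unfolded case_prod_beta']]
    by (simp add: pair_correlation_def)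
qed

lemma std_gaussian_fourth:
  "integrable std_gaussian (\<lambda>u. u ^ 4)" "integral\<^sup>L std_gaussian (\<lambda>u. u ^ 4) = 3"
proof -
  show "integrable std_gaussian (\<lambda>u. u ^ 4)" by (rule std_gaussian_moments)
  show "integral\<^sup>L std_gaussian (\<lambda>u. u ^ 4) = 3"
    unfolding std_gaussian_def using integral_std_normal_moment_even[of 2]
    by (subst integral_real_density) (auto simp: fact_numeral)
qed

lemma std_gaussian_pair_fourth:
  defines "P \<equiv> std_gaussian \<Otimes>\<^sub>M std_gaussian"
  shows "L4 P fst" "L4 P snd" "integral\<^sup>L P (\<lambda>z. fst z ^ 4) = 3" "integral\<^sup>L P (\<lambda>z. snd z ^ 4) = 3"
proof -
  interpret S: prob_space std_gaussian by (rule prob_space_std_gaussian)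
  interpret P: pair_prob_space std_gaussian std_gaussian ..
  have dfst: "distr P std_gaussian fst = std_gaussian"
    unfolding P_def by (rule S.distr_pair_fst)
  have dsnd: "distr P std_gaussian snd = std_gaussian"
  proof -
    have "distr P std_gaussian snd = distr (distr P P (\<lambda>(x, y). (y, x))) std_gaussian snd"
      unfolding P_def using P.distr_pair_swap by simp
    also have "\<dots> = distr P std_gaussian (snd \<circ> (\<lambda>(x, y). (y, x)))"
      unfolding P_def by (intro distr_distr measurable_snd measurable_pair_swap')
    also have "snd \<circ> (\<lambda>(x, y). (y, x)) = fst" by (auto simp: fun_eq_iff)
    finally show ?thesis using dfst by simp
  qed
  have mf: "fst \<in> measurable P std_gaussian" and msn: "snd \<in> measurable P std_gaussian"
    unfolding P_def by auto
  have m4: "(\<lambda>u::real. u ^ 4) \<in> borel_measurable std_gaussian" by simp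
  have "fst \<in> borel_measurable P" "snd \<in> borel_measurable P"
    using mf msn by (simp_all cong: measurable_cong_sets)
  then show "L4 P fst" "L4 P snd"
    using integrable_distr_eq[OF mf m4] integrable_distr_eq[OF msn m4] dfst dsnd std_gaussian_fourth mf msn
    by (auto simp: L4_def)
  show "integral\<^sup>L P (\<lambda>z. fst z ^ 4) = 3" "integral\<^sup>L P (\<lambda>z. snd z ^ 4) = 3"
    using integral_distr[OF mf m4] integral_distr[OF msn m4] dfst dsnd std_gaussian_fourth
    by auto
qed

text \<open>In standardised coordinates the Cholesky factorisation reads (u, r u + sqrt (1 - r^2)
  v), with r the pair correlation. The bound on r makes the radicand nonnegative and both
  coefficients at most 1 in absolute value, which gives 8 (3 + 3) = 48 for the second
  component.\<close>

lemma standardized_matching_gaussian: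
  assumes p: "p1 \<in> {-1<..<1}" "p2 \<in> {-1<..<1}" and v: "valid_pair p1 p2 \<theta>"
    and \<rho>: "\<bar>pair_correlation p1 p2 \<theta>\<bar> \<le> 1"
  defines "G \<equiv> matching_gaussian p1 p2 \<theta>"
  shows "standardized G (\<lambda>z. chi p1 (fst z)) (moment_bound p1)"
    and "standardized G (\<lambda>z. chi p2 (snd z)) (moment_bound p2)"
    and "integral\<^sup>L G (\<lambda>z. chi p1 (fst z) * chi p2 (snd z)) = pair_correlation p1 p2 \<theta>"
proof -
  define r where "r = pair_correlation p1 p2 \<theta>"
  have r: "r^2 \<le> 1" using \<rho> by (simp add: r_def abs_square_le_1)
  note pos = one_minus_square_pos[OF p(1)] one_minus_square_pos[OF p(2)]
  interpret S: prob_space std_gaussian by (rule prob_space_std_gaussian)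
  interpret P: pair_prob_space std_gaussian std_gaussian ..
  have G: "prob_space G" unfolding G_def matching_gaussian_def by (rule prob_space_bivariate_gaussian)
  define s1 where "s1 = sqrt (1 - p1^2)"
  define s2 where "s2 = sqrt (1 - p2^2)"
  have s: "s1 > 0" "s2 > 0" "s1^2 = 1 - p1^2" "s2^2 = 1 - p2^2"
    using pos by (auto simp: s1_def s2_def)
  define X where "X = (\<lambda>z :: real \<times> real. (p1 + s1 * fst z, p2 + (\<theta> - p1 * p2) / s1 * fst z
      + sqrt (1 - p2^2 - (\<theta> - p1 * p2)^2 / (1 - p1^2)) * snd z))"
  have GX: "G = distr (std_gaussian \<Otimes>\<^sub>M std_gaussian) borel X"
    unfolding G_def matching_gaussian_def bivariate_gaussian_def X_def s1_def
    by (simp add: case_prod_beta')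
  have mX: "X \<in> borel_measurable (std_gaussian \<Otimes>\<^sub>M std_gaussian)"
    unfolding X_def using bivariate_gaussian_map_measurable by (simp add: case_prod_beta')
  have c: "(\<theta> - p1 * p2) / s1 = s2 * r"
    using s by (simp add: r_def pair_correlation_def s1_def[symmetric] s2_def[symmetric])
  have "(\<theta> - p1 * p2)^2 / (1 - p1^2) = (s2 * r)^2"
    unfolding c[symmetric] power_divide s(3) ..
  then have "1 - p2^2 - (\<theta> - p1 * p2)^2 / (1 - p1^2) = s2^2 * (1 - r^2)"
    using s(4) by (simp add: power_mult_distrib right_diff_distrib)
  then have d: "sqrt (1 - p2^2 - (\<theta> - p1 * p2)^2 / (1 - p1^2)) = s2 * sqrt (1 - r^2)"
    using s(2) by (simp only: real_sqrt_mult real_sqrt_abs abs_of_pos)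
  have chi1: "chi p1 (fst (X z)) = fst z" for z
    using s by (simp add: X_def chi_def s1_def[symmetric])
  have chi2: "chi p2 (snd (X z)) = r * fst z + sqrt (1 - r^2) * snd z" for z
    unfolding X_def d c using s by (simp add: chi_def s2_def[symmetric] field_simps)
  have P: "prob_space (std_gaussian \<Otimes>\<^sub>M std_gaussian)" by (rule P.prob_space_axioms)
  note F = std_gaussian_pair_fourth
  have L4G: "L4 G g" if "g \<in> borel_measurable borel" "L4 (std_gaussian \<Otimes>\<^sub>M std_gaussian) (\<lambda>z. g (X z))"
    for g :: "real \<times> real \<Rightarrow> real"
    using that mX unfolding L4_def GX by (auto simp: integrable_distr_eq)
  have b12: "fst \<in> borel_measurable (borel :: (real \<times> real) measure)"
    "snd \<in> borel_measurable (borel :: (real \<times> real) measure)"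
    by (simp_all add: borel_prod[symmetric])
  have L41: "L4 G fst"
    by (rule L4G[OF b12(1)]) (simp only: X_def fst_conv snd_conv, intro L4_add L4_const L4_cmult P F)
  have L42: "L4 G snd"
    by (rule L4G[OF b12(2)]) (simp only: X_def fst_conv snd_conv, intro L4_add L4_const L4_cmult P F)
  note m = matching_gaussian_moments[OF p v, folded G_def, THEN has_bochner_integral_integral_eq]
  show "standardized G (\<lambda>z. chi p1 (fst z)) (moment_bound p1)"
  proof (rule standardized_chi[OF G p(1) L41 m(1,3) _ moment_bound_ge_1[OF p(1)]])
    have "integral\<^sup>L G (\<lambda>y. chi p1 (fst y) ^ 4) = 3"
      unfolding GX using mX b12 F chi1 by (subst integral_distr) auto
    then show "integral\<^sup>L G (\<lambda>y. chi p1 (fst y) ^ 4) \<le> moment_bound p1"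
      using pos by (simp add: moment_bound_def)
  qed
  show "standardized G (\<lambda>z. chi p2 (snd z)) (moment_bound p2)"
  proof (rule standardized_chi[OF G p(2) L42 m(2,4) _ moment_bound_ge_1[OF p(2)]])
    let ?a = "\<lambda>z. r * fst z" and ?b = "\<lambda>z. sqrt (1 - r^2) * snd z"
    let ?P = "std_gaussian \<Otimes>\<^sub>M std_gaussian"
    have "integral\<^sup>L G (\<lambda>y. chi p2 (snd y) ^ 4) = (LINT z|?P. (?a z + ?b z) ^ 4)"
      unfolding GX using mX b12 chi2 by (subst integral_distr) auto
    also have "\<dots> \<le> (LINT z|?P. 8 * (?a z ^ 4 + ?b z ^ 4))"
    proof (rule integral_mono)
      have a: "L4 ?P ?a" and b: "L4 ?P ?b" by (rule L4_cmult[OF F(1)], rule L4_cmult[OF F(2)])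
      then show "integrable ?P (\<lambda>z. (?a z + ?b z) ^ 4)" "integrable ?P (\<lambda>z. 8 * (?a z ^ 4 + ?b z ^ 4))"
        using L4_add[OF a b] by (simp_all add: L4_def)
    qed (rule power4_add_le)
    also have "\<dots> = 8 * (r ^ 4 * 3 + sqrt (1 - r^2) ^ 4 * 3)"
      using F by (simp add: power_mult_distrib L4_def)
    also have "\<dots> \<le> 8 * (1 * 3 + 1 * 3)"
    proof -
      have "(r^2)^2 \<le> 1^2" using r by (intro power_mono) auto
      moreover have "((sqrt (1 - r^2))^2)^2 \<le> 1^2" using r by (intro power_mono) auto
      ultimately show ?thesis by simp
    qed
    finally have "integral\<^sup>L G (\<lambda>y. chi p2 (snd y) ^ 4) \<le> 48" by simp
    moreover have "4 / (1 - p2^2) \<ge> 0" using pos by simp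
    ultimately show "integral\<^sup>L G (\<lambda>y. chi p2 (snd y) ^ 4) \<le> moment_bound p2"
      unfolding moment_bound_def by linarith
  qed
  show "integral\<^sup>L G (\<lambda>z. chi p1 (fst z) * chi p2 (snd z)) = pair_correlation p1 p2 \<theta>"
    using integral_chi_chi[OF G p L41 L42 m(1,2,5)] by (simp add: pair_correlation_def)
qed

text \<open>
  With \<open>A, B, C, D\<close> the four masses, the defect of the Cauchy-Schwarz inequality is
  \<open>16 (A B C + A B D + A C D + B C D)\<close>.
\<close>

lemma pair_correlation_bound:
  assumes p: "p1 \<in> {-1<..<1}" "p2 \<in> {-1<..<1}" and \<theta>0: "\<theta>0 \<in> {0..<1}"
  obtains \<rho>0 where "\<rho>0 \<in> {0..<1}"
    and "\<And>\<theta>. \<theta> \<in> {-\<theta>0..\<theta>0} \<Longrightarrow> valid_pair p1 p2 \<theta> \<Longrightarrow> \<bar>pair_correlation p1 p2 \<theta>\<bar> \<le> \<rho>0"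
proof -
  \<comment> \<open>\<open>m\<close> is the least mass of a marginal value, and \<open>c\<close>
    bounds from below the probabilities A + D and B + C of agreement and disagreement.\<close>
  define m where "m = min (min ((1 - p1) / 2) ((1 + p1) / 2)) (min ((1 - p2) / 2) ((1 + p2) / 2))"
  define c where "c = (1 - \<theta>0) / 2"
  have m: "m > 0" and c: "c > 0" using p \<theta>0 by (auto simp: m_def c_def)
  \<comment> \<open>A lower bound for the Cauchy-Schwarz defect: 16 times \<open>c\<close> for the
    sums A + D and B + C, times \<open>c / 2 * m\<close> for A D + B C.\<close>
  define q where "q = 8 * c^2 * m"
  have q: "q > 0" using m c by (simp add: q_def)
  show ?thesis
  proof (rule that[of "sqrt (max 0 (1 - q))"])
    show "sqrt (max 0 (1 - q)) \<in> {0..<1}" using q by auto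
    fix \<theta> assume \<theta>: "\<theta> \<in> {-\<theta>0..\<theta>0}" and valid: "valid_pair p1 p2 \<theta>"
    define A where "A = (1 + \<theta>) / 4 + (p1 + p2) / 4"
    define B where "B = (1 - \<theta>) / 4 + (p1 - p2) / 4"
    define C where "C = (1 - \<theta>) / 4 - (p1 - p2) / 4"
    define D where "D = (1 + \<theta>) / 4 - (p1 + p2) / 4"
    have nn: "A \<ge> 0" "B \<ge> 0" "C \<ge> 0" "D \<ge> 0"
      using valid[unfolded valid_pair_def, rule_format, of "(1, 1)"]
        valid[unfolded valid_pair_def, rule_format, of "(1, -1)"]
        valid[unfolded valid_pair_def, rule_format, of "(-1, 1)"]
        valid[unfolded valid_pair_def, rule_format, of "(-1, -1)"]
      by (simp_all add: pair_mass_def A_def B_def C_def D_def)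
    have AD: "A + D \<ge> c" and BC: "B + C \<ge> c" using \<theta> by (auto simp: A_def B_def C_def D_def c_def field_simps)
    have ms: "A + B \<ge> m" "C + D \<ge> m" "A + C \<ge> m" "B + D \<ge> m"
    proof -
      have "m \<le> (1 - p1) / 2" "m \<le> (1 + p1) / 2" "m \<le> (1 - p2) / 2" "m \<le> (1 + p2) / 2"
        unfolding m_def by (rule min.coboundedI1 min.coboundedI2 order_refl)+
      then show "A + B \<ge> m" "C + D \<ge> m" "A + C \<ge> m" "B + D \<ge> m"
        by (simp_all add: A_def B_def C_def D_def field_simps)
    qed
    have key: "(1 - p1^2) * (1 - p2^2) - (\<theta> - p1 * p2)^2 = 16 * (A * D * (B + C) + B * C * (A + D))"
      unfolding A_def B_def C_def D_def by (simp add: field_simps power2_eq_square)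
    \<comment> \<open>One of A, D and one of B, C is at least c / 2. The remaining two cells always
      form a row or a column, hence carry mass at least \<open>m\<close>, and each is multiplied by
      one of the large ones.\<close>
    have sub: "x * w + y * z \<ge> c / 2 * m" if "x \<ge> c / 2" "y \<ge> c / 2" "z + w \<ge> m" "z \<ge> 0" "w \<ge> 0" for x y z w
    proof -
      have "c / 2 * m \<le> c / 2 * (z + w)" using that c by (intro mult_left_mono) auto
      also have "\<dots> = c / 2 * w + c / 2 * z" by (simp add: algebra_simps)
      also have "\<dots> \<le> x * w + y * z" using that by (intro add_mono mult_right_mono)
      finally show ?thesis .
    qed
    have "A \<ge> c / 2 \<or> D \<ge> c / 2" "B \<ge> c / 2 \<or> C \<ge> c / 2" using AD BC by auto
    then have ADBC: "A * D + B * C \<ge> c / 2 * m"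
      using sub[of A B C D] sub[of A C B D] sub[of D B C A] sub[of D C B A] ms nn
      by (auto simp: mult.commute add.commute)
    have g1: "A * D * (B + C) + B * C * (A + D) \<ge> A * D * c + B * C * c"
      using AD BC nn by (intro add_mono mult_left_mono) auto
    have g2: "A * D * c + B * C * c \<ge> c / 2 * m * c"
      using ADBC c unfolding distrib_right[symmetric] by (intro mult_right_mono) auto
    have g3: "q = 16 * (c / 2 * m * c)" by (simp add: q_def power2_eq_square)
    have gap: "(\<theta> - p1 * p2)^2 \<le> (1 - p1^2) * (1 - p2^2) - q"
    proof -
      have "Y \<le> Z - q" if "u \<le> v" "w \<le> u" "q = 16 * w" "Z - Y = 16 * v" for u v w Y Z :: real
        using that by linarith
      from this[OF g1 g2 g3 key] show ?thesis .
    qed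
    define V where "V = (1 - p1^2) * (1 - p2^2)"
    have pos: "1 - p1^2 > 0" "1 - p2^2 > 0" using p one_minus_square_pos by auto
    have V: "0 < V" "V \<le> 1" using pos by (auto simp: V_def intro!: mult_le_one)
    have "(pair_correlation p1 p2 \<theta>)^2 = (\<theta> - p1 * p2)^2 / V"
      using pos by (simp add: pair_correlation_def V_def power_divide power_mult_distrib)
    also have "\<dots> \<le> (V - q) / V" using gap V by (intro divide_right_mono) (auto simp: V_def)
    also have "\<dots> = 1 - q / V" using V by (simp add: field_simps)
    \<comment> \<open>Both variances are at most 1, so dividing by \<open>V\<close> only widens the
      gap.\<close>
    also have "\<dots> \<le> 1 - q" using V q by (simp add: field_simps mult_le_cancel_left1)
    also have "\<dots> \<le> max 0 (1 - q)" by simp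
    finally show "\<bar>pair_correlation p1 p2 \<theta>\<bar> \<le> sqrt (max 0 (1 - q))"
      using real_sqrt_le_mono by fastforce
  qed
qed

text \<open>The pmf has default value \<open>undefined\<close> outside \<open>I\<close>, which is
  also the extensional convention of product measures; so \<open>restrict\<close> is the identity on
  its support, and comparison on rectangles suffices. This brings the discrete correlation under the
  same product-measure lemmas as the Gaussian one.\<close>

lemma distr_Pi_pmf:
  assumes "finite I"
  shows "Pi\<^sub>M I (\<lambda>i. measure_pmf (p i))
    = distr (measure_pmf (Pi_pmf I undefined p)) (Pi\<^sub>M I (\<lambda>i. measure_pmf (p i))) (\<lambda>z. restrict z I)"
    (is "?P = ?D")
proof -
  interpret product_sigma_finite "\<lambda>i. measure_pmf (p i)"
    by (intro product_sigma_finite.intro prob_space_imp_sigma_finite measure_pmf.prob_space_axioms)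
  have meas: "(\<lambda>z. restrict z I) \<in> measurable (measure_pmf (Pi_pmf I undefined p)) ?P"
    by (simp add: space_PiM PiE_def)
  have "?D = ?P"
  proof (rule PiM_eqI[OF assms])
    fix A :: "'a \<Rightarrow> 'b set"
    have "AE z in measure_pmf (Pi_pmf I undefined p). z \<in> PiE_dflt I undefined (\<lambda>_. UNIV)"
      using set_Pi_pmf_subset[OF assms, of undefined p]
      by (auto simp: AE_measure_pmf_iff PiE_dflt_def subset_iff)
    then have ae: "AE z in measure_pmf (Pi_pmf I undefined p).
        z \<in> (\<lambda>z. restrict z I) -` Pi\<^sub>E I A \<longleftrightarrow> z \<in> PiE_dflt I undefined A"
      by eventually_elim (auto simp: PiE_dflt_def PiE_iff)
    have "emeasure ?D (Pi\<^sub>E I A)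
        = emeasure (measure_pmf (Pi_pmf I undefined p)) ((\<lambda>z. restrict z I) -` Pi\<^sub>E I A)"
      using meas assms by (subst emeasure_distr) (auto intro!: sets_PiM_I_finite)
    also have "\<dots> = emeasure (measure_pmf (Pi_pmf I undefined p)) (PiE_dflt I undefined A)"
      by (intro emeasure_eq_AE ae) auto
    also have "\<dots> = (\<Prod>i\<in>I. emeasure (measure_pmf (p i)) (A i))"
      by (simp add: measure_pmf.emeasure_eq_measure measure_Pi_pmf_PiE_dflt assms prod_ennreal)
    finally show "emeasure ?D (Pi\<^sub>E I A) = (\<Prod>i\<in>I. emeasure (measure_pmf (p i)) (A i))" .
  qed simp
  then show ?thesis by simp
qed

section \<open>Distance of the truncated polynomial to the convex body\<close>

lemma integral_inner_vec_multilinear: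
  fixes a b :: "nat set \<Rightarrow> real ^ 'l"
  assumes 1: "standardized_product M \<xi> K" and 2: "standardized_product M \<zeta> K'"
    and \<rho>: "\<And>i. integral\<^sup>L (M i) (\<lambda>y. \<xi> y * \<zeta> y) = \<rho>" and I: "finite I"
  shows "integral\<^sup>L (Pi\<^sub>M I M) (\<lambda>z. inner (vec_multilinear \<xi> I a z) (vec_multilinear \<zeta> I b z))
      = (\<Sum>S\<in>Pow I. \<rho> ^ card S * inner (a S) (b S))"
    and "integrable (Pi\<^sub>M I M) (\<lambda>z. inner (vec_multilinear \<xi> I a z) (vec_multilinear \<zeta> I b z))"
proof -
  interpret A: standardized_product M \<xi> K by fact
  interpret B: standardized_product M \<zeta> K' by fact
  have eq: "inner (vec_multilinear \<xi> I a z) (vec_multilinear \<zeta> I b z)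
    = (\<Sum>j\<in>UNIV. multilinear \<xi> I (\<lambda>S. a S $ j) z * multilinear \<zeta> I (\<lambda>S. b S $ j) z)" for z
    by (simp add: inner_vec_def vec_multilinear_nth)
  have int: "integrable (Pi\<^sub>M I M)
      (\<lambda>z. multilinear \<xi> I (\<lambda>S. a S $ j) z * multilinear \<zeta> I (\<lambda>S. b S $ j) z)" for j
    using I by (intro L4_integrable_prod A.prob_PiM A.multilinear_L4 B.multilinear_L4)
  show "integrable (Pi\<^sub>M I M) (\<lambda>z. inner (vec_multilinear \<xi> I a z) (vec_multilinear \<zeta> I b z))"
    unfolding eq using int by simp
  have "integral\<^sup>L (Pi\<^sub>M I M) (\<lambda>z. inner (vec_multilinear \<xi> I a z) (vec_multilinear \<zeta> I b z))
    = (\<Sum>j\<in>UNIV. \<Sum>S\<in>Pow I. \<rho> ^ card S * a S $ j * b S $ j)"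
    unfolding eq using int by (simp add: integral_multilinear_multilinear[OF 1 2 \<rho> I])
  also have "\<dots> = (\<Sum>S\<in>Pow I. \<rho> ^ card S * inner (a S) (b S))"
    by (subst sum.swap) (simp add: inner_vec_def sum_distrib_left mult.assoc)
  finally show "integral\<^sup>L (Pi\<^sub>M I M) (\<lambda>z. inner (vec_multilinear \<xi> I a z) (vec_multilinear \<zeta> I b z))
      = (\<Sum>S\<in>Pow I. \<rho> ^ card S * inner (a S) (b S))" .
qed

text \<open>A correlated Plancherel identity. As \<theta> enters only through powers of the
  correlation, uniformity in \<theta> reduces to one bound on
  \<open>pair_correlation\<close>.\<close>

lemma discrete_correlation_fourier:
  fixes f g :: "(nat \<Rightarrow> real) \<Rightarrow> real ^ 'l"
  assumes p: "p1 \<in> {-1<..<1}" "p2 \<in> {-1<..<1}" and v: "valid_pair p1 p2 \<theta>"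
  shows "discrete_correlation n (biased_pair p1 p2 \<theta>) f g
    = (\<Sum>S\<in>Pow {..<n}. pair_correlation p1 p2 \<theta> ^ card S
        * inner (vec_fourier p1 n f S) (vec_fourier p2 n g S))"
proof -
  let ?N = "biased_pair p1 p2 \<theta>"
  let ?Q = "Pi_pmf {..<n} undefined (\<lambda>_. ?N)"
  let ?P = "Pi\<^sub>M {..<n} (\<lambda>_. measure_pmf ?N)"
  define h where "h z = inner (vec_multilinear (\<lambda>y. chi p1 (fst y)) {..<n} (vec_fourier p1 n f) z)
      (vec_multilinear (\<lambda>y. chi p2 (snd y)) {..<n} (vec_fourier p2 n g) z)" for z
  note sb = standardized_biased_pair[OF p v]
  have st: "standardized_product (\<lambda>_::nat. measure_pmf ?N) (\<lambda>y. chi p1 (fst y)) (moment_bound p1)"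
    "standardized_product (\<lambda>_::nat. measure_pmf ?N) (\<lambda>y. chi p2 (snd y)) (moment_bound p2)"
    using sb by (simp_all add: standardized_product_def)
  note I = integral_inner_vec_multilinear[OF st sb(5) finite_lessThan, of n "vec_fourier p1 n f" "vec_fourier p2 n g",
      folded h_def]
  have "discrete_correlation n ?N f g = measure_pmf.expectation ?Q h"
    unfolding discrete_correlation_def
  proof (rule integral_cong_AE)
    show "AE z in ?Q. inner (f (\<lambda>i\<in>{..<n}. fst (z i))) (g (\<lambda>i\<in>{..<n}. snd (z i))) = h z"
      unfolding AE_measure_pmf_iff
    proof
      fix z assume z: "z \<in> set_pmf ?Q"
      have zi: "z i \<in> {-1, 1} \<times> {-1, 1}" if "i < n" for i
        using z that set_biased_pair[OF v] set_Pi_pmf_subset'[of "{..<n}" undefined "\<lambda>_. ?N"]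
        by (fastforce simp: PiE_dflt_def)
      have c1: "(\<lambda>i\<in>{..<n}. fst (z i)) \<in> cube n" and c2: "(\<lambda>i\<in>{..<n}. snd (z i)) \<in> cube n"
        using zi unfolding cube_def by (force simp: mem_Times_iff)+
      show "inner (f (\<lambda>i\<in>{..<n}. fst (z i))) (g (\<lambda>i\<in>{..<n}. snd (z i))) = h z"
        unfolding vec_fourier_expansion[OF p(1) c1, of f] vec_fourier_expansion[OF p(2) c2, of g]
          vec_multilinear_restrict h_def ..
    qed
  qed simp_all
  also have "\<dots> = measure_pmf.expectation ?Q (\<lambda>z. h (restrict z {..<n}))"
  proof -
    have "h (restrict z {..<n}) = h z" for z
      unfolding h_def vec_multilinear_def monomial_def
      by (intro arg_cong2[where f = inner] sum.cong arg_cong2[where f = scaleR] prod.cong refl) auto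
    then show ?thesis by simp
  qed
  also have "\<dots> = integral\<^sup>L (distr (measure_pmf ?Q) ?P (\<lambda>z. restrict z {..<n})) h"
    by (rule integral_distr[symmetric]) (use I(2) in \<open>auto simp: space_PiM PiE_def extensional_def\<close>)
  also have "\<dots> = integral\<^sup>L ?P h"
    by (subst distr_Pi_pmf[symmetric]) auto
  finally show ?thesis unfolding I(1) .
qed

definition truncated_coeffs ::
  "real \<Rightarrow> nat \<Rightarrow> nat \<Rightarrow> nat set \<Rightarrow> real \<Rightarrow> ((nat \<Rightarrow> real) \<Rightarrow> real ^ 'l) \<Rightarrow> nat set \<Rightarrow> real ^ 'l" where
  "truncated_coeffs p n d B \<eta> f S
    = (if card S \<le> d \<and> S \<inter> B = {} then \<eta> ^ card S *\<^sub>R vec_fourier p n f S else 0)"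

text \<open>Collapsing vector coefficients to their norms turns low-degree influence, summed over
  the components, into the plain \<open>influence\<close> of a scalar family of degree at most
  d.\<close>

definition low_norm ::
  "real \<Rightarrow> nat \<Rightarrow> nat \<Rightarrow> ((nat \<Rightarrow> real) \<Rightarrow> real ^ 'l) \<Rightarrow> nat set \<Rightarrow> real" where
  "low_norm p n d f S = (if card S \<le> d then norm (vec_fourier p n f S) else 0)"

lemma influence_low_norm:
  "influence {..<n} (low_norm p n d f) i = (\<Sum>j\<in>UNIV. low_deg_influence p n d i (\<lambda>x. f x $ j))"
proof -
  have "influence {..<n} (low_norm p n d f) i
    = (\<Sum>S | S \<subseteq> {..<n} \<and> i \<in> S \<and> card S \<le> d. (norm (vec_fourier p n f S))^2)"
    unfolding influence_def low_norm_def
    by (rule sum.mono_neutral_cong_right) (auto intro: finite_subset[of _ "Pow {..<n}"])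
  also have "\<dots> = (\<Sum>S | S \<subseteq> {..<n} \<and> i \<in> S \<and> card S \<le> d. \<Sum>j\<in>UNIV. (fourier p n (\<lambda>x. f x $ j) S)^2)"
    unfolding power2_norm_eq_inner inner_vec_def vec_fourier_def
    by (simp add: power2_eq_square)
  also have "\<dots> = (\<Sum>j\<in>UNIV. low_deg_influence p n d i (\<lambda>x. f x $ j))"
    unfolding low_deg_influence_def by (rule sum.swap)
  finally show ?thesis .
qed

text \<open>\<open>s\<close> selects one component of a pair, so that \<open>f\<close> and
  \<open>g\<close> are handled by two instances over one and the same space.\<close>

locale sign_product =
  fixes M :: "nat \<Rightarrow> 'a measure" and p :: real and s :: "'a \<Rightarrow> real" and L :: real
  assumes std_chi: "standardized_product M (\<lambda>y. chi p (s y)) L"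
    and p: "p \<in> {-1<..<1}" and sign: "AE y in M i. s y \<in> {-1, 1}"
begin

sublocale standardized_product M "\<lambda>y. chi p (s y)" L
  by (rule std_chi)

lemma AE_cube: "AE z in Pi\<^sub>M {..<n} M. (\<lambda>i\<in>{..<n}. s (z i)) \<in> cube n"
proof -
  have "AE z in Pi\<^sub>M {..<n} M. \<forall>i\<in>{..<n}. s (z i) \<in> {-1, 1}"
    by (intro eventually_ball_finite finite_lessThan ballI AE_PiM_component prob sign)
  then show ?thesis by eventually_elim (auto simp: cube_def)
qed

lemma parseval_le:
  fixes f :: "(nat \<Rightarrow> real) \<Rightarrow> real ^ 'l"
  assumes f: "\<And>x. x \<in> cube n \<Longrightarrow> norm (f x) \<le> R"
  shows "(\<Sum>S\<in>Pow {..<n}. (norm (vec_fourier p n f S))^2) \<le> R^2"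
proof -
  let ?P = "Pi\<^sub>M {..<n} M" and ?F = "vec_multilinear (\<lambda>y. chi p (s y)) {..<n} (vec_fourier p n f)"
  interpret PM: prob_space ?P by (rule prob_PiM)
  have r: "integral\<^sup>L (M i) (\<lambda>y. chi p (s y) * chi p (s y)) = 1" for i
    using standardized.var_\<xi>[OF std, of i] by (simp add: power2_eq_square)
  note I = integral_inner_vec_multilinear[OF std_chi std_chi r finite_lessThan,
      of n "vec_fourier p n f" "vec_fourier p n f"]
  have "(\<Sum>S\<in>Pow {..<n}. (norm (vec_fourier p n f S))^2) = PM.expectation (\<lambda>z. inner (?F z) (?F z))"
    unfolding I(1) by (simp add: power2_norm_eq_inner)
  also have "\<dots> \<le> PM.expectation (\<lambda>_. R^2)"
  proof (rule integral_mono_AE[OF I(2)])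
    show "AE z in ?P. inner (?F z) (?F z) \<le> R^2"
      using AE_cube
    proof eventually_elim
      case (elim z)
      have "norm (?F z) \<le> R"
        using f[OF elim] unfolding vec_fourier_expansion[OF p elim, of f] vec_multilinear_restrict .
      then show ?case unfolding power2_norm_eq_inner[symmetric] by (intro power_mono) auto
    qed
  qed simp
  finally show ?thesis using PM.prob_space by simp
qed

text \<open>The re-randomised polynomial takes values in \<open>K\<close>, so in direction
  \<open>u\<close> it never exceeds \<open>h\<close>. The truncated one differs from it only above
  degree \<open>d\<close>, where damping leaves at most \<open>\<eta> ^ d\<close> of each
  coefficient. Any excess is thus bounded by the difference, whose second moment is a tail
  sum.\<close>

lemma smooth_ramp_support_excess:
  fixes f :: "(nat \<Rightarrow> real) \<Rightarrow> real ^ 'l"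
  assumes f: "\<And>x. x \<in> cube n \<Longrightarrow> f x \<in> K" and K: "convex K" and R: "\<And>k. k \<in> K \<Longrightarrow> norm k \<le> R"
    and u: "norm u = 1" and h: "\<And>k. k \<in> K \<Longrightarrow> inner u k \<le> h" and \<eta>: "\<eta> \<in> {0..1}"
  shows "(LINT z|Pi\<^sub>M {..<n} M. smooth_ramp
      (inner u (vec_multilinear (\<lambda>y. chi p (s y)) {..<n} (truncated_coeffs p n d B \<eta> f) z) - h))
    \<le> 3 * (\<eta> ^ d)^2 * R^2"
proof -
  let ?P = "Pi\<^sub>M {..<n} M" and ?ml = "vec_multilinear (\<lambda>y. chi p (s y)) {..<n}"
  define a where "a = truncated_coeffs p n d B \<eta> f"
  \<comment> \<open>Rate 0 on \<open>B\<close> averages those coordinates out, which reproduces the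
    deletion of all sets meeting \<open>B\<close>; up to degree \<open>d\<close> the coefficients
    coincide with those of \<open>a\<close>.\<close>
  define b where "b S = (\<Prod>i\<in>S. if i \<in> B then 0 else \<eta>) *\<^sub>R vec_fourier p n f S" for S
  define q where "q S = inner u (a S - b S)" for S
  interpret PM: prob_space ?P by (rule prob_PiM)
  have Q: "L4 ?P (multilinear (\<lambda>y. chi p (s y)) {..<n} q)" by (intro multilinear_L4) auto
  have "(LINT z|?P. smooth_ramp (inner u (?ml a z) - h))
      \<le> (LINT z|?P. 3 * (multilinear (\<lambda>y. chi p (s y)) {..<n} q z)^2)"
  proof (rule integral_mono_AE)
    have "L4 ?P (\<lambda>z. inner u (?ml a z) + (- h))"
      unfolding inner_vec_multilinear by (intro L4_add L4_const prob_PiM multilinear_L4) auto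
    then show "integrable ?P (\<lambda>z. smooth_ramp (inner u (?ml a z) - h))"
      by (simp add: integrable_smooth_ramp prob_PiM)
    show "integrable ?P (\<lambda>z. 3 * (multilinear (\<lambda>y. chi p (s y)) {..<n} q z)^2)"
      using L4_integrable_sq[OF prob_PiM Q] by simp
    show "AE z in ?P. smooth_ramp (inner u (?ml a z) - h)
        \<le> 3 * (multilinear (\<lambda>y. chi p (s y)) {..<n} q z)^2"
      using AE_cube
    proof eventually_elim
      case (elim z)
      have "vec_multilinear (chi p) {..<n} b (\<lambda>i\<in>{..<n}. s (z i)) \<in> K"
        unfolding b_def by (rule rerandomisation_in_convex[OF p f K _ elim]) (use \<eta> in auto)
      then have "inner u (?ml b z) \<le> h" unfolding vec_multilinear_restrict by (rule h)
      moreover have "multilinear (\<lambda>y. chi p (s y)) {..<n} q z = inner u (?ml a z) - inner u (?ml b z)"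
        unfolding inner_vec_multilinear q_def
        by (simp add: multilinear_def inner_diff_right left_diff_distrib sum_subtractf)
      ultimately have le: "inner u (?ml a z) - h \<le> multilinear (\<lambda>y. chi p (s y)) {..<n} q z" by simp
      have "smooth_ramp (inner u (?ml a z) - h) \<le> 3 * (max (inner u (?ml a z) - h) 0)^2"
        by (rule smooth_ramp_bounds)
      also have "(max (inner u (?ml a z) - h) 0)^2 \<le> (multilinear (\<lambda>y. chi p (s y)) {..<n} q z)^2"
        using le by (cases "inner u (?ml a z) - h \<le> 0") (auto simp: max_def intro!: power_mono)
      finally show ?case by simp
    qed
  qed
  also have "\<dots> = 3 * (\<Sum>S\<in>Pow {..<n}. (q S)^2)"
    by (simp add: second_moment_multilinear)
  also have "\<dots> \<le> 3 * (\<Sum>S\<in>Pow {..<n}. (\<eta> ^ d)^2 * (norm (vec_fourier p n f S))^2)"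
  proof (intro mult_left_mono sum_mono)
    fix S assume "S \<in> Pow {..<n}"
    then have S: "finite S" by (auto intro: finite_subset)
    have prod: "(\<Prod>i\<in>S. if i \<in> B then 0 else \<eta>) = (if S \<inter> B = {} then \<eta> ^ card S else 0)"
    proof (cases "S \<inter> B = {}")
      case True
      then have "(\<Prod>i\<in>S. if i \<in> B then 0 else \<eta>) = (\<Prod>i\<in>S. \<eta>)" by (intro prod.cong) auto
      then show ?thesis using True by simp
    next
      case False
      then show ?thesis using S by (auto intro!: prod_zero)
    qed
    show "(q S)^2 \<le> (\<eta> ^ d)^2 * (norm (vec_fourier p n f S))^2"
    proof (cases "card S \<le> d")
      case True
      then have "q S = 0" by (simp add: q_def a_def b_def truncated_coeffs_def prod)
      then show ?thesis by simp
    next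
      case False
      have "\<bar>q S\<bar> \<le> norm (a S - b S)" using Cauchy_Schwarz_ineq2[of u "a S - b S"] u by (simp add: q_def)
      also have "\<dots> \<le> \<eta> ^ card S * norm (vec_fourier p n f S)"
        using False \<eta> by (simp add: a_def b_def truncated_coeffs_def prod)
      also have "\<dots> \<le> \<eta> ^ d * norm (vec_fourier p n f S)"
        using False \<eta> by (intro mult_right_mono power_decreasing) auto
      finally have "\<bar>q S\<bar>^2 \<le> (\<eta> ^ d * norm (vec_fourier p n f S))^2" by (intro power_mono) auto
      then show ?thesis by (simp add: power_mult_distrib)
    qed
  qed simp
  also have "\<dots> \<le> 3 * ((\<eta> ^ d)^2 * R^2)"
    unfolding sum_distrib_left[symmetric] using f R by (intro mult_left_mono parseval_le) auto
  finally show ?thesis by (simp add: a_def)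
qed

text \<open>On the cube the excess in each net direction is controlled by damping; replacement
  carries this over to \<open>G\<close> at the cost 16 L t d R^2; the threshold
  \<open>\<kappa>\<close> then converts ramps back into the squared distance. Coordinates in
  \<open>B\<close> cannot hurt the replacement, because the truncated polynomial does not involve
  them.\<close>

lemma projection_error:
  fixes f :: "(nat \<Rightarrow> real) \<Rightarrow> real ^ 'l" and K U :: "(real ^ 'l) set"
  assumes G: "standardized_product G (\<lambda>y. chi p (s y)) L"
    and f: "\<And>x. x \<in> cube n \<Longrightarrow> f x \<in> K" and K: "closed K" "convex K"
    and R: "\<And>k. k \<in> K \<Longrightarrow> norm k \<le> R" and \<eta>: "\<eta> \<in> {0..1}"
    and U: "finite U" "\<And>u. u \<in> U \<Longrightarrow> norm u = 1" "\<And>e. norm e = 1 \<Longrightarrow> \<exists>u\<in>U. dist e u \<le> \<delta>"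
    and \<delta>: "\<delta> \<le> 1/2" and \<kappa>: "0 < \<kappa>" "\<kappa> \<le> 1" and t: "t > 0"
    and B: "\<And>i. i < n \<Longrightarrow> i \<notin> B \<Longrightarrow> influence {..<n} (low_norm p n d f) i \<le> (t / (4 * L) ^ d)^2"
  defines "V \<equiv> vec_multilinear (\<lambda>y. chi p (s y)) {..<n} (truncated_coeffs p n d B \<eta> f)"
  shows "(LINT z|Pi\<^sub>M {..<n} G. (dist (V z) (closest_point K (V z)))^2)
      \<le> 32 * (\<delta> * R)^2 + 8 * card U * (\<kappa>^2 + (3 * (\<eta> ^ d)^2 * R^2 + 16 * L * t * d * R^2) / \<kappa>)" (is ?bound)
    and "integrable (Pi\<^sub>M {..<n} G) (\<lambda>z. (dist (V z) (closest_point K (V z)))^2)" (is ?int)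
proof -
  let ?\<xi> = "\<lambda>y. chi p (s y)" and ?P = "Pi\<^sub>M {..<n} G"
  define a where "a = truncated_coeffs p n d B \<eta> f"
  interpret G: standardized_product G ?\<xi> L by fact
  interpret GP: prob_space ?P by (rule G.prob_PiM)
  have L: "L \<ge> 1" using std[of 0] by (auto simp: standardized_def standardized_axioms_def)
  have "(\<lambda>i\<in>{..<n}. 1) \<in> cube n" by (auto simp: cube_def)
  then have K_ne: "K \<noteq> {}" using f by blast
  define h where "h u = (SUP k\<in>K. inner u k)" for u
  have bdd: "bdd_above ((\<lambda>k. inner u k) ` K)" for u
  proof (rule bdd_aboveI2)
    fix k assume "k \<in> K"
    have "inner u k \<le> norm u * norm k" by (rule norm_cauchy_schwarz)
    also have "\<dots> \<le> norm u * R" using R[OF \<open>k \<in> K\<close>] by (intro mult_left_mono) auto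
    finally show "inner u k \<le> norm u * R" .
  qed
  have h: "inner u k \<le> h u" if "k \<in> K" for u k
    unfolding h_def by (rule cSUP_upper[OF that bdd])
  have W: "(\<Sum>S\<in>Pow {..<n}. (norm (vec_fourier p n f S))^2) \<le> R^2"
    using f R by (intro parseval_le) auto
  have a_norm: "norm (a S) \<le> norm (vec_fourier p n f S)" for S
  proof -
    have "\<eta> ^ card S * norm (vec_fourier p n f S) \<le> 1 * norm (vec_fourier p n f S)"
      using \<eta> by (intro mult_right_mono power_le_one) auto
    then show ?thesis using \<eta> by (simp add: a_def truncated_coeffs_def)
  qed
  have one: "(LINT z|?P. smooth_ramp (inner u (V z) - h u)) \<le> 3 * (\<eta> ^ d)^2 * R^2 + 16 * L * t * d * R^2"
    if u: "u \<in> U" for u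
  proof -
    \<comment> \<open>Moving the offset \<open>h u\<close> into the constant coefficient makes the
      excess itself a multilinear polynomial, and influences ignore the empty set.\<close>
    define c where "c S = inner u (a S) - (if S = {} then h u else 0)" for S
    have c: "multilinear \<xi> {..<n} c z = inner u (vec_multilinear \<xi> {..<n} a z) - h u" for \<xi> :: "'a \<Rightarrow> real" and z
    proof -
      have "(\<Sum>S\<in>Pow {..<n}. (if S = {} then h u else 0) * monomial \<xi> S z) = h u"
        by (simp add: if_distrib[of "\<lambda>x. x * _"] monomial_def cong: if_cong)
      then show ?thesis
        unfolding inner_vec_multilinear by (simp add: multilinear_def c_def left_diff_distrib sum_subtractf)
    qed
    have c_le: "\<bar>inner u (a S)\<bar> \<le> norm (vec_fourier p n f S)" for S
      using Cauchy_Schwarz_ineq2[of u "a S"] U(2)[OF u] a_norm[of S] by simp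
    have deg: "c S = 0" if "card S > d" for S
      using that by (auto simp: c_def a_def truncated_coeffs_def)
    have infl: "influence {..<n} c i \<le> (t / (4 * L) ^ d)^2" if i: "i < n" for i
    proof (cases "i \<in> B")
      case True
      then have "influence {..<n} c i = 0"
        unfolding influence_def by (intro sum.neutral) (auto simp: c_def a_def truncated_coeffs_def)
      then show ?thesis by simp
    next
      case False
      have "influence {..<n} c i \<le> influence {..<n} (low_norm p n d f) i"
        unfolding influence_def
      proof (rule sum_mono)
        fix S assume S: "S \<in> {S. S \<subseteq> {..<n} \<and> i \<in> S}"
        then have "S \<noteq> {}" by auto
        then have "\<bar>c S\<bar> \<le> low_norm p n d f S"
          using c_le[of S] by (auto simp: c_def low_norm_def a_def truncated_coeffs_def)
        then have "\<bar>c S\<bar>^2 \<le> (low_norm p n d f S)^2" by (intro power_mono) auto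
        then show "(c S)^2 \<le> (low_norm p n d f S)^2" by simp
      qed
      then show ?thesis using B[OF i False] by linarith
    qed
    have h_le: "(h u)^2 \<le> R^2"
    proof -
      obtain k where k: "k \<in> K" using K_ne by blast
      have ik: "\<bar>inner u k\<bar> \<le> R" if "k \<in> K" for k
        using Cauchy_Schwarz_ineq2[of u k] U(2)[OF u] R[OF that] by simp
      have "h u \<le> R" unfolding h_def
      proof (rule cSUP_least[OF K_ne])
        show "inner u k \<le> R" if "k \<in> K" for k using ik[OF that] by simp
      qed
      moreover have "- R \<le> h u" using ik[OF k] h[OF k, of u] by linarith
      ultimately have "\<bar>h u\<bar>^2 \<le> R^2" by (intro power_mono) auto
      then show ?thesis by simp
    qed
    have "(\<Sum>S\<in>Pow {..<n}. (c S)^2)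
      \<le> (\<Sum>S\<in>Pow {..<n}. 2 * (norm (vec_fourier p n f S))^2 + (if S = {} then 2 * (h u)^2 else 0))"
    proof (rule sum_mono)
      fix S assume "S \<in> Pow {..<n}"
      have 1: "(x - y)^2 \<le> 2 * x^2 + 2 * y^2" for x y :: real
        using zero_le_power2[of "x + y"] by (simp add: power2_eq_square algebra_simps)
      have "\<bar>inner u (a S)\<bar>^2 \<le> (norm (vec_fourier p n f S))^2" using c_le by (intro power_mono) auto
      then have 2: "(inner u (a S))^2 \<le> (norm (vec_fourier p n f S))^2" by simp
      show "(c S)^2 \<le> 2 * (norm (vec_fourier p n f S))^2 + (if S = {} then 2 * (h u)^2 else 0)"
        using 1[of "inner u (a S)" "if S = {} then h u else 0"] 2 order_trans[OF 2, of "2 * (norm (vec_fourier p n f S))^2"]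
        unfolding c_def by (cases "S = {}") auto
    qed
    also have "\<dots> = 2 * (\<Sum>S\<in>Pow {..<n}. (norm (vec_fourier p n f S))^2) + 2 * (h u)^2"
      by (simp add: sum.distrib sum_distrib_left)
    also have "\<dots> \<le> 4 * R^2" using W h_le by simp
    finally have cW: "(\<Sum>S\<in>Pow {..<n}. (c S)^2) \<le> 4 * R^2" .
    have "\<bar>(LINT z|Pi\<^sub>M {..<n} M. smooth_ramp (multilinear ?\<xi> {..<n} c z))
      - (LINT z|?P. smooth_ramp (multilinear ?\<xi> {..<n} c z))\<bar>
      \<le> 4 * L * t * d * (\<Sum>S\<in>Pow {..<n}. (c S)^2)"
      by (rule lindeberg_replacement[OF std_chi G deg t infl])
    also have "\<dots> \<le> 4 * L * t * d * (4 * R^2)" using cW L t by (intro mult_left_mono) auto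
    finally have "(LINT z|?P. smooth_ramp (multilinear ?\<xi> {..<n} c z))
      \<le> (LINT z|Pi\<^sub>M {..<n} M. smooth_ramp (multilinear ?\<xi> {..<n} c z)) + 16 * L * t * d * R^2"
      by (simp add: abs_le_iff)
    moreover have "(LINT z|Pi\<^sub>M {..<n} M. smooth_ramp (multilinear ?\<xi> {..<n} c z)) \<le> 3 * (\<eta> ^ d)^2 * R^2"
      unfolding c unfolding a_def
      by (rule smooth_ramp_support_excess[OF f K(2) R U(2)[OF u] h \<eta>])
    ultimately show ?thesis unfolding c V_def a_def by linarith
  qed
  define S where "S u z = inner u (V z) - h u" for u z
  have S_L4: "L4 ?P (S u)" for u
  proof -
    have "L4 ?P (\<lambda>z. inner u (V z) + - h u)"
      unfolding V_def inner_vec_multilinear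
      by (intro L4_add L4_const G.prob_PiM G.multilinear_L4) auto
    then show ?thesis by (simp add: S_def[abs_def])
  qed
  have int1: "integrable ?P (\<lambda>z. smooth_ramp (S u z))" for u
    by (rule integrable_smooth_ramp[OF G.prob_PiM S_L4])
  have le1: "(dist (V z) (closest_point K (V z)))^2
      \<le> 32 * (\<delta> * R)^2 + 8 * (\<Sum>u\<in>U. \<kappa>^2 + smooth_ramp (S u z) / \<kappa>)" for z
  proof -
    have "(dist (V z) (closest_point K (V z)))^2
      \<le> 32 * (\<delta> * R)^2 + 8 * (\<Sum>u\<in>U. (max (S u z) 0)^2)"
      unfolding S_def h_def by (rule closest_point_dist_sq_le_net[OF K K_ne R U(1,3) \<delta>])
    also have "\<dots> \<le> 32 * (\<delta> * R)^2 + 8 * (\<Sum>u\<in>U. \<kappa>^2 + smooth_ramp (S u z) / \<kappa>)"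
      by (intro add_left_mono mult_left_mono sum_mono smooth_ramp_bounds(3) \<kappa>) auto
    finally show ?thesis .
  qed
  have int2: "integrable ?P (\<lambda>z. 32 * (\<delta> * R)^2 + 8 * (\<Sum>u\<in>U. \<kappa>^2 + smooth_ramp (S u z) / \<kappa>))"
    using int1 by simp
  have V_meas: "V \<in> borel_measurable ?P"
    unfolding V_def vec_multilinear_def
    by (intro borel_measurable_sum borel_measurable_scaleR G.monomial_measurable borel_measurable_const) auto
  have cp: "closest_point K \<in> borel_measurable borel"
    using continuous_on_closest_point[OF K(2,1) K_ne] by (rule borel_measurable_continuous_onI)
  show ?int
  proof (rule Bochner_Integration.integrable_bound[OF int2])
    show "(\<lambda>z. (dist (V z) (closest_point K (V z)))^2) \<in> borel_measurable ?P"
      using V_meas measurable_compose[OF V_meas cp] by measurable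
    show "AE z in ?P. norm ((dist (V z) (closest_point K (V z)))^2)
      \<le> norm (32 * (\<delta> * R)^2 + 8 * (\<Sum>u\<in>U. \<kappa>^2 + smooth_ramp (S u z) / \<kappa>))"
      using le1 by (intro AE_I2) (simp add: order_trans[OF _ abs_ge_self])
  qed
  then have "(LINT z|?P. (dist (V z) (closest_point K (V z)))^2)
    \<le> (LINT z|?P. 32 * (\<delta> * R)^2 + 8 * (\<Sum>u\<in>U. \<kappa>^2 + smooth_ramp (S u z) / \<kappa>))"
    by (intro integral_mono int2 le1)
  also have "\<dots> = 32 * (\<delta> * R)^2 + 8 * (\<Sum>u\<in>U. \<kappa>^2 + (LINT z|?P. smooth_ramp (S u z)) / \<kappa>)"
    using int1 GP.prob_space by simp
  also have "\<dots> \<le> 32 * (\<delta> * R)^2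
      + 8 * (\<Sum>u\<in>U. \<kappa>^2 + (3 * (\<eta> ^ d)^2 * R^2 + 16 * L * t * d * R^2) / \<kappa>)"
    using one \<kappa> unfolding S_def
    by (intro add_left_mono mult_left_mono sum_mono divide_right_mono) auto
  finally show ?bound by simp
qed

end

section \<open>Comparison of the correlations\<close>

text \<open>1 - r^k is 1 - r times the sum of the k powers r^0, ..., r^(k-1), each of which is at
  least r^k.\<close>

lemma mult_power_gap_le:
  fixes r :: real assumes "r \<in> {0..<1}"
  shows "k * r ^ k * (1 - r) \<le> 1 - r ^ k"
proof (induction k)
  case (Suc k)
  have "Suc k * r ^ Suc k * (1 - r) = r * (k * r ^ k * (1 - r)) + r ^ Suc k * (1 - r)"
    by (simp add: algebra_simps)
  also have "\<dots> \<le> r * (1 - r ^ k) + r ^ Suc k * (1 - r)"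
    using Suc assms by (intro add_right_mono mult_left_mono) auto
  also have "\<dots> = r * (1 - r ^ Suc k)" by (simp add: algebra_simps)
  also have "\<dots> \<le> 1 * (1 - r ^ Suc k)"
    using assms power_le_one[of r "Suc k"] by (intro mult_right_mono) auto
  finally show ?case by simp
qed simp

text \<open>Bernoulli bounds the loss by k (1 - \<eta>^2), and the decay of r^k absorbs the factor
  k. The right-hand side does not depend on \<open>k\<close>, which allows \<eta> to be chosen
  before the degree.\<close>

lemma noise_gap_le:
  fixes r \<eta> :: real assumes r: "r \<in> {0..<1}" and \<eta>: "\<eta> \<in> {0..1}"
  shows "r ^ k * (1 - (\<eta>^2) ^ k) \<le> (1 - \<eta>^2) / (1 - r)"
proof -
  have \<eta>2: "0 \<le> \<eta>^2" "\<eta>^2 \<le> 1" using \<eta> by (auto simp: abs_square_le_1)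
  have "1 + k * (\<eta>^2 - 1) \<le> (1 + (\<eta>^2 - 1)) ^ k"
    by (rule Bernoulli_inequality) (use \<eta>2 in auto)
  then have "1 - (\<eta>^2) ^ k \<le> k * (1 - \<eta>^2)" by (simp add: algebra_simps)
  then have "r ^ k * (1 - (\<eta>^2) ^ k) \<le> r ^ k * (k * (1 - \<eta>^2))"
    using r by (intro mult_left_mono) auto
  also have "\<dots> = (k * r ^ k * (1 - r)) * (1 - \<eta>^2) / (1 - r)" using r by (simp add: field_simps)
  also have "\<dots> \<le> 1 * (1 - \<eta>^2) / (1 - r)"
  proof -
    have "k * r ^ k * (1 - r) \<le> 1"
    proof -
      have "r ^ k \<ge> 0" using r by auto
      then show ?thesis using mult_power_gap_le[OF r, of k] by linarith
    qed
    then show ?thesis using r \<eta>2 by (intro divide_right_mono mult_right_mono) auto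
  qed
  finally show ?thesis by simp
qed

text \<open>Total influence at most d W bounds the size of \<open>B\<close> by d W / \<tau>'. In the
  weighted AM-GM the influences of \<open>c\<close>, whose sum is bounded, get the weight \<sigma>;
  those of \<open>e\<close> get 1 / \<sigma> but are at most \<tau> each. Counting \<open>S\<close>
  once per element of \<open>B\<close> in it is harmless for an upper bound.\<close>

lemma influential_coordinates_mass:
  fixes c e :: "nat set \<Rightarrow> real"
  assumes I: "finite I" and B: "B \<subseteq> I"
    and deg: "\<And>S. S \<subseteq> I \<Longrightarrow> card S > d \<Longrightarrow> c S = 0" and W: "(\<Sum>S\<in>Pow I. (c S)^2) \<le> W"
    and big: "\<And>i. i \<in> B \<Longrightarrow> influence I c i \<ge> \<tau>'" and small: "\<And>i. i \<in> B \<Longrightarrow> influence I e i \<le> \<tau>"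
    and pos: "\<sigma> > 0" "\<tau>' > 0" "\<tau> \<ge> 0"
  shows "(\<Sum>S\<in>Pow I. \<Sum>i\<in>B. if i \<in> S then \<bar>c S * e S\<bar> else 0)
    \<le> (\<sigma> * d * W + d * W / \<tau>' * \<tau> / \<sigma>) / 2"
proof -
  have fB: "finite B" using I B finite_subset by blast
  have tot: "(\<Sum>i\<in>B. influence I c i) \<le> d * W"
  proof -
    have "(\<Sum>i\<in>B. influence I c i) \<le> (\<Sum>i\<in>I. influence I c i)"
      using I B by (intro sum_mono2) (auto intro: influence_nonneg)
    also have "\<dots> \<le> d * (\<Sum>S\<in>Pow I. (c S)^2)" by (intro sum_influence_le I deg)
    also have "\<dots> \<le> d * W" using W by (intro mult_left_mono) auto
    finally show ?thesis .
  qed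
  have "card B * \<tau>' = (\<Sum>i\<in>B. \<tau>')" by simp
  also have "\<dots> \<le> (\<Sum>i\<in>B. influence I c i)" using big by (rule sum_mono)
  also have "\<dots> \<le> d * W" by (rule tot)
  finally have cardB: "card B \<le> d * W / \<tau>'" using pos by (simp add: field_simps)
  have "(\<Sum>S\<in>Pow I. \<Sum>i\<in>B. if i \<in> S then \<bar>c S * e S\<bar> else 0)
    = (\<Sum>i\<in>B. \<Sum>S\<in>Pow I. if i \<in> S then \<bar>c S * e S\<bar> else 0)" by (rule sum.swap)
  also have "\<dots> = (\<Sum>i\<in>B. \<Sum>S | S \<subseteq> I \<and> i \<in> S. \<bar>c S * e S\<bar>)"
    using I by (intro sum.cong[OF refl]) (simp add: sum.If_cases Int_def)
  also have "\<dots> \<le> (\<Sum>i\<in>B. (\<sigma> * influence I c i + influence I e i / \<sigma>) / 2)"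
  proof (rule sum_mono)
    fix i
    have "\<bar>x * y\<bar> \<le> (\<sigma> * x^2 + y^2 / \<sigma>) / 2" for x y :: real
    proof -
      have "0 \<le> (\<sigma> * \<bar>x\<bar> - \<bar>y\<bar>)^2" by simp
      also have "\<dots> = \<sigma>^2 * x^2 + y^2 - 2 * \<sigma> * \<bar>x * y\<bar>"
        by (simp add: power2_diff power_mult_distrib abs_mult)
      finally show ?thesis using pos by (simp add: field_simps power2_eq_square)
    qed
    then have "(\<Sum>S | S \<subseteq> I \<and> i \<in> S. \<bar>c S * e S\<bar>)
      \<le> (\<Sum>S | S \<subseteq> I \<and> i \<in> S. (\<sigma> * (c S)^2 + (e S)^2 / \<sigma>) / 2)" by (rule sum_mono)
    also have "\<dots> = (\<sigma> * influence I c i + influence I e i / \<sigma>) / 2"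
      unfolding influence_def
      by (simp add: sum.distrib sum_distrib_left flip: sum_divide_distrib)
    finally show "(\<Sum>S | S \<subseteq> I \<and> i \<in> S. \<bar>c S * e S\<bar>)
      \<le> (\<sigma> * influence I c i + influence I e i / \<sigma>) / 2" .
  qed
  also have "\<dots> = (\<sigma> * (\<Sum>i\<in>B. influence I c i) + (\<Sum>i\<in>B. influence I e i) / \<sigma>) / 2"
    by (simp add: sum.distrib sum_distrib_left flip: sum_divide_distrib)
  also have "\<dots> \<le> (\<sigma> * (d * W) + card B * \<tau> / \<sigma>) / 2"
  proof -
    have "(\<Sum>i\<in>B. influence I e i) \<le> card B * \<tau>"
      using sum_mono[of B "influence I e" "\<lambda>_. \<tau>"] small by simp
    then show ?thesis using tot pos by (intro divide_right_mono add_mono mult_left_mono) auto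
  qed
  also have "\<dots> \<le> (\<sigma> * (d * W) + d * W / \<tau>' * \<tau> / \<sigma>) / 2"
    using cardB pos by (intro divide_right_mono add_left_mono mult_right_mono) auto
  finally show ?thesis by (simp add: mult.assoc)
qed

lemma truncation_error:
  fixes f g :: "(nat \<Rightarrow> real) \<Rightarrow> real ^ 'l"
  assumes W1: "(\<Sum>S\<in>Pow {..<n}. (norm (vec_fourier p1 n f S))^2) \<le> W"
    and W2: "(\<Sum>S\<in>Pow {..<n}. (norm (vec_fourier p2 n g S))^2) \<le> W"
    and r: "\<bar>r\<bar> \<le> \<rho>0" and \<rho>0: "\<rho>0 \<in> {0..<1}" and \<eta>: "\<eta> \<in> {0..1}"
    and pos: "\<sigma> > 0" "\<tau>' > 0" "\<tau> \<ge> 0"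
    and B1: "\<And>i. i < n \<Longrightarrow> i \<in> B1 \<Longrightarrow>
      influence {..<n} (low_norm p1 n d f) i \<ge> \<tau>' \<and> influence {..<n} (low_norm p2 n d g) i \<le> \<tau>"
    and B2: "\<And>i. i < n \<Longrightarrow> i \<in> B2 \<Longrightarrow>
      influence {..<n} (low_norm p2 n d g) i \<ge> \<tau>' \<and> influence {..<n} (low_norm p1 n d f) i \<le> \<tau>"
  shows "\<bar>(\<Sum>S\<in>Pow {..<n}. r ^ card S * inner (vec_fourier p1 n f S) (vec_fourier p2 n g S))
     - (\<Sum>S\<in>Pow {..<n}. r ^ card S *
          inner (truncated_coeffs p1 n d B1 \<eta> f S) (truncated_coeffs p2 n d B2 \<eta> g S))\<bar>
    \<le> (\<rho>0 ^ d + (1 - \<eta>^2) / (1 - \<rho>0)) * W + (\<sigma> * d * W + d * W / \<tau>' * \<tau> / \<sigma>)"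
proof -
  define F where "F = vec_fourier p1 n f"
  define G where "G = vec_fourier p2 n g"
  define a where "a = truncated_coeffs p1 n d B1 \<eta> f"
  define b where "b = truncated_coeffs p2 n d B2 \<eta> g"
  define c where "c = low_norm p1 n d f"
  define e where "e = low_norm p2 n d g"
  define B1' where "B1' = B1 \<inter> {..<n}"
  define B2' where "B2' = B2 \<inter> {..<n}"
  define m where "m = \<rho>0 ^ d + (1 - \<eta>^2) / (1 - \<rho>0)"
  have \<eta>2: "\<eta>^2 \<le> 1" using \<eta> by (auto simp: abs_square_le_1)
  have m1: "\<rho>0 ^ d \<le> m" and m2: "(1 - \<eta>^2) / (1 - \<rho>0) \<le> m" and m0: "m \<ge> 0"
    using \<rho>0 \<eta>2 by (auto simp: m_def)
  have pt: "\<bar>r ^ card S * inner (F S) (G S) - r ^ card S * inner (a S) (b S)\<bar>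
    \<le> m * (((norm (F S))^2 + (norm (G S))^2) / 2)
      + ((\<Sum>i\<in>B1'. if i \<in> S then \<bar>c S * e S\<bar> else 0) + (\<Sum>i\<in>B2'. if i \<in> S then \<bar>e S * c S\<bar> else 0))"
    if S: "S \<in> Pow {..<n}" for S
  proof -
    define w where "w = ((norm (F S))^2 + (norm (G S))^2) / 2"
    define y1 where "y1 = (\<Sum>i\<in>B1'. if i \<in> S then \<bar>c S * e S\<bar> else 0)"
    define y2 where "y2 = (\<Sum>i\<in>B2'. if i \<in> S then \<bar>e S * c S\<bar> else 0)"
    have y: "y1 \<ge> 0" "y2 \<ge> 0" unfolding y1_def y2_def by (auto intro!: sum_nonneg)
    have ip: "\<bar>inner (F S) (G S)\<bar> \<le> norm (F S) * norm (G S)" by (rule Cauchy_Schwarz_ineq2)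
    also have nw: "\<dots> \<le> w"
      using zero_le_power2[of "norm (F S) - norm (G S)"] by (simp add: w_def power2_diff)
    finally have iw: "\<bar>inner (F S) (G S)\<bar> \<le> w" .
    have w0: "w \<ge> 0" by (simp add: w_def)
    have rk: "\<bar>r ^ k\<bar> \<le> \<rho>0 ^ k" for k unfolding power_abs using r by (intro power_mono) auto
    have rk1: "\<bar>r ^ k\<bar> \<le> 1" for k using rk[of k] power_le_one[of \<rho>0 k] \<rho>0 by auto
    have mw: "m * w \<ge> 0" using m0 w0 by simp
    \<comment> \<open>A set is lost to the degree cut, lost because it meets an influential
      coordinate, or kept but damped once by each factor. The costs are \<open>\<rho>0 ^ d\<close>,
      the mass over influential coordinates, and the noise gap.\<close>
    consider (high) "card S > d" | (meet) "card S \<le> d" "S \<inter> (B1 \<union> B2) \<noteq> {}"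
      | (low) "card S \<le> d" "S \<inter> B1 = {}" "S \<inter> B2 = {}" by fastforce
    then have "\<bar>r ^ card S * inner (F S) (G S) - r ^ card S * inner (a S) (b S)\<bar> \<le> m * w + (y1 + y2)"
    proof cases
      case high
      then have "a S = 0" by (simp add: a_def truncated_coeffs_def)
      moreover have "\<bar>r ^ card S\<bar> \<le> m"
        using rk[of "card S"] m1 power_decreasing[of d "card S" \<rho>0] high \<rho>0 by auto
      then have "\<bar>r ^ card S * inner (F S) (G S)\<bar> \<le> m * w"
        unfolding abs_mult using iw m0 by (intro mult_mono) auto
      ultimately show ?thesis using y by simp
    next
      case meet
      then have "a S = 0 \<or> b S = 0" by (auto simp: a_def b_def truncated_coeffs_def)
      then have ab: "inner (a S) (b S) = 0" by auto
      obtain i where i: "i \<in> S" "i \<in> B1 \<union> B2" using meet by auto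
      have "\<bar>c S * e S\<bar> \<le> y1 + y2"
      proof (cases "i \<in> B1")
        case True
        then have "i \<in> B1'" using i S by (auto simp: B1'_def)
        then have "(if i \<in> S then \<bar>c S * e S\<bar> else 0) \<le> y1"
          unfolding y1_def by (intro member_le_sum[of i]) (auto simp: B1'_def)
        then show ?thesis using y i by simp
      next
        case False
        then have "i \<in> B2'" using i S by (auto simp: B2'_def)
        then have "(if i \<in> S then \<bar>e S * c S\<bar> else 0) \<le> y2"
          unfolding y2_def by (intro member_le_sum[of i]) (auto simp: B2'_def)
        then show ?thesis using y i by (simp add: mult.commute)
      qed
      moreover have "\<bar>r ^ card S * inner (F S) (G S)\<bar> \<le> 1 * \<bar>c S * e S\<bar>"
        unfolding abs_mult[of "r ^ card S"] using ip meet rk1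
        by (intro mult_mono) (auto simp: c_def e_def low_norm_def F_def G_def)
      ultimately show ?thesis using mw ab by simp
    next
      case low
      have "inner (a S) (b S) = (\<eta>^2) ^ card S * inner (F S) (G S)"
        using low by (simp add: a_def b_def truncated_coeffs_def F_def G_def power2_eq_square power_mult_distrib)
      then have "\<bar>r ^ card S * inner (F S) (G S) - r ^ card S * inner (a S) (b S)\<bar>
          = \<bar>r ^ card S * (1 - (\<eta>^2) ^ card S)\<bar> * \<bar>inner (F S) (G S)\<bar>"
        by (simp add: abs_mult[symmetric] algebra_simps)
      also have "\<dots> \<le> m * w"
      proof (intro mult_mono iw)
        have k0: "0 \<le> 1 - (\<eta>^2) ^ card S" using \<eta>2 power_le_one[of "\<eta>^2" "card S"] by simp
        then have "\<bar>r ^ card S * (1 - (\<eta>^2) ^ card S)\<bar> \<le> \<rho>0 ^ card S * (1 - (\<eta>^2) ^ card S)"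
          unfolding abs_mult using rk \<rho>0 by (intro mult_mono) auto
        also have "\<dots> \<le> m" using noise_gap_le[OF \<rho>0 \<eta>, of "card S"] m2 by linarith
        finally show "\<bar>r ^ card S * (1 - (\<eta>^2) ^ card S)\<bar> \<le> m" .
      qed (use m0 in auto)
      finally show ?thesis using y by simp
    qed
    then show ?thesis unfolding w_def y1_def y2_def .
  qed
  have deg: "c S = 0" "e S = 0" if "card S > d" for S
    using that by (auto simp: c_def e_def low_norm_def)
  have cW: "(\<Sum>S\<in>Pow {..<n}. (c S)^2) \<le> W"
    by (rule order_trans[OF sum_mono W1]) (auto simp: c_def low_norm_def)
  have eW: "(\<Sum>S\<in>Pow {..<n}. (e S)^2) \<le> W"
    by (rule order_trans[OF sum_mono W2]) (auto simp: e_def low_norm_def)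
  have Y1: "(\<Sum>S\<in>Pow {..<n}. \<Sum>i\<in>B1'. if i \<in> S then \<bar>c S * e S\<bar> else 0)
      \<le> (\<sigma> * d * W + d * W / \<tau>' * \<tau> / \<sigma>) / 2"
    by (rule influential_coordinates_mass[OF _ _ deg(1) cW _ _ pos])
       (use B1 in \<open>auto simp: B1'_def c_def e_def\<close>)
  have Y2: "(\<Sum>S\<in>Pow {..<n}. \<Sum>i\<in>B2'. if i \<in> S then \<bar>e S * c S\<bar> else 0)
      \<le> (\<sigma> * d * W + d * W / \<tau>' * \<tau> / \<sigma>) / 2"
    by (rule influential_coordinates_mass[OF _ _ deg(2) eW _ _ pos])
       (use B2 in \<open>auto simp: B2'_def c_def e_def\<close>)
  have "\<bar>(\<Sum>S\<in>Pow {..<n}. r ^ card S * inner (F S) (G S)) - (\<Sum>S\<in>Pow {..<n}. r ^ card S * inner (a S) (b S))\<bar>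
    \<le> (\<Sum>S\<in>Pow {..<n}. m * (((norm (F S))^2 + (norm (G S))^2) / 2)
      + ((\<Sum>i\<in>B1'. if i \<in> S then \<bar>c S * e S\<bar> else 0) + (\<Sum>i\<in>B2'. if i \<in> S then \<bar>e S * c S\<bar> else 0)))"
    unfolding sum_subtractf[symmetric] by (rule order_trans[OF sum_abs sum_mono[OF pt]])
  also have "\<dots> = m * (((\<Sum>S\<in>Pow {..<n}. (norm (F S))^2) + (\<Sum>S\<in>Pow {..<n}. (norm (G S))^2)) / 2)
      + ((\<Sum>S\<in>Pow {..<n}. \<Sum>i\<in>B1'. if i \<in> S then \<bar>c S * e S\<bar> else 0)
        + (\<Sum>S\<in>Pow {..<n}. \<Sum>i\<in>B2'. if i \<in> S then \<bar>e S * c S\<bar> else 0))"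
    by (simp only: sum.distrib add_divide_distrib distrib_left sum_distrib_left sum_divide_distrib)
  also have "\<dots> \<le> m * ((W + W) / 2) + ((\<sigma> * d * W + d * W / \<tau>' * \<tau> / \<sigma>) / 2
      + (\<sigma> * d * W + d * W / \<tau>' * \<tau> / \<sigma>) / 2)"
    using W1 W2 Y1 Y2 m0
    by (intro add_mono mult_left_mono divide_right_mono) (auto simp: F_def G_def)
  finally show ?thesis by (simp add: m_def F_def G_def a_def b_def)
qed

text \<open>The product is expanded around the bounded functions \<open>F\<close> and
  \<open>H\<close>, so that \<open>P\<close> and \<open>Q\<close> enter the error only through their
  L2 distances. The weight \<open>t\<close> splits the terms linear in a distance; choosing it
  before \<open>e\<close> makes all three errors small.\<close>

lemma inner_projection_error:
  fixes P Q F H :: "'a \<Rightarrow> 'b::euclidean_space"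
  assumes "prob_space M" and PQ: "integrable M (\<lambda>z. inner (P z) (Q z))"
    and FH: "integrable M (\<lambda>z. inner (F z) (H z))"
    and x: "integrable M (\<lambda>z. (dist (P z) (F z))^2)" "integral\<^sup>L M (\<lambda>z. (dist (P z) (F z))^2) \<le> e"
    and y: "integrable M (\<lambda>z. (dist (Q z) (H z))^2)" "integral\<^sup>L M (\<lambda>z. (dist (Q z) (H z))^2) \<le> e"
    and R: "\<And>z. norm (F z) \<le> R" "\<And>z. norm (H z) \<le> R" and t: "t > 0"
  shows "\<bar>integral\<^sup>L M (\<lambda>z. inner (P z) (Q z)) - integral\<^sup>L M (\<lambda>z. inner (F z) (H z))\<bar> \<le> e + t * R^2 + e / t"
proof -
  interpret prob_space M by fact
  let ?X = "\<lambda>z. (dist (P z) (F z))^2" and ?Y = "\<lambda>z. (dist (Q z) (H z))^2"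
  have pt: "\<bar>inner (P z) (Q z) - inner (F z) (H z)\<bar>
    \<le> (?X z + ?Y z) / 2 + t * R^2 + (?X z + ?Y z) / (2 * t)" for z
  proof -
    define a where "a = dist (P z) (F z)"
    define b where "b = dist (Q z) (H z)"
    have ab: "a \<ge> 0" "b \<ge> 0" by (auto simp: a_def b_def)
    have "R \<ge> 0" using R(1)[of z] norm_ge_zero order_trans by blast
    have "inner (P z) (Q z) - inner (F z) (H z)
      = inner (P z - F z) (Q z - H z) + inner (P z - F z) (H z) + inner (F z) (Q z - H z)"
      by (simp add: inner_diff_left inner_diff_right)
    moreover have "\<bar>inner (P z - F z) (Q z - H z)\<bar> \<le> a * b"
      unfolding a_def b_def dist_norm by (rule Cauchy_Schwarz_ineq2)
    moreover have "\<bar>inner (P z - F z) (H z)\<bar> \<le> a * R"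
      using Cauchy_Schwarz_ineq2[of "P z - F z" "H z"] mult_left_mono[OF R(2)[of z] ab(1)]
      by (simp add: a_def dist_norm)
    moreover have "\<bar>inner (F z) (Q z - H z)\<bar> \<le> b * R"
      using Cauchy_Schwarz_ineq2[of "F z" "Q z - H z"] mult_left_mono[OF R(1)[of z] ab(2)]
      by (simp add: b_def dist_norm mult.commute)
    moreover have "a * b \<le> (a^2 + b^2) / 2"
      using zero_le_power2[of "a - b"] by (simp add: power2_diff)
    moreover have "c * R \<le> t * R^2 / 2 + c^2 / (2 * t)" for c :: real
    proof -
      have "0 \<le> (c - t * R)^2" by simp
      also have "\<dots> = c^2 + t^2 * R^2 - 2 * t * (c * R)" by (simp add: power2_diff power_mult_distrib)
      finally show ?thesis using t by (simp add: field_simps power2_eq_square)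
    qed
    note this[of a] this[of b]
    ultimately show ?thesis unfolding a_def[symmetric] b_def[symmetric] add_divide_distrib by linarith
  qed
  have "\<bar>integral\<^sup>L M (\<lambda>z. inner (P z) (Q z)) - integral\<^sup>L M (\<lambda>z. inner (F z) (H z))\<bar>
    = \<bar>integral\<^sup>L M (\<lambda>z. inner (P z) (Q z) - inner (F z) (H z))\<bar>" using PQ FH by simp
  also have "\<dots> \<le> integral\<^sup>L M (\<lambda>z. (?X z + ?Y z) / 2 + t * R^2 + (?X z + ?Y z) / (2 * t))"
    by (rule order_trans[OF integral_abs_bound], rule integral_mono)
       (use PQ FH x y pt in auto)
  also have "\<dots> = (integral\<^sup>L M ?X + integral\<^sup>L M ?Y) / 2 + t * R^2 + (integral\<^sup>L M ?X + integral\<^sup>L M ?Y) / (2 * t)"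
    using x(1) y(1) prob_space by simp
  also have "\<dots> \<le> (e + e) / 2 + t * R^2 + (e + e) / (2 * t)"
    using x(2) y(2) t by (intro add_mono divide_right_mono) auto
  finally show ?thesis by simp
qed

text \<open>Neither \<theta> nor the law of pairs appears beyond the marginal mean \<open>p\<close>,
  so one map serves every \<theta>. The threshold is \<tau>' rather than the \<tau> of the
  hypothesis: it has to make replacement work on the remaining coordinates. Under the Gaussian
  marginal, \<open>chi p\<close> of a coordinate is standard normal.\<close>

definition gaussian_extension ::
  "(real ^ 'l) set \<Rightarrow> real \<Rightarrow> nat \<Rightarrow> nat \<Rightarrow> real \<Rightarrow> real \<Rightarrow> ((nat \<Rightarrow> real) \<Rightarrow> real ^ 'l)
    \<Rightarrow> (nat \<Rightarrow> real) \<Rightarrow> real ^ 'l" where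
  "gaussian_extension K p n d \<tau>' \<eta> f x = closest_point K (vec_multilinear (chi p) {..<n}
     (truncated_coeffs p n d {i. \<tau>' < (MAX j. low_deg_influence p n d i (\<lambda>x. f x $ j))} \<eta> f) x)"

lemma gaussian_extension_measurable:
  assumes K: "closed K" "convex K" "K \<noteq> {}"
  shows "gaussian_extension K p n d \<tau>' \<eta> f \<in> gaussian_functions n K"
  unfolding gaussian_functions_def
proof (rule measurable_restrict_space2)
  show "gaussian_extension K p n d \<tau>' \<eta> f \<in> space (Pi\<^sub>M {..<n} (\<lambda>_. borel)) \<rightarrow> K"
    using K by (auto simp: gaussian_extension_def closest_point_in_set)
  have cp: "closest_point K \<in> borel_measurable borel"
    using continuous_on_closest_point[OF K(2,1,3)] by (rule borel_measurable_continuous_onI)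
  have "monomial (chi p) S \<in> borel_measurable (Pi\<^sub>M {..<n} (\<lambda>_. borel))" if "S \<in> Pow {..<n}" for S
    unfolding monomial_def using that
    by (intro borel_measurable_prod measurable_compose[OF _ chi_measurable] measurable_component_singleton) auto
  then show "gaussian_extension K p n d \<tau>' \<eta> f \<in> borel_measurable (Pi\<^sub>M {..<n} (\<lambda>_. borel))"
    unfolding gaussian_extension_def vec_multilinear_def
    by (intro measurable_compose[OF _ cp] borel_measurable_sum borel_measurable_scaleR
        borel_measurable_const)
qed

lemma low_deg_influence_nonneg: "low_deg_influence p n d i h \<ge> 0"
  unfolding low_deg_influence_def by (rule sum_nonneg) auto

text \<open>The theorem speaks of the maximum over components, the estimates of the sum;
  \<open>CARD('l)\<close> passes between them and is the \<open>R\<close> that accompanies \<tau>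
  and \<tau>' below.\<close>

lemma influence_low_norm_bounds:
  fixes f :: "(nat \<Rightarrow> real) \<Rightarrow> real ^ 'l" and p :: real and n d :: nat and m :: "nat \<Rightarrow> real"
  defines "m \<equiv> \<lambda>i. MAX j. low_deg_influence p n d i (\<lambda>x. f x $ j)"
  shows "m i \<le> influence {..<n} (low_norm p n d f) i"
    and "influence {..<n} (low_norm p n d f) i \<le> CARD('l) * m i"
proof -
  let ?g = "\<lambda>j. low_deg_influence p n d i (\<lambda>x. f x $ j)"
  have "m i \<in> range ?g" unfolding m_def by (rule Max_in) auto
  then obtain j where j: "m i = ?g j" by blast
  show "m i \<le> influence {..<n} (low_norm p n d f) i"
    unfolding influence_low_norm j by (rule member_le_sum) (auto intro: low_deg_influence_nonneg)
  have "?g j \<le> m i" for j unfolding m_def by (rule Max_ge) auto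
  then show "influence {..<n} (low_norm p n d f) i \<le> CARD('l) * m i"
    unfolding influence_low_norm using sum_mono[of UNIV ?g "\<lambda>_. m i"] by simp
qed

text \<open>All parameters are still free here, which separates the analytic estimate from their
  choice. \<open>L\<close> exceeds the moment bounds of both marginals, so a single \<tau>' and a
  single error \<open>e\<close> serve f and g.\<close>

lemma correlation_difference:
  fixes K1 K2 U :: "(real ^ 'l) set" and f g :: "(nat \<Rightarrow> real) \<Rightarrow> real ^ 'l" and p1 p2 R L :: real
  defines "R \<equiv> real CARD('l)" and "L \<equiv> moment_bound p1 + moment_bound p2"
  assumes p: "p1 \<in> {-1<..<1}" "p2 \<in> {-1<..<1}" and v: "valid_pair p1 p2 \<theta>"
    and K1: "closed K1" "convex K1" "K1 \<subseteq> {x. \<forall>j. x $ j \<in> {0..1}}"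
    and K2: "closed K2" "convex K2" "K2 \<subseteq> {x. \<forall>j. x $ j \<in> {0..1}}"
    and f: "f \<in> cube n \<rightarrow>\<^sub>E K1" and g: "g \<in> cube n \<rightarrow>\<^sub>E K2"
    and r: "\<bar>pair_correlation p1 p2 \<theta>\<bar> \<le> \<rho>0" and \<rho>0: "\<rho>0 \<in> {0..<1}" and \<eta>: "\<eta> \<in> {0..1}"
    and U: "finite U" "\<And>u. u \<in> U \<Longrightarrow> norm u = 1" "\<And>e. norm e = 1 \<Longrightarrow> \<exists>u\<in>U. dist e u \<le> \<delta>"
    and \<delta>: "\<delta> \<le> 1/2" and \<kappa>: "0 < \<kappa>" "\<kappa> \<le> 1" and t: "t > 0" and t0: "t0 > 0"
    and \<sigma>: "\<sigma> > 0" and \<tau>: "0 < \<tau>" "\<tau> \<le> \<tau>'" and \<tau>': "R * \<tau>' \<le> (t / (4 * L) ^ d)^2"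
    and min: "\<And>i. i < n \<Longrightarrow> min (MAX j. low_deg_influence p1 n d i (\<lambda>x. f x $ j))
                   (MAX j. low_deg_influence p2 n d i (\<lambda>y. g y $ j)) \<le> \<tau>"
    and e: "32 * (\<delta> * R)^2 + 8 * card U * (\<kappa>^2 + (3 * (\<eta> ^ d)^2 * R^2 + 16 * L * t * d * R^2) / \<kappa>) \<le> e"
  shows "\<bar>discrete_correlation n (biased_pair p1 p2 \<theta>) f g
      - gaussian_correlation n (matching_gaussian p1 p2 \<theta>)
          (gaussian_extension K1 p1 n d \<tau>' \<eta> f) (gaussian_extension K2 p2 n d \<tau>' \<eta> g)\<bar>
    \<le> ((\<rho>0 ^ d + (1 - \<eta>^2) / (1 - \<rho>0)) * R^2 + (\<sigma> * d * R^2 + d * R^2 / \<tau>' * (R * \<tau>) / \<sigma>))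
      + (e + t0 * R^2 + e / t0)"
proof -
  let ?N = "biased_pair p1 p2 \<theta>" and ?G = "matching_gaussian p1 p2 \<theta>"
  let ?P = "Pi\<^sub>M {..<n} (\<lambda>_. ?G)"
  define r where "r = pair_correlation p1 p2 \<theta>"
  define m1 where "m1 i = (MAX j. low_deg_influence p1 n d i (\<lambda>x. f x $ j))" for i
  define m2 where "m2 i = (MAX j. low_deg_influence p2 n d i (\<lambda>x. g x $ j))" for i
  define B1 where "B1 = {i. \<tau>' < m1 i}"
  define B2 where "B2 = {i. \<tau>' < m2 i}"
  define a where "a = truncated_coeffs p1 n d B1 \<eta> f"
  define b where "b = truncated_coeffs p2 n d B2 \<eta> g"
  define P where "P = vec_multilinear (\<lambda>y :: real \<times> real. chi p1 (fst y)) {..<n} a"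
  define Q where "Q = vec_multilinear (\<lambda>y :: real \<times> real. chi p2 (snd y)) {..<n} b"
  have R: "R \<ge> 1" "R > 0" by (simp_all add: R_def)
  have L1: "moment_bound p1 \<ge> 1" and L2: "moment_bound p2 \<ge> 1"
    using p by (simp_all add: moment_bound_ge_1)
  have \<tau>'0: "\<tau>' > 0" using \<tau> by linarith
  have r1: "\<bar>pair_correlation p1 p2 \<theta>\<bar> \<le> 1" using r \<rho>0 by auto
  note N = standardized_biased_pair[OF p v] and G = standardized_matching_gaussian[OF p v r1]
  have f': "f x \<in> K1" and g': "g x \<in> K2" if "x \<in> cube n" for x using f g that by auto
  have n1: "norm k \<le> R" if "k \<in> K1" for k
    using K1(3) that unfolding R_def by (intro norm_le_card_unit_box) blast
  have n2: "norm k \<le> R" if "k \<in> K2" for k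
    using K2(3) that unfolding R_def by (intro norm_le_card_unit_box) blast
  interpret S1: sign_product "\<lambda>_. measure_pmf ?N" p1 fst "moment_bound p1"
    using N p by (simp add: sign_product_def standardized_product_def)
  interpret S2: sign_product "\<lambda>_. measure_pmf ?N" p2 snd "moment_bound p2"
    using N p by (simp add: sign_product_def standardized_product_def)
  have G1: "standardized_product (\<lambda>_::nat. ?G) (\<lambda>y. chi p1 (fst y)) (moment_bound p1)"
    and G2: "standardized_product (\<lambda>_::nat. ?G) (\<lambda>y. chi p2 (snd y)) (moment_bound p2)"
    using G by (simp_all add: standardized_product_def)
  interpret G1: standardized_product "\<lambda>_. ?G" "\<lambda>y. chi p1 (fst y)" "moment_bound p1" by (rule G1)
  have W1: "(\<Sum>S\<in>Pow {..<n}. (norm (vec_fourier p1 n f S))^2) \<le> R^2"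
    using f' n1 by (intro S1.parseval_le) auto
  have W2: "(\<Sum>S\<in>Pow {..<n}. (norm (vec_fourier p2 n g S))^2) \<le> R^2"
    using g' n2 by (intro S2.parseval_le) auto
  have b1: "m1 i \<le> influence {..<n} (low_norm p1 n d f) i" "influence {..<n} (low_norm p1 n d f) i \<le> R * m1 i"
    and b2: "m2 i \<le> influence {..<n} (low_norm p2 n d g) i" "influence {..<n} (low_norm p2 n d g) i \<le> R * m2 i"
    for i
    unfolding m1_def m2_def R_def by (rule influence_low_norm_bounds)+
  have min': "m1 i \<le> \<tau> \<or> m2 i \<le> \<tau>" if "i < n" for i
    using min[OF that] by (simp add: m1_def m2_def min_le_iff_disj)
  \<comment> \<open>Here the minimum in the hypothesis takes effect: \<open>f\<close> exceeds
    \<tau>' >= \<tau> at \<open>i\<close>, so it must be \<open>g\<close> that stays below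
    \<tau>.\<close>
  have i1: "influence {..<n} (low_norm p1 n d f) i \<ge> \<tau>' \<and> influence {..<n} (low_norm p2 n d g) i \<le> R * \<tau>"
    if i: "i < n" "i \<in> B1" for i
  proof -
    have "m2 i \<le> \<tau>" "m1 i > \<tau>'" using min'[OF i(1)] i \<tau> by (auto simp: B1_def)
    moreover from this have "R * m2 i \<le> R * \<tau>" using R by (intro mult_left_mono) auto
    ultimately show ?thesis using b1(1)[of i] b2(2)[of i] by linarith
  qed
  have i2: "influence {..<n} (low_norm p2 n d g) i \<ge> \<tau>' \<and> influence {..<n} (low_norm p1 n d f) i \<le> R * \<tau>"
    if i: "i < n" "i \<in> B2" for i
  proof -
    have "m1 i \<le> \<tau>" "m2 i > \<tau>'" using min'[OF i(1)] i \<tau> by (auto simp: B2_def)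
    moreover from this have "R * m1 i \<le> R * \<tau>" using R by (intro mult_left_mono) auto
    ultimately show ?thesis using b2(1)[of i] b1(2)[of i] by linarith
  qed
  have thr: "R * \<tau>' \<le> (t / (4 * M) ^ d)^2" if "M \<ge> 1" "M \<le> L" for M
  proof -
    have "(4 * M) ^ d \<le> (4 * L) ^ d" using that by (intro power_mono) auto
    then have "t / (4 * L) ^ d \<le> t / (4 * M) ^ d" using that t by (intro divide_left_mono) auto
    then have "(t / (4 * L) ^ d)^2 \<le> (t / (4 * M) ^ d)^2" using that t by (intro power_mono) auto
    then show ?thesis using \<tau>' by linarith
  qed
  have o1: "influence {..<n} (low_norm p1 n d f) i \<le> (t / (4 * moment_bound p1) ^ d)^2" if "i < n" "i \<notin> B1" for i
  proof -
    have "R * m1 i \<le> R * \<tau>'" using that R by (intro mult_left_mono) (auto simp: B1_def)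
    then show ?thesis using b1(2)[of i] thr[OF L1] L2 by (simp add: L_def)
  qed
  have o2: "influence {..<n} (low_norm p2 n d g) i \<le> (t / (4 * moment_bound p2) ^ d)^2" if "i < n" "i \<notin> B2" for i
  proof -
    have "R * m2 i \<le> R * \<tau>'" using that R by (intro mult_left_mono) (auto simp: B2_def)
    then show ?thesis using b2(2)[of i] thr[OF L2] L1 by (simp add: L_def)
  qed
  have e_mono: "32 * (\<delta> * R)^2 + 8 * card U * (\<kappa>^2 + (3 * (\<eta> ^ d)^2 * R^2 + 16 * M * t * d * R^2) / \<kappa>) \<le> e"
    if "M \<le> L" for M
  proof -
    have "16 * M * t * d * R^2 \<le> 16 * L * t * d * R^2" using that t by (intro mult_right_mono) auto
    then have "8 * card U * (\<kappa>^2 + (3 * (\<eta> ^ d)^2 * R^2 + 16 * M * t * d * R^2) / \<kappa>)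
      \<le> 8 * card U * (\<kappa>^2 + (3 * (\<eta> ^ d)^2 * R^2 + 16 * L * t * d * R^2) / \<kappa>)"
      using \<kappa> by (intro mult_left_mono add_left_mono divide_right_mono) auto
    then show ?thesis using e by linarith
  qed
  have E1: "(LINT z|?P. (dist (P z) (closest_point K1 (P z)))^2) \<le> e"
  proof (rule order_trans)
    show "(LINT z|?P. (dist (P z) (closest_point K1 (P z)))^2)
      \<le> 32 * (\<delta> * R)^2
        + 8 * card U * (\<kappa>^2 + (3 * (\<eta> ^ d)^2 * R^2 + 16 * moment_bound p1 * t * d * R^2) / \<kappa>)"
      unfolding P_def a_def
      by (rule S1.projection_error(1)[OF G1 f' K1(1,2) n1 \<eta> U \<delta> \<kappa> t o1])
  qed (rule e_mono, use L2 in \<open>simp add: L_def\<close>)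
  have D1: "integrable ?P (\<lambda>z. (dist (P z) (closest_point K1 (P z)))^2)"
    unfolding P_def a_def
    by (rule S1.projection_error(2)[OF G1 f' K1(1,2) n1 \<eta> U \<delta> \<kappa> t o1])
  have E2: "(LINT z|?P. (dist (Q z) (closest_point K2 (Q z)))^2) \<le> e"
  proof (rule order_trans)
    show "(LINT z|?P. (dist (Q z) (closest_point K2 (Q z)))^2)
      \<le> 32 * (\<delta> * R)^2
        + 8 * card U * (\<kappa>^2 + (3 * (\<eta> ^ d)^2 * R^2 + 16 * moment_bound p2 * t * d * R^2) / \<kappa>)"
      unfolding Q_def b_def
      by (rule S2.projection_error(1)[OF G2 g' K2(1,2) n2 \<eta> U \<delta> \<kappa> t o2])
  qed (rule e_mono, use L1 in \<open>simp add: L_def\<close>)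
  have D2: "integrable ?P (\<lambda>z. (dist (Q z) (closest_point K2 (Q z)))^2)"
    unfolding Q_def b_def
    by (rule S2.projection_error(2)[OF G2 g' K2(1,2) n2 \<eta> U \<delta> \<kappa> t o2])
  have one: "(\<lambda>i\<in>{..<n}. 1) \<in> cube n" by (auto simp: cube_def)
  have ne: "K1 \<noteq> {}" "K2 \<noteq> {}" using f'[OF one] g'[OF one] by auto
  have R1: "norm (closest_point K1 z) \<le> R" and R2: "norm (closest_point K2 z) \<le> R" for z
    using n1 n2 closest_point_in_set K1(1) K2(1) ne by blast+
  note PQ = integral_inner_vec_multilinear[OF G1 G2 G(3) finite_lessThan, of n a b, folded P_def Q_def r_def]
  have meas: "(\<lambda>z. closest_point K1 (P z)) \<in> borel_measurable ?P"
    "(\<lambda>z. closest_point K2 (Q z)) \<in> borel_measurable ?P"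
  proof -
    interpret G2: standardized_product "\<lambda>_. ?G" "\<lambda>y. chi p2 (snd y)" "moment_bound p2" by (rule G2)
    have "P \<in> borel_measurable ?P" "Q \<in> borel_measurable ?P"
      unfolding P_def Q_def vec_multilinear_def
      by (intro borel_measurable_sum borel_measurable_scaleR G1.monomial_measurable
          G2.monomial_measurable borel_measurable_const; auto)+
    moreover have "closest_point K1 \<in> borel_measurable borel" "closest_point K2 \<in> borel_measurable borel"
      using continuous_on_closest_point[OF K1(2,1) ne(1)] continuous_on_closest_point[OF K2(2,1) ne(2)]
      by (auto intro: borel_measurable_continuous_onI)
    ultimately show "(\<lambda>z. closest_point K1 (P z)) \<in> borel_measurable ?P"
      "(\<lambda>z. closest_point K2 (Q z)) \<in> borel_measurable ?P"
      by (auto intro: measurable_compose)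
  qed
  interpret PP: prob_space ?P by (rule G1.prob_PiM)
  have FH: "integrable ?P (\<lambda>z. inner (closest_point K1 (P z)) (closest_point K2 (Q z)))"
  proof (rule PP.integrable_const_bound[of _ "R * R"])
    have "\<bar>inner (closest_point K1 (P z)) (closest_point K2 (Q z))\<bar> \<le> R * R" for z
      using R R1 R2 by (intro order_trans[OF Cauchy_Schwarz_ineq2] mult_mono) auto
    then show "AE z in ?P. norm (inner (closest_point K1 (P z)) (closest_point K2 (Q z))) \<le> R * R" by simp
  qed (use meas in measurable)
  have "gaussian_correlation n ?G (gaussian_extension K1 p1 n d \<tau>' \<eta> f) (gaussian_extension K2 p2 n d \<tau>' \<eta> g)
    = (LINT z|?P. inner (closest_point K1 (P z)) (closest_point K2 (Q z)))"
    unfolding gaussian_correlation_def gaussian_extension_def vec_multilinear_restrict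
      m1_def[symmetric] m2_def[symmetric] B1_def[symmetric] B2_def[symmetric]
      a_def[symmetric] b_def[symmetric] P_def[symmetric] Q_def[symmetric] ..
  moreover have "\<bar>(LINT z|?P. inner (P z) (Q z))
      - (LINT z|?P. inner (closest_point K1 (P z)) (closest_point K2 (Q z)))\<bar> \<le> e + t0 * R^2 + e / t0"
    by (rule inner_projection_error[OF PP.prob_space_axioms PQ(2) FH D1 E1 D2 E2 R1 R2 t0])
  moreover have "\<bar>discrete_correlation n ?N f g - (LINT z|?P. inner (P z) (Q z))\<bar>
    \<le> (\<rho>0 ^ d + (1 - \<eta>^2) / (1 - \<rho>0)) * R^2 + (\<sigma> * d * R^2 + d * R^2 / \<tau>' * (R * \<tau>) / \<sigma>)"
    unfolding PQ(1) discrete_correlation_fourier[OF p v] r_def[symmetric] a_def b_def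
    using r R \<tau> by (intro truncation_error[OF W1 W2 _ \<rho>0 \<eta> \<sigma> \<tau>'0 _ i1 i2]) (auto simp: r_def)
  ultimately show ?thesis by linarith
qed

section \<open>Choice of the parameters\<close>

lemma small_power_exists:
  fixes x y \<epsilon> :: real assumes "x \<in> {0..<1}" "y \<in> {0..<1}" "\<epsilon> > 0"
  obtains d :: nat where "d > 0" "x ^ d \<le> \<epsilon>" "y ^ d \<le> \<epsilon>"
proof -
  obtain k where k: "max x y ^ k < \<epsilon>" using real_arch_pow_inv[of \<epsilon> "max x y"] assms by auto
  have "z ^ Suc k \<le> \<epsilon>" if "0 \<le> z" "z \<le> max x y" for z
  proof -
    have "z ^ Suc k \<le> max x y ^ Suc k" using that by (intro power_mono) auto
    also have "\<dots> \<le> max x y ^ k" using assms by (intro power_decreasing) auto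
    finally show ?thesis using k by linarith
  qed
  from this[of x] this[of y] show ?thesis using assms by (intro that[of "Suc k"]) auto
qed

theorem theorem7p1:
  fixes p1 p2 \<epsilon> \<theta>0 :: real and K1 K2 :: "(real ^ 'l) set"
  assumes "p1 \<in> {-1<..<1}" and "p2 \<in> {-1<..<1}"
    and "\<epsilon> \<in> {0<..1}" and "\<theta>0 \<in> {0..<1}"
    and "closed K1" and "convex K1" and "K1 \<subseteq> {x. \<forall>j. x $ j \<in> {0..1}}"
    and "closed K2" and "convex K2" and "K2 \<subseteq> {x. \<forall>j. x $ j \<in> {0..1}}"
  shows "\<exists>n0 d :: nat. \<exists>\<tau> :: real. n0 > 0 \<and> d > 0 \<and> \<tau> \<in> {0<..<1} \<and>
    (\<forall>n\<ge>n0.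
      \<exists>T1 \<in> (cube n \<rightarrow>\<^sub>E K1) \<rightarrow> gaussian_functions n K1.
      \<exists>T2 \<in> (cube n \<rightarrow>\<^sub>E K2) \<rightarrow> gaussian_functions n K2.
        \<forall>\<theta> \<in> {-\<theta>0..\<theta>0}. valid_pair p1 p2 \<theta> \<longrightarrow>
          (\<forall>f \<in> cube n \<rightarrow>\<^sub>E K1. \<forall>g \<in> cube n \<rightarrow>\<^sub>E K2.
            (MAX i\<in>{..<n}.
               min (MAX j. low_deg_influence p1 n d i (\<lambda>x. f x $ j))
                   (MAX j. low_deg_influence p2 n d i (\<lambda>y. g y $ j))) \<le> \<tau> \<longrightarrow>
            \<bar>discrete_correlation n (biased_pair p1 p2 \<theta>) f g
              - gaussian_correlation n (matching_gaussian p1 p2 \<theta>) (T1 f) (T2 g)\<bar> \<le> \<epsilon>))"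
proof -
  define R where "R = real CARD('l)"
  define L where "L = moment_bound p1 + moment_bound p2"
  have R: "R \<ge> 1" "R > 0" by (simp_all add: R_def)
  have R2: "R^2 \<ge> 1" "R^2 > 0" using R by simp_all
  have L: "L \<ge> 1" "L > 0"
    using moment_bound_ge_1[OF assms(1)] moment_bound_ge_1[OF assms(2)] by (auto simp: L_def)
  have \<epsilon>: "\<epsilon> > 0" "\<epsilon> \<le> 1" using assms by auto
  obtain \<rho>0 where \<rho>0: "\<rho>0 \<in> {0..<1}"
    and \<rho>: "\<And>\<theta>. \<theta> \<in> {-\<theta>0..\<theta>0} \<Longrightarrow> valid_pair p1 p2 \<theta> \<Longrightarrow> \<bar>pair_correlation p1 p2 \<theta>\<bar> \<le> \<rho>0"
    using pair_correlation_bound[OF assms(1,2,4)] by metis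
  \<comment> \<open>Since 1 - \<eta>^2 <= x, this caps the cost of damping at \<epsilon> / 8. The
    other budgets are \<epsilon> / 8 for the degree cut, \<epsilon> / 16 twice for the influential
    coordinates, and \<epsilon> / 4 for the projection; the sum stays below \<epsilon>.\<close>
  define x where "x = \<epsilon> * (1 - \<rho>0) / (8 * R^2)"
  define \<eta> where "\<eta> = 1 - x / 2"
  have x: "x > 0" using \<epsilon> \<rho>0 R by (simp add: x_def)
  have "\<epsilon> * (1 - \<rho>0) \<le> 1 * 1" using \<epsilon> \<rho>0 by (intro mult_mono) auto
  then have x1: "x \<le> 1" using R2 by (simp add: x_def divide_le_eq)
  have \<eta>: "\<eta> \<in> {0..1}" "\<eta> \<in> {0..<1}" using x x1 by (auto simp: \<eta>_def)
  have noise: "(1 - \<eta>^2) / (1 - \<rho>0) * R^2 \<le> \<epsilon> / 8"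
  proof -
    have "1 - \<eta>^2 = x - x^2 / 4" by (simp add: \<eta>_def power2_eq_square algebra_simps)
    then have "1 - \<eta>^2 \<le> x" by simp
    then have "(1 - \<eta>^2) / (1 - \<rho>0) * R^2 \<le> x / (1 - \<rho>0) * R^2"
      using \<rho>0 by (intro mult_right_mono divide_right_mono) auto
    also have "\<dots> = \<epsilon> / 8" using \<rho>0 R by (simp add: x_def)
    finally show ?thesis .
  qed
  \<comment> \<open>\<open>t0\<close> is fixed by the term t0 R^2; only then is \<open>e\<close>,
    the allowed mean squared distance to the body, made small against it.\<close>
  define t0 where "t0 = \<epsilon> / (16 * R^2)"
  define e where "e = min (\<epsilon> / 16) (\<epsilon> * t0 / 16)"
  have t0: "t0 > 0" using \<epsilon> R by (simp add: t0_def)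
  have e: "e > 0" using \<epsilon> t0 by (simp add: e_def)
  have eb: "e + t0 * R^2 + e / t0 \<le> \<epsilon> / 4"
  proof -
    have "e \<le> \<epsilon> / 16" by (simp add: e_def)
    moreover have "t0 * R^2 = \<epsilon> / 16" using R by (simp add: t0_def)
    moreover have "e / t0 \<le> \<epsilon> / 16"
    proof -
      have "e \<le> \<epsilon> * t0 / 16" by (simp add: e_def)
      then show ?thesis using t0 by (simp add: field_simps)
    qed
    ultimately show ?thesis using \<epsilon> by linarith
  qed
  \<comment> \<open>The net gets a quarter of \<open>e\<close>: since \<delta> <= 1 its square is at
    most \<delta>, which makes a linear choice sufficient.\<close>
  define \<delta> where "\<delta> = min (1/2) (e / (128 * R^2))"
  have \<delta>: "0 < \<delta>" "\<delta> \<le> 1/2" "\<delta> \<le> e / (128 * R^2)" using e R by (auto simp: \<delta>_def)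
  have \<delta>e: "32 * (\<delta> * R)^2 \<le> e / 4"
  proof -
    have "\<delta>^2 \<le> \<delta> * 1" unfolding power2_eq_square using \<delta> by (intro mult_left_mono) auto
    then have "32 * (\<delta> * R)^2 \<le> 32 * (\<delta> * R^2)"
      unfolding power_mult_distrib by (intro mult_left_mono mult_right_mono) auto
    also have "\<dots> \<le> 32 * (e / (128 * R^2) * R^2)" using \<delta> by (intro mult_left_mono mult_right_mono) auto
    finally show ?thesis using R by simp
  qed
  obtain U :: "(real ^ 'l) set" where U: "finite U" "\<And>u. u \<in> U \<Longrightarrow> norm u = 1"
    "\<And>e. norm e = 1 \<Longrightarrow> \<exists>u\<in>U. dist e u \<le> \<delta>" using sphere_net[OF \<delta>(1)] by metis
  define N where "N = real (card U) + 1"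
  define \<kappa> where "\<kappa> = min 1 (e / (32 * N))"
  have N: "N > 0" "real (card U) \<le> N" by (simp_all add: N_def add_pos_nonneg add_nonneg_pos)
  have \<kappa>: "0 < \<kappa>" "\<kappa> \<le> 1" "\<kappa> \<le> e / (32 * N)" using e N by (auto simp: \<kappa>_def)
  have \<kappa>e: "8 * N * \<kappa>^2 \<le> e / 4"
  proof -
    have "\<kappa>^2 \<le> \<kappa> * 1" unfolding power2_eq_square using \<kappa> by (intro mult_left_mono) auto
    then have "8 * N * \<kappa>^2 \<le> 8 * N * (e / (32 * N))" using \<kappa> N by (intro mult_left_mono) auto
    then show ?thesis using N by simp
  qed
  \<comment> \<open>What damped tail and replacement error may reach together: 8 N x0 / \<kappa> = e
    / 2. Each receives half of it.\<close>
  define x0 where "x0 = e * \<kappa> / (16 * N)"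
  have x0: "x0 > 0" using e \<kappa> N by (simp add: x0_def)
  obtain d where d: "d > 0" and d1: "\<rho>0 ^ d \<le> min (\<epsilon> / (8 * R^2)) (x0 / (6 * R^2))"
    and d2: "\<eta> ^ d \<le> min (\<epsilon> / (8 * R^2)) (x0 / (6 * R^2))"
    using small_power_exists[OF \<rho>0 \<eta>(2), of "min (\<epsilon> / (8 * R^2)) (x0 / (6 * R^2))"] \<epsilon> R x0 by auto
  have \<rho>d: "\<rho>0 ^ d * R^2 \<le> \<epsilon> / 8"
  proof -
    have "\<rho>0 ^ d * R^2 \<le> \<epsilon> / (8 * R^2) * R^2" using d1 by (intro mult_right_mono) auto
    then show ?thesis using R by simp
  qed
  have \<eta>d: "3 * (\<eta> ^ d)^2 * R^2 \<le> x0 / 2"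
  proof -
    have "(\<eta> ^ d)^2 \<le> \<eta> ^ d * 1" unfolding power2_eq_square
      using \<eta> by (intro mult_left_mono power_le_one) auto
    also have "\<dots> \<le> x0 / (6 * R^2)" using d2 by simp
    finally have "3 * (\<eta> ^ d)^2 * R^2 \<le> 3 * (x0 / (6 * R^2)) * R^2"
      by (intro mult_right_mono mult_left_mono) auto
    then show ?thesis using R by simp
  qed
  \<comment> \<open>Only now, with \<open>d\<close> fixed, can the replacement error, which carries
    a factor \<open>d\<close>, be made small.\<close>
  define t where "t = x0 / (32 * L * d * R^2)"
  have t: "t > 0" using x0 L d R by (simp add: t_def)
  have te: "16 * L * t * d * R^2 = x0 / 2" using L d R by (simp add: t_def field_simps)
  have total: "32 * (\<delta> * R)^2 + 8 * card U * (\<kappa>^2 + (3 * (\<eta> ^ d)^2 * R^2 + 16 * L * t * d * R^2) / \<kappa>) \<le> e"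
  proof -
    define X where "X = 3 * (\<eta> ^ d)^2 * R^2 + 16 * L * t * d * R^2"
    have "X \<le> x0" "X \<ge> 0" using \<eta>d te x0 by (auto simp: X_def)
    then have "8 * card U * (\<kappa>^2 + X / \<kappa>) \<le> 8 * N * (\<kappa>^2 + x0 / \<kappa>)"
      using N \<kappa> by (intro mult_mono add_left_mono divide_right_mono add_nonneg_nonneg divide_nonneg_nonneg) auto
    also have "\<dots> = 8 * N * \<kappa>^2 + e / 2" using N \<kappa> by (simp add: x0_def field_simps)
    finally show ?thesis using \<delta>e \<kappa>e e unfolding X_def by linarith
  qed
  define \<tau>' where "\<tau>' = (t / (4 * L) ^ d)^2 / R"
  have \<tau>': "\<tau>' > 0" "R * \<tau>' \<le> (t / (4 * L) ^ d)^2" using t L R by (simp_all add: \<tau>'_def)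
  \<comment> \<open>\<sigma> makes the contribution of the influential function small;
    \<open>y\<close> then compensates the large factors 1 / \<sigma> and 1 / \<tau>' on the other
    one.\<close>
  define \<sigma> where "\<sigma> = \<epsilon> / (16 * d * R^2)"
  have \<sigma>: "\<sigma> > 0" "\<sigma> * d * R^2 = \<epsilon> / 16" using \<epsilon> d R by (simp_all add: \<sigma>_def)
  define y where "y = \<epsilon> * \<tau>' * \<sigma> / (16 * d * R^2 * R)"
  define \<tau> where "\<tau> = min (min (1/2) \<tau>') y"
  have y: "y > 0" using \<epsilon> \<tau>' \<sigma> d R by (simp add: y_def)
  have \<tau>: "0 < \<tau>" "\<tau> < 1" "\<tau> \<le> \<tau>'" "\<tau> \<le> y" using y \<tau>' by (auto simp: \<tau>_def)
  have \<tau>e: "d * R^2 / \<tau>' * (R * \<tau>) / \<sigma> \<le> \<epsilon> / 16"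
  proof -
    have "d * R^2 / \<tau>' * (R * \<tau>) / \<sigma> \<le> d * R^2 / \<tau>' * (R * y) / \<sigma>"
      using \<tau> \<tau>' \<sigma> R by (intro divide_right_mono mult_left_mono) auto
    also have "\<dots> = \<epsilon> / 16" using \<tau>' \<sigma>(1) d R by (simp add: y_def)
    finally show ?thesis .
  qed
  show ?thesis
  \<comment> \<open>No error term depends on n, so the least positive \<open>n0\<close>
    serves.\<close>
  proof (rule exI[of _ 1], rule exI[of _ d], rule exI[of _ \<tau>], intro conjI allI impI)
    fix n :: nat assume n: "n \<ge> 1"
    \<comment> \<open>The cube has a point, so any \<open>f\<close> in the domain of a map witnesses
      that its body is nonempty; for an empty body that domain is empty.\<close>
    have one: "(\<lambda>i\<in>{..<n}. 1) \<in> cube n" by (auto simp: cube_def)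
    let ?T1 = "gaussian_extension K1 p1 n d \<tau>' \<eta>" and ?T2 = "gaussian_extension K2 p2 n d \<tau>' \<eta>"
    have T1: "?T1 \<in> (cube n \<rightarrow>\<^sub>E K1) \<rightarrow> gaussian_functions n K1"
      using one assms by (intro Pi_I gaussian_extension_measurable) auto
    have T2: "?T2 \<in> (cube n \<rightarrow>\<^sub>E K2) \<rightarrow> gaussian_functions n K2"
      using one assms by (intro Pi_I gaussian_extension_measurable) auto
    show "\<exists>T1 \<in> (cube n \<rightarrow>\<^sub>E K1) \<rightarrow> gaussian_functions n K1.
      \<exists>T2 \<in> (cube n \<rightarrow>\<^sub>E K2) \<rightarrow> gaussian_functions n K2.
        \<forall>\<theta> \<in> {-\<theta>0..\<theta>0}. valid_pair p1 p2 \<theta> \<longrightarrow>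
          (\<forall>f \<in> cube n \<rightarrow>\<^sub>E K1. \<forall>g \<in> cube n \<rightarrow>\<^sub>E K2.
            (MAX i\<in>{..<n}.
               min (MAX j. low_deg_influence p1 n d i (\<lambda>x. f x $ j))
                   (MAX j. low_deg_influence p2 n d i (\<lambda>y. g y $ j))) \<le> \<tau> \<longrightarrow>
            \<bar>discrete_correlation n (biased_pair p1 p2 \<theta>) f g
              - gaussian_correlation n (matching_gaussian p1 p2 \<theta>) (T1 f) (T2 g)\<bar> \<le> \<epsilon>)"
    proof (rule bexI[OF _ T1], rule bexI[OF _ T2], intro ballI impI)
      fix \<theta> f g
      assume \<theta>: "\<theta> \<in> {-\<theta>0..\<theta>0}" "valid_pair p1 p2 \<theta>"
        and f: "f \<in> cube n \<rightarrow>\<^sub>E K1" and g: "g \<in> cube n \<rightarrow>\<^sub>E K2"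
        and M: "(MAX i\<in>{..<n}.
               min (MAX j. low_deg_influence p1 n d i (\<lambda>x. f x $ j))
                   (MAX j. low_deg_influence p2 n d i (\<lambda>y. g y $ j))) \<le> \<tau>"
      have min: "min (MAX j. low_deg_influence p1 n d i (\<lambda>x. f x $ j))
                   (MAX j. low_deg_influence p2 n d i (\<lambda>y. g y $ j)) \<le> \<tau>" if "i < n" for i
        by (rule order_trans[OF Max_ge M]) (use that in auto)
      have "\<bar>discrete_correlation n (biased_pair p1 p2 \<theta>) f g
          - gaussian_correlation n (matching_gaussian p1 p2 \<theta>) (?T1 f) (?T2 g)\<bar>
        \<le> ((\<rho>0 ^ d + (1 - \<eta>^2) / (1 - \<rho>0)) * R^2 + (\<sigma> * d * R^2 + d * R^2 / \<tau>' * (R * \<tau>) / \<sigma>))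
          + (e + t0 * R^2 + e / t0)"
        unfolding R_def
        by (rule correlation_difference[OF assms(1,2) \<theta>(2) assms(5-10) f g \<rho>[OF \<theta>] \<rho>0 \<eta>(1) U \<delta>(2)
              \<kappa>(1,2) t t0 \<sigma>(1) \<tau>(1,3) \<tau>'(2)[unfolded R_def L_def] min total[unfolded R_def L_def]])
      also have "\<dots> \<le> \<epsilon>"
        using \<rho>d noise \<sigma>(2) \<tau>e eb \<epsilon> unfolding distrib_right by linarith
      finally show "\<bar>discrete_correlation n (biased_pair p1 p2 \<theta>) f g
          - gaussian_correlation n (matching_gaussian p1 p2 \<theta>) (?T1 f) (?T2 g)\<bar> \<le> \<epsilon>" .
    qed
  qed (use d \<tau> in auto)
qed

end
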